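(* Fix a constant $0<\epsilon<1$. There is a deterministic fully dynamic algorithm which, given a value $\alpha$ and a sequence of edge insertions and deletions applied to an initially empty graph $G$ on a fixed set of $n$ nodes such that the arboricity of $G$ never exceeds $\alpha$, maintains after every update a proper $(\Delta+(4+\epsilon)\alpha)$-edge coloring of $G$, where $\Delta$ is the maximum degree of $G$ throughout the entire update sequence (the algorithm does not need to know $\Delta$). The algorithm has $O(\log n/\epsilon)$ worst-case recourse per update and $O(\log^2 n\log\Delta/\epsilon^2)$ amortized update time.
   Context: A proper $\lambda$-edge coloring assigns each edge a color from $\{1,\dots,\lfloor\lambda\rfloor\}$ so that edges sharing an endpoint have different colors. The arboricity of $G=(V,E)$ is the smallest integer $\alpha$ with $\lceil|E(G[S])|/(|S|-1)\rceil\le\alpha$ for all $S\subseteq V$, $|S|\ge2$. The recourse of an update is the number of edges whose color changes while processing it; worst-case recourse $\lambda$ means every update has recourse at most $\lambda$. Amortized update time $\lambda$ means any sequence of $T$ updates starting from the empty graph is processed in total time $O(T\lambda)$. *)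

theory Defs
  imports Complex_Main
begin

section \<open>Graphs, arboricity and edge colorings\<close>

text \<open>A simple graph on the nodes \<^term>\<open>{..<n}\<close> is given by its set of edges, each edge being a
  two-element set of nodes.\<close>

definition induced_edges :: "nat set set \<Rightarrow> nat set \<Rightarrow> nat set set" where
  "induced_edges E S = {e \<in> E. e \<subseteq> S}"

definition arboricity :: "nat set \<Rightarrow> nat set set \<Rightarrow> nat" where
  "arboricity V E = (LEAST a::nat. \<forall>S \<subseteq> V. 2 \<le> card S \<longrightarrow>
     \<lceil>real (card (induced_edges E S)) / (real (card S) - 1)\<rceil> \<le> int a)"

definition degree :: "nat set set \<Rightarrow> nat \<Rightarrow> nat" where
  "degree E v = card {e \<in> E. v \<in> e}"

definition max_degree :: "nat \<Rightarrow> nat set set \<Rightarrow> nat" where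
  "max_degree n E = Max (insert 0 (degree E ` {..<n}))"

definition proper_edge_coloring :: "real \<Rightarrow> nat set set \<Rightarrow> (nat set \<rightharpoonup> nat) \<Rightarrow> bool" where
  "proper_edge_coloring l E \<chi> \<longleftrightarrow>
     dom \<chi> = E \<and> ran \<chi> \<subseteq> {1..nat \<lfloor>l\<rfloor>} \<and>
     (\<forall>e\<in>E. \<forall>f\<in>E. e \<noteq> f \<and> e \<inter> f \<noteq> {} \<longrightarrow> \<chi> e \<noteq> \<chi> f)"

text \<open>The edge that is inserted or deleted counts as changing its color, since it becomes colored or
  uncolored.\<close>

definition recourse :: "(nat set \<rightharpoonup> nat) \<Rightarrow> (nat set \<rightharpoonup> nat) \<Rightarrow> nat" where
  "recourse \<chi> \<chi>' = card {e. \<chi> e \<noteq> \<chi>' e}"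

section \<open>Update sequences\<close>

datatype update = Insert nat nat | Delete nat nat

fun apply_update :: "update \<Rightarrow> nat set set \<Rightarrow> nat set set" where
  "apply_update (Insert u v) E = insert {u, v} E"
| "apply_update (Delete u v) E = E - {{u, v}}"

fun valid_update :: "nat \<Rightarrow> nat set set \<Rightarrow> update \<Rightarrow> bool" where
  "valid_update n E (Insert u v) \<longleftrightarrow> u < n \<and> v < n \<and> u \<noteq> v \<and> {u, v} \<notin> E"
| "valid_update n E (Delete u v) \<longleftrightarrow> u < n \<and> v < n \<and> u \<noteq> v \<and> {u, v} \<in> E"

definition graph_after :: "update list \<Rightarrow> nat \<Rightarrow> nat set set" where
  "graph_after us i = fold apply_update (take i us) {}"

definition valid_updates :: "nat \<Rightarrow> nat \<Rightarrow> update list \<Rightarrow> bool" where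
  "valid_updates n \<alpha> us \<longleftrightarrow>
     (\<forall>i < length us. valid_update n (graph_after us i) (us ! i)) \<and>
     (\<forall>i \<le> length us. arboricity {..<n} (graph_after us i) \<le> \<alpha>)"

definition overall_max_degree :: "nat \<Rightarrow> update list \<Rightarrow> nat" where
  "overall_max_degree n us = (MAX i\<in>{..length us}. max_degree n (graph_after us i))"

section \<open>Computational model: a structured word RAM\<close>

text \<open>A program accesses finitely many arrays, named by program constants; every array is a random
  access memory indexed by words. This is a word RAM whose memory is split into interleaved
  segments. A word is a natural number below \<open>W\<close>; an operation whose result is not a word faults,
  so that evaluation has no result. Subtraction is truncated, and comparisons yield 0 or 1.\<close>

type_synonym memory = "nat \<Rightarrow> nat \<Rightarrow> nat"

datatype binop = Plus | Minus | Times | Quotient | Less | Equal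

fun apply_binop :: "binop \<Rightarrow> nat \<Rightarrow> nat \<Rightarrow> nat" where
  "apply_binop Plus x y = x + y"
| "apply_binop Minus x y = x - y"
| "apply_binop Times x y = x * y"
| "apply_binop Quotient x y = x div y"
| "apply_binop Less x y = (if x < y then 1 else 0)"
| "apply_binop Equal x y = (if x = y then 1 else 0)"

datatype expr = Const nat | Read nat expr | Binop binop expr expr

definition as_word :: "nat \<Rightarrow> nat \<Rightarrow> nat option" where
  "as_word W x = (if x < W then Some x else None)"

fun eval :: "nat \<Rightarrow> memory \<Rightarrow> expr \<Rightarrow> nat option" where
  "eval W M (Const k) = as_word W k"
| "eval W M (Read a e) = Option.bind (eval W M e) (\<lambda>i. as_word W (M a i))"
| "eval W M (Binop f e1 e2) =
     Option.bind (eval W M e1) (\<lambda>x. Option.bind (eval W M e2) (\<lambda>y. as_word W (apply_binop f x y)))"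

fun expr_cost :: "expr \<Rightarrow> nat" where
  "expr_cost (Const k) = 1"
| "expr_cost (Read a e) = 1 + expr_cost e"
| "expr_cost (Binop f e1 e2) = 1 + expr_cost e1 + expr_cost e2"

datatype com =
    Skip
  | Write nat expr expr
  | Seq com com
  | If expr com com
  | While expr com

text \<open>\<open>exec W c M t M'\<close>: started in memory \<open>M\<close>, the command \<open>c\<close> terminates without fault in
  memory \<open>M'\<close> after time \<open>t\<close>, where every basic operation takes unit time.\<close>

inductive exec :: "nat \<Rightarrow> com \<Rightarrow> memory \<Rightarrow> nat \<Rightarrow> memory \<Rightarrow> bool" for W :: nat where
  Skip: "exec W Skip M 1 M"
| Write: "eval W M e1 = Some i \<Longrightarrow> eval W M e2 = Some x \<Longrightarrow>
    exec W (Write a e1 e2) M (1 + expr_cost e1 + expr_cost e2) (M(a := (M a)(i := x)))"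
| Seq: "exec W c1 M t1 M1 \<Longrightarrow> exec W c2 M1 t2 M2 \<Longrightarrow> exec W (Seq c1 c2) M (t1 + t2) M2"
| If_true: "eval W M b = Some x \<Longrightarrow> x \<noteq> 0 \<Longrightarrow> exec W c1 M t M' \<Longrightarrow>
    exec W (If b c1 c2) M (1 + expr_cost b + t) M'"
| If_false: "eval W M b = Some 0 \<Longrightarrow> exec W c2 M t M' \<Longrightarrow>
    exec W (If b c1 c2) M (1 + expr_cost b + t) M'"
| While_false: "eval W M b = Some 0 \<Longrightarrow> exec W (While b c) M (1 + expr_cost b) M"
| While_true: "eval W M b = Some x \<Longrightarrow> x \<noteq> 0 \<Longrightarrow> exec W c M t1 M1 \<Longrightarrow>
    exec W (While b c) M1 t2 M2 \<Longrightarrow> exec W (While b c) M (1 + expr_cost b + t1 + t2) M2"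

inductive_cases SkipE: "exec W Skip M t M'"
  and WriteE: "exec W (Write a e1 e2) M t M'"
  and SeqE: "exec W (Seq c1 c2) M t M'"
  and IfE: "exec W (If b c1 c2) M t M'"
  and WhileE: "exec W (While b c) M t M'"

lemma exec_deterministic:
  "exec W c M t M' \<Longrightarrow> exec W c M s M'' \<Longrightarrow> s = t \<and> M'' = M'"
proof (induction arbitrary: s M'' rule: exec.induct)
  case (Skip M)
  then show ?case by (rule SkipE) simp
next
  case (Write M e1 i e2 x a)
  from Write.prems show ?case
    by (rule WriteE) (simp add: Write.hyps)
next
  case (Seq c1 M t1 M1 c2 t2 M2)
  from Seq.prems show ?case
    by (rule SeqE) (use Seq.IH in blast)
next
  case (If_true M b x c1 t M' c2)
  from If_true.prems show ?case
    by (rule IfE) (use If_true.hyps in \<open>auto dest: If_true.IH\<close>)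
next
  case (If_false M b c2 t M' c1)
  from If_false.prems show ?case
    by (rule IfE) (use If_false.hyps in \<open>auto dest: If_false.IH\<close>)
next
  case (While_false M b c)
  from While_false.prems show ?case
    by (rule WhileE) (simp_all add: While_false.hyps)
next
  case (While_true M b x c t1 M1 t2 M2)
  from While_true.prems show ?case
  proof (rule WhileE)
    assume "eval W M b = Some 0"
    with While_true.hyps show ?thesis by simp
  next
    fix y s1 N s2
    assume s: "s = Suc (expr_cost b + s1 + s2)" and c: "exec W c M s1 N"
      and w: "exec W (While b c) N s2 M''"
    from While_true.IH(1)[OF c] have 1: "s1 = t1" "N = M1" by blast+
    with w have "exec W (While b c) M1 s2 M''" by simp
    from While_true.IH(2)[OF this] 1 s show ?thesis by simp
  qed
qed

section \<open>Dynamic algorithms\<close>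

text \<open>A dynamic algorithm is a program that is run once for every update on the persistent memory.
  Array 0 serves as input: cells 0 and 1 initially hold \<open>n\<close> and \<open>\<alpha>\<close>, all other memory is 0, and
  the current update is placed in cells 2 to 4. There is no uncounted preprocessing. Array 1 serves
  as output: it is the table of edge colors, with the color of \<open>{u, v}\<close>, \<open>u < v\<close>, in cell
  \<open>u * n + v\<close>.\<close>

definition initial_memory :: "nat \<Rightarrow> nat \<Rightarrow> memory" where
  "initial_memory n \<alpha> = (\<lambda>_ _. 0)(0 := (\<lambda>_. 0)(0 := n, 1 := \<alpha>))"

fun input_update :: "update \<Rightarrow> memory \<Rightarrow> memory" where
  "input_update (Insert u v) M = M(0 := (M 0)(2 := 1, 3 := u, 4 := v))"
| "input_update (Delete u v) M = M(0 := (M 0)(2 := 0, 3 := u, 4 := v))"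

definition stored_coloring :: "nat \<Rightarrow> nat set set \<Rightarrow> memory \<Rightarrow> (nat set \<rightharpoonup> nat)" where
  "stored_coloring n E M = (\<lambda>e. if e \<in> E then Some (M 1 (Min e * n + Max e)) else None)"

text \<open>\<open>M i\<close> is the memory after \<open>i\<close> updates, \<open>t i\<close> the time spent on the update \<open>us ! i\<close>.\<close>

definition is_run ::
  "nat \<Rightarrow> com \<Rightarrow> nat \<Rightarrow> nat \<Rightarrow> update list \<Rightarrow> (nat \<Rightarrow> memory) \<Rightarrow> (nat \<Rightarrow> nat) \<Rightarrow> bool" where
  "is_run W p n \<alpha> us M t \<longleftrightarrow>
     M 0 = initial_memory n \<alpha> \<and>
     (\<forall>i < length us. exec W p (input_update (us ! i) (M i)) (t i) (M (Suc i)))"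

end

theory Submission
  imports Defs
begin

text \<open>Every node has a level below \<open>L = O(log n / \<epsilon>)\<close>. A node with more than about \<open>(4 + \<epsilon>) \<alpha>\<close>
  neighbors on its own level or above is moved up; a node with fewer than about \<open>(2 + \<epsilon>) \<alpha>\<close>
  neighbors on the level below its own or higher is moved down. The second rule makes the number of
  nodes above a level decrease geometrically, because the arboricity bounds the average degree by
  \<open>2 \<alpha>\<close>. The gap of a factor of 2 between the two thresholds lets a potential function pay for all
  moves.

  An edge \<open>xy\<close> whose lower endpoint is \<open>x\<close> receives the first color that is missing at \<open>y\<close> and at the
  edges from \<open>x\<close> to nodes that are not below \<open>x\<close>. At most one other edge \<open>xz\<close> has this color; it is
  uncolored and treated in the same way. As \<open>z\<close> is on a smaller level than \<open>x\<close>, this stops after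
  \<open>L\<close> steps. Counting trees over the colors of every node and level support the search for the
  color in logarithmic time, and they also serve as adjacency lists.\<close>

text \<open>\<open>N\<close> is five times 1/\<epsilon> rounded up, and all thresholds are scaled by
  \<open>N\<close> to stay within the natural numbers: a node rises when its upper degree exceeds (4
  + 5/N) \<alpha> and falls below (2 + 1/N) \<alpha>. The potential rests on (2 + 1/N)^2 \<le> 4 +
  5/N: the credit that a node holds for a level under it is zero when the node rises, yet when it
  falls the credit covers all that the fall adds elsewhere. A move never changes a color. An edge is
  filed in a bucket, the smaller level of its endpoints, and a move only refiles edges. So recourse
  stems from the recoloring chain alone and is worst-case, while time is amortized over moves. Rises
  create no node that must fall, nor falls one that must rise, so an insertion triggers only rises
  and a deletion only falls. A new color is at most the number of forbidden ones, counted with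
  multiplicity: at most \<Delta> - 1 at \<open>y\<close>, since \<open>xy\<close> is uncolored, and
  about (4 + \<epsilon>) \<alpha> at \<open>x\<close>. Hence \<Delta> is never consulted. Without
  preprocessing, zeroed memory has to be a valid picture of the empty graph.\<close>

definition graph_on :: "nat \<Rightarrow> nat set set \<Rightarrow> bool" where
  "graph_on n E \<longleftrightarrow> (\<forall>e\<in>E. \<exists>u v. e = {u, v} \<and> u < n \<and> v < n \<and> u \<noteq> v)"

definition adj :: "nat set set \<Rightarrow> nat \<Rightarrow> nat set" where
  "adj E v = {w. {v, w} \<in> E}"

definition deg_above :: "nat set set \<Rightarrow> (nat \<Rightarrow> nat) \<Rightarrow> nat \<Rightarrow> nat \<Rightarrow> nat" where
  "deg_above E l v i = card {w \<in> adj E v. i \<le> l w}"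

lemma adj_sym: "w \<in> adj E v \<longleftrightarrow> v \<in> adj E w"
  by (simp add: adj_def insert_commute)

lemma graph_on_adj: "graph_on n E \<Longrightarrow> w \<in> adj E v \<Longrightarrow> v < n \<and> w < n \<and> v \<noteq> w"
  unfolding graph_on_def adj_def by (fastforce simp: doubleton_eq_iff)

lemma finite_adj: "graph_on n E \<Longrightarrow> finite (adj E v)"
  by (rule finite_subset[of _ "{..<n}"]) (auto dest: graph_on_adj)

lemma finite_graph_on: "graph_on n E \<Longrightarrow> finite E"
  by (rule finite_subset[of _ "Pow {..<n}"]) (force simp: graph_on_def)+

lemma card_adj_less: "graph_on n E \<Longrightarrow> v < n \<Longrightarrow> card (adj E v) < n"
proof -
  assume a: "graph_on n E" "v < n"
  have "adj E v \<subseteq> {..<n} - {v}" using a(1) graph_on_adj by blast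
  then have "card (adj E v) \<le> card ({..<n} - {v})" by (intro card_mono) auto
  then show ?thesis using a(2) by simp
qed

lemma bij_adj_edges:
  assumes "graph_on n E"
  shows "bij_betw (\<lambda>w. {v, w}) (adj E v) {e \<in> E. v \<in> e}"
  unfolding bij_betw_def
proof
  show "inj_on (\<lambda>w. {v, w}) (adj E v)" by (auto simp: inj_on_def doubleton_eq_iff)
  show "(\<lambda>w. {v, w}) ` adj E v = {e \<in> E. v \<in> e}"
    using assms unfolding graph_on_def adj_def by (auto simp: image_iff) (metis insertE insert_commute singletonD)
qed

lemma degree_eq_card_adj: "graph_on n E \<Longrightarrow> degree E v = card (adj E v)"
  unfolding degree_def by (rule bij_betw_same_card[OF bij_adj_edges, symmetric])

lemma deg_above_antimono: "graph_on n E \<Longrightarrow> i \<le> k \<Longrightarrow> deg_above E l v k \<le> deg_above E l v i"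
  unfolding deg_above_def by (rule card_mono) (auto intro: finite_subset[OF _ finite_adj])

lemma deg_above_less: "graph_on n E \<Longrightarrow> v < n \<Longrightarrow> deg_above E l v i < n"
proof -
  assume a: "graph_on n E" "v < n"
  have "deg_above E l v i \<le> card (adj E v)" unfolding deg_above_def
    by (rule card_mono) (auto simp: finite_adj[OF a(1)])
  then show ?thesis using card_adj_less[OF a] by simp
qed

text \<open>The \<open>LEAST\<close> is attained because \<open>card E\<close> is one admissible
  value. The denominator \<open>card S - 1\<close> is weakened to \<open>card S\<close>; sets with
  fewer than two nodes induce no edge.\<close>

lemma arboricity_bound:
  assumes g: "graph_on n E" and a: "arboricity {..<n} E \<le> \<alpha>" and S: "S \<subseteq> {..<n}"
  shows "card (induced_edges E S) \<le> \<alpha> * card S"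
proof -
  let ?Q = "\<lambda>a::nat. \<forall>S \<subseteq> {..<n}. 2 \<le> card S \<longrightarrow>
     \<lceil>real (card (induced_edges E S)) / (real (card S) - 1)\<rceil> \<le> int a"
  have fE: "finite E" by (rule finite_graph_on[OF g])
  have "?Q (card E)"
  proof (intro allI impI)
    fix S :: "nat set" assume S: "2 \<le> card S"
    have "card (induced_edges E S) \<le> card E"
      unfolding induced_edges_def by (rule card_mono) (use fE in auto)
    then have "real (card (induced_edges E S)) \<le> real (card E) * 1" by simp
    also have "\<dots> \<le> real (card E) * (real (card S) - 1)" using S by (intro mult_left_mono) auto
    finally show "\<lceil>real (card (induced_edges E S)) / (real (card S) - 1)\<rceil> \<le> int (card E)"
      using S by (simp add: ceiling_le_iff divide_le_eq)
  qed
  then have Q: "?Q (arboricity {..<n} E)" unfolding arboricity_def by (rule LeastI)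
  have fS: "finite S" using S finite_subset by blast
  show ?thesis
  proof (cases "2 \<le> card S")
    case True
    have "\<lceil>real (card (induced_edges E S)) / (real (card S) - 1)\<rceil> \<le> int \<alpha>"
      using Q S True a by (meson order_trans of_nat_mono)
    then have "real (card (induced_edges E S)) \<le> real \<alpha> * (real (card S) - 1)"
      using True by (simp add: ceiling_le_iff divide_le_eq)
    also have "\<dots> \<le> real \<alpha> * real (card S)" by (intro mult_left_mono) auto
    finally show ?thesis by (metis of_nat_le_iff of_nat_mult)
  next
    case False
    have "induced_edges E S = {}"
    proof (rule ccontr)
      assume "induced_edges E S \<noteq> {}"
      then obtain e where e: "e \<in> E" "e \<subseteq> S" by (auto simp: induced_edges_def)
      then obtain u v where uv: "e = {u, v}" "u \<noteq> v" using g by (auto simp: graph_on_def)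
      then have "card e \<le> card S" using e fS card_mono by blast
      then show False using uv False by simp
    qed
    then show ?thesis by simp
  qed
qed

text \<open>Summed over all of \<open>Y\<close>, each induced edge is counted twice; passing from
  \<open>Y\<close> to \<open>X\<close> only drops terms.\<close>

lemma handshake_bound:
  assumes g: "graph_on n E" and XY: "X \<subseteq> Y" "Y \<subseteq> {..<n}"
  shows "(\<Sum>v\<in>X. card (adj E v \<inter> Y)) \<le> 2 * card (induced_edges E Y)"
proof -
  let ?I = "induced_edges E Y"
  have fY: "finite Y" using XY finite_subset by blast
  have fI: "finite ?I" using finite_graph_on[OF g] by (simp add: induced_edges_def)
  have gI: "graph_on n ?I" using g by (auto simp: graph_on_def induced_edges_def)
  have eq: "card (adj E v \<inter> Y) = card {e \<in> ?I. v \<in> e}" if "v \<in> Y" for v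
  proof -
    have "adj E v \<inter> Y = adj ?I v" using that by (auto simp: adj_def induced_edges_def)
    then show ?thesis using bij_betw_same_card[OF bij_adj_edges[OF gI]] by metis
  qed
  have "(\<Sum>v\<in>X. card (adj E v \<inter> Y)) \<le> (\<Sum>v\<in>Y. card (adj E v \<inter> Y))"
    by (rule sum_mono2) (use fY XY in auto)
  also have "\<dots> = (\<Sum>v\<in>Y. card {e \<in> ?I. v \<in> e})" using eq by simp
  also have "\<dots> = 2 * card ?I"
  proof (rule sum_multicount[OF fY fI], intro ballI)
    fix e assume e: "e \<in> ?I"
    then obtain u v where "e = {u, v}" "u \<noteq> v" using g by (auto simp: graph_on_def induced_edges_def)
    moreover have "{i \<in> Y. i \<in> e} = e" using e by (auto simp: induced_edges_def)
    ultimately show "card {i \<in> Y. i \<in> e} = 2" by simp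
  qed
  finally show ?thesis .
qed

text \<open>Bernoulli for (1 + 1/(2N))^(2N) \<ge> 2: a set that shrinks by 1 + 1/(2N) per level is
  halved by \<open>2 * N\<close> levels.\<close>

lemma two_times_power_le: "N \<ge> 1 \<Longrightarrow> 2 * (2 * N) ^ (2 * N) \<le> (2 * N + 1) ^ (2 * N)" for N :: nat
proof -
  assume N: "N \<ge> 1"
  have "1 + real (2 * N) * (1 / real (2 * N)) \<le> (1 + 1 / real (2 * N)) ^ (2 * N)"
    by (rule Bernoulli_inequality) (rule order_trans[of _ 0], auto)
  then have "2 \<le> (1 + 1 / real (2 * N)) ^ (2 * N)" using N by simp
  also have "1 + 1 / real (2 * N) = real (2 * N + 1) / real (2 * N)" using N by (simp add: field_simps)
  finally have "2 * real (2 * N) ^ (2 * N) \<le> real (2 * N + 1) ^ (2 * N)"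
    using N by (simp add: power_divide pos_le_divide_eq del: of_nat_add of_nat_mult)
  then have "real (2 * (2 * N) ^ (2 * N)) \<le> real ((2 * N + 1) ^ (2 * N))"
    by (simp del: of_nat_add of_nat_Suc)
  then show ?thesis by (metis of_nat_le_iff)
qed

text \<open>The nodes of level at least \<open>i + 1\<close> have many neighbors of level at least \<open>i\<close>, so sparsity
  makes the sets of nodes above a level shrink by the factor \<open>1 + 1 / (2 * N)\<close>.\<close>

lemma level_bound:
  assumes g: "graph_on n E" and a: "arboricity {..<n} E \<le> \<alpha>" and pos: "N \<ge> 1" "\<alpha> \<ge> 1"
    and H: "n < 2 ^ H"
    and dn: "\<And>v. v < n \<Longrightarrow> 0 < l v \<Longrightarrow> (2 * N + 1) * \<alpha> \<le> N * deg_above E l v (l v - 1)"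
    and v: "v < n"
  shows "l v < 2 * N * H"
proof -
  define Z where "Z i = {v. v < n \<and> i \<le> l v}" for i
  have fZ: "finite (Z i)" for i by (simp add: Z_def)
  have step: "(2 * N + 1) * card (Z (Suc i)) \<le> 2 * N * card (Z i)" for i
  proof -
    have "(2 * N + 1) * \<alpha> \<le> N * card (adj E v \<inter> Z i)" if "v \<in> Z (Suc i)" for v
    proof -
      have v: "v < n" "Suc i \<le> l v" using that by (auto simp: Z_def)
      have "(2 * N + 1) * \<alpha> \<le> N * deg_above E l v (l v - 1)" using dn v by auto
      also have "\<dots> \<le> N * deg_above E l v i" using deg_above_antimono[OF g] v
        by (simp add: le_diff_conv2)
      also have "{w \<in> adj E v. i \<le> l w} = adj E v \<inter> Z i"
        using graph_on_adj[OF g] by (auto simp: Z_def)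
      then have "deg_above E l v i = card (adj E v \<inter> Z i)" by (simp add: deg_above_def)
      finally show ?thesis .
    qed
    then have "card (Z (Suc i)) * ((2 * N + 1) * \<alpha>) \<le> (\<Sum>v\<in>Z (Suc i). N * card (adj E v \<inter> Z i))"
      using sum_bounded_below[of "Z (Suc i)" "(2 * N + 1) * \<alpha>"] by simp
    also have "\<dots> = N * (\<Sum>v\<in>Z (Suc i). card (adj E v \<inter> Z i))" by (simp add: sum_distrib_left)
    also have "\<dots> \<le> N * (2 * card (induced_edges E (Z i)))"
      by (intro mult_left_mono handshake_bound[OF g]) (auto simp: Z_def)
    also have "\<dots> \<le> N * (2 * (\<alpha> * card (Z i)))"
      by (intro mult_left_mono arboricity_bound[OF g a]) (auto simp: Z_def)
    finally have "\<alpha> * ((2 * N + 1) * card (Z (Suc i))) \<le> \<alpha> * (2 * N * card (Z i))"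
      by (simp add: algebra_simps)
    then show ?thesis using pos by simp
  qed
  have pw: "(2 * N + 1) ^ i * card (Z i) \<le> (2 * N) ^ i * n" for i
  proof (induction i)
    case 0
    show ?case by (simp add: Z_def)
  next
    case (Suc i)
    have "(2 * N + 1) ^ Suc i * card (Z (Suc i)) = (2 * N + 1) ^ i * ((2 * N + 1) * card (Z (Suc i)))"
      by (simp add: algebra_simps)
    also have "\<dots> \<le> (2 * N + 1) ^ i * (2 * N * card (Z i))" by (intro mult_left_mono step) simp
    also have "\<dots> = 2 * N * ((2 * N + 1) ^ i * card (Z i))" by simp
    also have "\<dots> \<le> 2 * N * ((2 * N) ^ i * n)" by (intro mult_left_mono Suc.IH) simp
    finally show ?case by simp
  qed
  let ?i = "2 * N * H"
  \<comment> \<open>Each block of \<open>2 * N\<close> levels halves the set, so after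
    \<open>H\<close> blocks at most n / 2^H < 1 nodes remain.\<close>
  have "(2 * (2 * N) ^ (2 * N)) ^ H \<le> ((2 * N + 1) ^ (2 * N)) ^ H"
    by (rule power_mono[OF two_times_power_le[OF pos(1)]]) simp
  then have "2 ^ H * (2 * N) ^ ?i \<le> (2 * N + 1) ^ ?i"
    by (simp add: power_mult power_mult_distrib)
  then have "2 ^ H * (2 * N) ^ ?i * card (Z ?i) \<le> (2 * N) ^ ?i * n"
    using pw[of ?i] by (meson mult_le_mono1 order_trans)
  then have "(2 * N) ^ ?i * (2 ^ H * card (Z ?i)) \<le> (2 * N) ^ ?i * n"
    by (simp add: mult.assoc mult.left_commute)
  then have "2 ^ H * card (Z ?i) \<le> n" using pos by simp
  then have "card (Z ?i) = 0"
  proof -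
    assume *: "2 ^ H * card (Z ?i) \<le> n"
    show ?thesis
    proof (rule ccontr)
      assume "card (Z ?i) \<noteq> 0"
      then have "2 ^ H * 1 \<le> 2 ^ H * card (Z ?i)" by (intro mult_left_mono) auto
      then show False using * H by linarith
    qed
  qed
  then have "v \<notin> Z ?i" using fZ by auto
  then show ?thesis using v by (simp add: Z_def)
qed

section \<open>The potential of a level assignment\<close>

text \<open>Credit for rises: 4 per level that the lower endpoint can still climb. When the
  endpoints are level, one rise leaves the minimum unchanged, and the extra 2 lets even this rise
  release 2; a rise that ends level with the neighbor still releases 4 - 2.\<close>

definition edge_pot :: "nat \<Rightarrow> (nat \<Rightarrow> nat) \<Rightarrow> nat set \<Rightarrow> nat" where
  "edge_pot L l e = 4 * (L - Min (l ` e)) + (if Min (l ` e) = Max (l ` e) then 2 else 0)"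

text \<open>Credit for falls: for each level \<open>k\<close> under \<open>v\<close>, how far the
  upper degree stays below (2 + 1/N)^2 \<alpha>, scaled by \<open>N ^ 2\<close>. Truncated
  subtraction takes the positive part.\<close>

definition node_pot :: "nat \<Rightarrow> nat \<Rightarrow> nat set set \<Rightarrow> (nat \<Rightarrow> nat) \<Rightarrow> nat \<Rightarrow> nat" where
  "node_pot N \<alpha> E l v = (\<Sum>k<l v. (2 * N + 1) ^ 2 * \<alpha> - N ^ 2 * deg_above E l v k)"

text \<open>A fall with upper degree \<open>d\<close> lowers the node part by more than
  \<open>N * d\<close> and raises the edge part by at most \<open>4 * d\<close>. With the weights
  \<open>N\<close> and 5 = 4 + 1, \<open>N * (d + 1)\<close> is left to pay for the move.\<close>

definition potential :: "nat \<Rightarrow> nat \<Rightarrow> nat \<Rightarrow> nat \<Rightarrow> nat set set \<Rightarrow> (nat \<Rightarrow> nat) \<Rightarrow> nat" where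
  "potential n \<alpha> N L E l = N * (\<Sum>e\<in>E. edge_pot L l e) + 5 * (\<Sum>v<n. node_pot N \<alpha> E l v)"

lemma edge_pot_pair:
  "edge_pot L l {u, v} = 4 * (L - min (l u) (l v)) + (if l u = l v then 2 else 0)"
  by (auto simp: edge_pot_def min_def max_def)

lemma sum_edge_pot_split:
  fixes f :: "nat set \<Rightarrow> nat"
  assumes g: "graph_on n E"
  shows "(\<Sum>e\<in>E. f e) = (\<Sum>e\<in>{e \<in> E. v \<notin> e}. f e) + (\<Sum>w\<in>adj E v. f {v, w})"
proof -
  have "(\<Sum>e\<in>E. f e) = (\<Sum>e\<in>{e \<in> E. v \<notin> e} \<union> {e \<in> E. v \<in> e}. f e)"
    by (rule sum.cong) auto
  also have "\<dots> = (\<Sum>e\<in>{e \<in> E. v \<notin> e}. f e) + (\<Sum>e\<in>{e \<in> E. v \<in> e}. f e)"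
    using finite_graph_on[OF g] by (intro sum.union_disjoint) auto
  also have "(\<Sum>e\<in>{e \<in> E. v \<in> e}. f e) = (\<Sum>w\<in>adj E v. f {v, w})"
    by (rule sum.reindex_bij_betw[OF bij_adj_edges[OF g], symmetric])
  finally show ?thesis .
qed

lemma sum_edge_pot_away:
  "(\<Sum>e\<in>{e \<in> E. v \<notin> e}. edge_pot L (l(v := i)) e) = (\<Sum>e\<in>{e \<in> E. v \<notin> e}. edge_pot L l e)"
proof (rule sum.cong[OF refl])
  fix e assume "e \<in> {e \<in> E. v \<notin> e}"
  then have "l(v := i) ` e = l ` e" by (auto simp: image_iff)
  then show "edge_pot L (l(v := i)) e = edge_pot L l e" by (simp add: edge_pot_def)
qed

lemma deg_above_raise:
  assumes g: "graph_on n E"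
  shows "deg_above E (l(v := Suc (l v))) x k =
    deg_above E l x k + (if v \<in> adj E x \<and> k = Suc (l v) then 1 else 0)"
proof (cases "v \<in> adj E x \<and> k = Suc (l v)")
  case True
  then have "{w \<in> adj E x. k \<le> (l(v := Suc (l v))) w} = insert v {w \<in> adj E x. k \<le> l w}" by auto
  moreover have "v \<notin> {w \<in> adj E x. k \<le> l w}" using True by auto
  ultimately show ?thesis using True finite_adj[OF g] by (simp add: deg_above_def)
next
  case False
  then have "{w \<in> adj E x. k \<le> (l(v := Suc (l v))) w} = {w \<in> adj E x. k \<le> l w}" by auto
  then show ?thesis unfolding deg_above_def if_not_P[OF False] by simp
qed

lemma deg_above_lower:
  assumes g: "graph_on n E" and pos: "0 < l v"
  shows "deg_above E l x k =
    deg_above E (l(v := l v - 1)) x k + (if v \<in> adj E x \<and> k = l v then 1 else 0)"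
  using deg_above_raise[OF g, of "l(v := l v - 1)" v x k] pos by simp

text \<open>Each edge to a node not below \<open>v\<close> releases at least 2, and
  \<open>d + 1 \<le> 2 * d\<close>. The node part cannot grow: a rise never lowers an upper degree,
  and the only new summand, that of \<open>v\<close> at \<open>l v\<close>, is zero.\<close>

lemma potential_raise:
  assumes g: "graph_on n E" and v: "v < n" "l v < L" and N: "N \<ge> 1" "\<alpha> \<ge> 1"
    and viol: "(4 * N + 5) * \<alpha> < N * deg_above E l v (l v)"
  shows "potential n \<alpha> N L E (l(v := Suc (l v))) + N * (deg_above E l v (l v) + 1)
    \<le> potential n \<alpha> N L E l"
proof -
  let ?l = "l(v := Suc (l v))" and ?d = "deg_above E l v (l v)"
  have "node_pot N \<alpha> E ?l x \<le> node_pot N \<alpha> E l x" for x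
  proof (cases "x = v")
    case True
    have nv: "v \<notin> adj E v" using graph_on_adj[OF g] by blast
    \<comment> \<open>4N^2 + 4N + 1 \<le> 4N^2 + 5N is why the rising threshold carries the constant
      5; it truncates the new summand to zero.\<close>
    have "(2 * N + 1) ^ 2 * \<alpha> \<le> N * ((4 * N + 5) * \<alpha>)"
      using N(1) by (simp add: power2_eq_square algebra_simps)
    also have "\<dots> \<le> N * (N * ?d)" using viol by (intro mult_left_mono) auto
    finally have "(2 * N + 1) ^ 2 * \<alpha> - N ^ 2 * ?d = 0" by (simp add: power2_eq_square)
    then show ?thesis using True nv by (simp add: node_pot_def deg_above_raise[OF g])
  next
    case False
    then show ?thesis unfolding node_pot_def deg_above_raise[OF g]
      by (auto intro!: sum_mono diff_le_mono2)
  qed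
  then have nodes: "(\<Sum>x<n. node_pot N \<alpha> E ?l x) \<le> (\<Sum>x<n. node_pot N \<alpha> E l x)"
    by (intro sum_mono)
  have "2 * ?d = (\<Sum>w\<in>adj E v. if l v \<le> l w then 2 else 0)"
    using finite_adj[OF g] by (simp add: deg_above_def sum.If_cases Int_def)
  then have "(\<Sum>w\<in>adj E v. edge_pot L ?l {v, w}) + 2 * ?d =
      (\<Sum>w\<in>adj E v. edge_pot L ?l {v, w} + (if l v \<le> l w then 2 else 0))"
    by (simp add: sum.distrib)
  also have "\<dots> \<le> (\<Sum>w\<in>adj E v. edge_pot L l {v, w})"
  proof (rule sum_mono)
    fix w assume "w \<in> adj E v"
    then have "w \<noteq> v" using graph_on_adj[OF g] by blast
    then show "edge_pot L ?l {v, w} + (if l v \<le> l w then 2 else 0) \<le> edge_pot L l {v, w}"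
      using v by (simp add: edge_pot_pair min_def) arith
  qed
  finally have edges: "(\<Sum>e\<in>E. edge_pot L ?l e) + 2 * ?d \<le> (\<Sum>e\<in>E. edge_pot L l e)"
    by (simp add: sum_edge_pot_split[OF g, of _ v] sum_edge_pot_away)
  have "?d \<noteq> 0" using viol by (intro notI) simp
  then have "N * (?d + 1) \<le> N * (2 * ?d)" by (intro mult_left_mono) auto
  moreover have "N * (\<Sum>e\<in>E. edge_pot L ?l e) + N * (2 * ?d) \<le> N * (\<Sum>e\<in>E. edge_pot L l e)"
    using edges by (metis distrib_left mult_le_mono2)
  ultimately show ?thesis using nodes unfolding potential_def by linarith
qed

text \<open>With \<open>d\<close> the degree above \<open>l v - 1\<close>, node \<open>v\<close>
  gives up its top summand, which the violation makes at least N^2 d + N d. At most \<open>d\<close>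
  higher neighbors gain \<open>N ^ 2\<close> each. The remaining N d, taken five times, covers 4 N d
  for the edges and the cost of the move.\<close>

lemma potential_lower:
  assumes g: "graph_on n E" and v: "v < n" "0 < l v" "l v \<le> L" and N: "N \<ge> 1"
    and viol: "N * deg_above E l v (l v - 1) < (2 * N + 1) * \<alpha>"
  shows "potential n \<alpha> N L E (l(v := l v - 1)) + N * (deg_above E l v (l v) + 1)
    \<le> potential n \<alpha> N L E l"
proof -
  let ?l = "l(v := l v - 1)" and ?d = "deg_above E l v (l v - 1)"
  let ?D = "(2 * N + 1) ^ 2 * \<alpha>"
  have nv: "v \<notin> adj E v" using graph_on_adj[OF g] by blast
  have du: "deg_above E l v (l v) \<le> ?d" by (rule deg_above_antimono[OF g]) simp
  \<comment> \<open>A neighbor \<open>x\<close> notices the fall only in its summand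
    \<open>k = l v\<close>, which it has only if it lies above \<open>v\<close>.\<close>
  let ?c = "\<lambda>x. if x \<in> adj E v \<and> l v < l x then N ^ 2 else 0"
  have other: "node_pot N \<alpha> E ?l x \<le> node_pot N \<alpha> E l x + ?c x" if "x \<noteq> v" for x
  proof -
    have "node_pot N \<alpha> E ?l x \<le>
      (\<Sum>k<l x. (?D - N ^ 2 * deg_above E l x k) + (if k = l v then if v \<in> adj E x then N ^ 2 else 0 else 0))"
      unfolding node_pot_def using that
      by (auto intro!: sum_mono simp: deg_above_lower[where l = l and v = v, OF g v(2)] algebra_simps)
    also have "\<dots> = node_pot N \<alpha> E l x + ?c x"
      by (simp add: sum.distrib node_pot_def sum.delta adj_sym[of x])
    finally show ?thesis .
  qed
  have self: "node_pot N \<alpha> E ?l v + (?D - N ^ 2 * ?d) = node_pot N \<alpha> E l v"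
  proof -
    have "deg_above E ?l v k = deg_above E l v k" for k
      using deg_above_lower[where l = l and v = v, OF g v(2), of v k] nv by simp
    moreover have "{..<l v} = insert (l v - 1) {..<l v - 1}" using v by auto
    ultimately show ?thesis using nv by (simp add: node_pot_def)
  qed
  have "(\<Sum>x<n. node_pot N \<alpha> E ?l x) + (?D - N ^ 2 * ?d) =
      (\<Sum>x\<in>{..<n} - {v}. node_pot N \<alpha> E ?l x) + node_pot N \<alpha> E l v"
    using self v by (simp add: sum.remove[of "{..<n}" v])
  also have "\<dots> \<le> (\<Sum>x\<in>{..<n} - {v}. node_pot N \<alpha> E l x + ?c x) + (node_pot N \<alpha> E l v + ?c v)"
    using other by (intro add_mono sum_mono) auto
  also have "\<dots> = (\<Sum>x<n. node_pot N \<alpha> E l x + ?c x)"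
    using v by (simp add: sum.remove[of "{..<n}" v])
  also have "\<dots> = (\<Sum>x<n. node_pot N \<alpha> E l x) + N ^ 2 * card {x \<in> {..<n}. x \<in> adj E v \<and> l v < l x}"
    by (simp add: sum.distrib sum.If_cases Int_def)
  also have "\<dots> \<le> (\<Sum>x<n. node_pot N \<alpha> E l x) + N ^ 2 * ?d"
  proof -
    have "card {x \<in> {..<n}. x \<in> adj E v \<and> l v < l x} \<le> ?d"
      unfolding deg_above_def by (rule card_mono) (auto simp: finite_adj[OF g])
    then show ?thesis by simp
  qed
  finally have nodes: "(\<Sum>x<n. node_pot N \<alpha> E ?l x) + (?D - N ^ 2 * ?d)
      \<le> (\<Sum>x<n. node_pot N \<alpha> E l x) + N ^ 2 * ?d" .
  have "(\<Sum>w\<in>adj E v. edge_pot L ?l {v, w}) \<le>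
      (\<Sum>w\<in>adj E v. edge_pot L l {v, w} + (if l v - 1 \<le> l w then 4 else 0))"
  proof (rule sum_mono)
    fix w assume "w \<in> adj E v"
    then have "w \<noteq> v" using graph_on_adj[OF g] by blast
    then show "edge_pot L ?l {v, w} \<le> edge_pot L l {v, w} + (if l v - 1 \<le> l w then 4 else 0)"
      using v by (simp add: edge_pot_pair min_def) arith
  qed
  also have "\<dots> = (\<Sum>w\<in>adj E v. edge_pot L l {v, w}) + 4 * ?d"
    using finite_adj[OF g] by (simp add: deg_above_def sum.If_cases Int_def sum.distrib)
  finally have edges: "(\<Sum>e\<in>E. edge_pot L ?l e) \<le> (\<Sum>e\<in>E. edge_pot L l e) + 4 * ?d"
    by (simp add: sum_edge_pot_split[OF g, of _ v] sum_edge_pot_away)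
  \<comment> \<open>Multiplying the violated threshold by another \<open>2 * N + 1\<close> reaches
    \<open>?D\<close>, which therefore exceeds \<open>N ^ 2 * ?d\<close> twice: once for the
    subtracted degree of \<open>v\<close>, once for the gain of its neighbors.\<close>
  have "N * ?d + 1 \<le> (2 * N + 1) * \<alpha>" using viol by simp
  then have "(2 * N + 1) * (N * ?d + 1) \<le> (2 * N + 1) * ((2 * N + 1) * \<alpha>)"
    by (intro mult_left_mono) auto
  then have D: "2 * (N ^ 2 * ?d) + N * ?d + 2 * N + 1 \<le> ?D"
    by (simp add: power2_eq_square algebra_simps)
  have "N * (\<Sum>e\<in>E. edge_pot L ?l e) \<le> N * (\<Sum>e\<in>E. edge_pot L l e) + 4 * (N * ?d)"
    using mult_left_mono[OF edges, of N] by (simp add: algebra_simps)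
  moreover have "N * (deg_above E l v (l v) + 1) \<le> N * ?d + N" using du by simp
  ultimately show ?thesis using nodes D unfolding potential_def by linarith
qed

lemma deg_above_insert_edge:
  assumes "graph_on n E"
  shows "deg_above E l x k \<le> deg_above (insert e E) l x k"
    and "deg_above (insert e E) l x k \<le> deg_above E l x k + (if x \<in> e then 1 else 0)"
proof -
  have "finite (adj (insert e E) x)"
  proof (rule finite_subset)
    show "adj (insert e E) x \<subseteq> adj E x \<union> {w. e = {x, w}}" by (auto simp: adj_def)
    have "finite {w. e = {x, w}}"
      by (cases "\<exists>w. e = {x, w}") (auto simp: doubleton_eq_iff)
    then show "finite (adj E x \<union> {w. e = {x, w}})" using finite_adj[OF assms] by simp
  qed
  then show "deg_above E l x k \<le> deg_above (insert e E) l x k"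
    unfolding deg_above_def by (intro card_mono) (auto simp: adj_def)
  show "deg_above (insert e E) l x k \<le> deg_above E l x k + (if x \<in> e then 1 else 0)"
  proof (cases "\<exists>w. e = {x, w}")
    case True
    then obtain w where w: "e = {x, w}" by blast
    have "{w \<in> adj (insert e E) x. k \<le> l w} \<subseteq> insert w {w \<in> adj E x. k \<le> l w}"
      by (auto simp: adj_def w doubleton_eq_iff)
    then have "deg_above (insert e E) l x k \<le> card (insert w {w \<in> adj E x. k \<le> l w})"
      unfolding deg_above_def using finite_adj[OF assms] by (intro card_mono) auto
    also have "\<dots> \<le> deg_above E l x k + 1"
      unfolding deg_above_def using finite_adj[OF assms] by (simp add: card_insert_if)
    finally show ?thesis using w by simp
  next
    case False
    then have "adj (insert e E) x = adj E x" by (auto simp: adj_def)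
    then show ?thesis by (simp add: deg_above_def)
  qed
qed

text \<open>Only the new edge adds potential; growing degrees can only shrink the summands of the
  nodes.\<close>

lemma potential_insert:
  assumes g: "graph_on n E" and e: "e = {u, v}"
  shows "potential n \<alpha> N L (insert e E) l \<le> potential n \<alpha> N L E l + N * (4 * L + 2)"
proof -
  have "(\<Sum>e\<in>insert e E. edge_pot L l e) \<le> (\<Sum>e\<in>E. edge_pot L l e) + (4 * L + 2)"
  proof (cases "e \<in> E")
    case False
    have "edge_pot L l e \<le> 4 * L + 2" by (auto simp: e edge_pot_pair)
    then show ?thesis using False finite_graph_on[OF g] by simp
  qed (simp add: insert_absorb)
  then have "N * (\<Sum>e\<in>insert e E. edge_pot L l e) \<le> N * (\<Sum>e\<in>E. edge_pot L l e) + N * (4 * L + 2)"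
    by (metis distrib_left mult_le_mono2)
  moreover have "(\<Sum>x<n. node_pot N \<alpha> (insert e E) l x) \<le> (\<Sum>x<n. node_pot N \<alpha> E l x)"
    unfolding node_pot_def
    by (intro sum_mono diff_le_mono2 mult_left_mono deg_above_insert_edge[OF g]) auto
  ultimately show ?thesis by (simp add: potential_def)
qed

text \<open>Each of the two endpoints may lose one neighbor at each of at most \<open>L\<close>
  levels, at \<open>N ^ 2\<close> per level and with weight 5; this is the factor 10.\<close>

lemma potential_delete:
  assumes g: "graph_on n E" and e: "e = {u, v}" and L: "\<And>x. x < n \<Longrightarrow> l x \<le> L"
  shows "potential n \<alpha> N L (E - {e}) l \<le> potential n \<alpha> N L E l + 10 * (N ^ 2 * L)"
proof -
  have g': "graph_on n (E - {e})" using g by (simp add: graph_on_def)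
  have "(\<Sum>e\<in>E - {e}. edge_pot L l e) \<le> (\<Sum>e\<in>E. edge_pot L l e)"
    using finite_graph_on[OF g] by (intro sum_mono2) auto
  moreover have "(\<Sum>x<n. node_pot N \<alpha> (E - {e}) l x) \<le>
      (\<Sum>x<n. node_pot N \<alpha> E l x + (if x \<in> e then N ^ 2 * L else 0))"
  proof (rule sum_mono)
    fix x assume x: "x \<in> {..<n}"
    have d: "deg_above E l x k \<le> deg_above (E - {e}) l x k + (if x \<in> e then 1 else 0)" for k
    proof (cases "e \<in> E")
      case True
      then show ?thesis using deg_above_insert_edge(2)[OF g', of e l x k] by (simp add: insert_absorb)
    qed simp
    have "node_pot N \<alpha> (E - {e}) l x \<le>
      (\<Sum>k<l x. ((2 * N + 1) ^ 2 * \<alpha> - N ^ 2 * deg_above E l x k) + (if x \<in> e then N ^ 2 else 0))"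
      unfolding node_pot_def
    proof (rule sum_mono)
      fix k
      have "N ^ 2 * deg_above E l x k \<le> N ^ 2 * deg_above (E - {e}) l x k + (if x \<in> e then N ^ 2 else 0)"
        using mult_left_mono[OF d[of k], of "N ^ 2"] by (auto simp: algebra_simps split: if_splits)
      then show "(2 * N + 1) ^ 2 * \<alpha> - N ^ 2 * deg_above (E - {e}) l x k
          \<le> (2 * N + 1) ^ 2 * \<alpha> - N ^ 2 * deg_above E l x k + (if x \<in> e then N ^ 2 else 0)" by linarith
    qed
    also have "\<dots> = node_pot N \<alpha> E l x + l x * (if x \<in> e then N ^ 2 else 0)"
      by (simp add: sum.distrib node_pot_def)
    also have "\<dots> \<le> node_pot N \<alpha> E l x + (if x \<in> e then N ^ 2 * L else 0)"
      using L[of x] x by (auto simp: mult.commute)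
    finally show "node_pot N \<alpha> (E - {e}) l x \<le> node_pot N \<alpha> E l x + (if x \<in> e then N ^ 2 * L else 0)" .
  qed
  moreover have "(\<Sum>x<n. if x \<in> e then N ^ 2 * L else 0) \<le> 2 * (N ^ 2 * L)"
  proof -
    have "card ({..<n} \<inter> e) \<le> card e" by (rule card_mono) (auto simp: e)
    also have "\<dots> \<le> 2" by (simp add: e card_insert_if)
    finally have "card ({..<n} \<inter> e) * (N ^ 2 * L) \<le> 2 * (N ^ 2 * L)" by (intro mult_right_mono) auto
    then show ?thesis by (simp add: sum.If_cases)
  qed
  ultimately show ?thesis unfolding potential_def sum.distrib
    using mult_left_mono[of "\<Sum>e\<in>E - {e}. edge_pot L l e" "\<Sum>e\<in>E. edge_pot L l e" N] by linarith
qed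

lemma card_graph_on: "graph_on n E \<Longrightarrow> card E \<le> n * n"
proof -
  assume g: "graph_on n E"
  have "E \<subseteq> (\<lambda>(u, v). {u, v}) ` ({..<n} \<times> {..<n})"
  proof
    fix e assume "e \<in> E"
    then obtain u v where "e = {u, v}" "u < n" "v < n" using g unfolding graph_on_def by blast
    then show "e \<in> (\<lambda>(u, v). {u, v}) ` ({..<n} \<times> {..<n})" by (intro image_eqI[of _ _ "(u, v)"]) auto
  qed
  then have "card E \<le> card ((\<lambda>(u, v). {u, v}) ` ({..<n} \<times> {..<n}))" by (intro card_mono) auto
  also have "\<dots> \<le> card ({..<n} \<times> {..<n})" by (rule card_image_le) simp
  finally show ?thesis by simp
qed

text \<open>A crude polynomial bound. The potential limits the size of the work stack, and that size
  has to fit into a word.\<close>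

lemma potential_le:
  assumes g: "graph_on n E" and L: "\<And>x. x < n \<Longrightarrow> l x \<le> L"
  shows "potential n \<alpha> N L E l \<le> N * (n * n * (4 * L + 2)) + 5 * (n * (L * ((2 * N + 1) ^ 2 * \<alpha>)))"
proof -
  have "(\<Sum>e\<in>E. edge_pot L l e) \<le> of_nat (card E) * (4 * L + 2)"
    by (rule sum_bounded_above) (auto simp: edge_pot_def)
  then have "(\<Sum>e\<in>E. edge_pot L l e) \<le> card E * (4 * L + 2)" by simp
  also have "\<dots> \<le> n * n * (4 * L + 2)" by (intro mult_right_mono card_graph_on[OF g]) simp
  finally have "N * (\<Sum>e\<in>E. edge_pot L l e) \<le> N * (n * n * (4 * L + 2))" by simp
  moreover have "node_pot N \<alpha> E l x \<le> L * ((2 * N + 1) ^ 2 * \<alpha>)" if "x < n" for x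
  proof -
    have "node_pot N \<alpha> E l x \<le> card {..<l x} * ((2 * N + 1) ^ 2 * \<alpha>)"
      unfolding node_pot_def by (rule sum_bounded_above[where 'a = nat, simplified]) simp
    also have "\<dots> \<le> L * ((2 * N + 1) ^ 2 * \<alpha>)" using L[OF that] by (intro mult_right_mono) auto
    finally show ?thesis .
  qed
  then have "(\<Sum>x<n. node_pot N \<alpha> E l x) \<le> n * (L * ((2 * N + 1) ^ 2 * \<alpha>))"
    using sum_bounded_above[of "{..<n}" "node_pot N \<alpha> E l"] by simp
  ultimately show ?thesis unfolding potential_def by linarith
qed

section \<open>Reasoning about programs\<close>

text \<open>A weakest precondition for fault-free termination. The rules for it are equivalences, so
  that rewriting executes a program symbolically and accumulates its time inside the
  postcondition.\<close>

definition runs :: "nat \<Rightarrow> com \<Rightarrow> memory \<Rightarrow> (nat \<Rightarrow> memory \<Rightarrow> bool) \<Rightarrow> bool" where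
  "runs W c M Q \<longleftrightarrow> (\<exists>t M'. exec W c M t M' \<and> Q t M')"

lemma runs_conseq:
  "runs W c M Q \<Longrightarrow> (\<And>t M'. Q t M' \<Longrightarrow> R t M') \<Longrightarrow> runs W c M R"
  unfolding runs_def by blast

lemma runs_Skip: "runs W Skip M Q \<longleftrightarrow> Q 1 M"
  unfolding runs_def by (auto intro: exec.Skip[simplified] elim: SkipE)

lemma runs_Write: "runs W (Write a e1 e2) M Q \<longleftrightarrow>
    (\<exists>i x. eval W M e1 = Some i \<and> eval W M e2 = Some x \<and>
       Q (1 + expr_cost e1 + expr_cost e2) (M(a := (M a)(i := x))))"
  unfolding runs_def by (auto intro: exec.Write[simplified] elim!: WriteE)

lemma runs_Seq: "runs W (Seq c1 c2) M Q \<longleftrightarrow>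
    runs W c1 M (\<lambda>t1 M1. runs W c2 M1 (\<lambda>t2. Q (t1 + t2)))"
  unfolding runs_def by (blast intro: exec.Seq elim: SeqE)

lemma runs_If: "runs W (If b c1 c2) M Q \<longleftrightarrow>
    (\<exists>x. eval W M b = Some x \<and> runs W (if x = 0 then c2 else c1) M (\<lambda>t. Q (1 + expr_cost b + t)))"
proof
  assume "runs W (If b c1 c2) M Q"
  then obtain t M' where e: "exec W (If b c1 c2) M t M'" and Q: "Q t M'" unfolding runs_def by blast
  from e show "\<exists>x. eval W M b = Some x \<and>
      runs W (if x = 0 then c2 else c1) M (\<lambda>t. Q (1 + expr_cost b + t))"
    by (rule IfE) (use Q in \<open>auto simp: runs_def\<close>)
next
  assume "\<exists>x. eval W M b = Some x \<and> runs W (if x = 0 then c2 else c1) M (\<lambda>t. Q (1 + expr_cost b + t))"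
  then obtain x t M' where x: "eval W M b = Some x" and e: "exec W (if x = 0 then c2 else c1) M t M'"
    and Q: "Q (1 + expr_cost b + t) M'" unfolding runs_def by blast
  have "exec W (If b c1 c2) M (1 + expr_cost b + t) M'"
    using x e by (cases "x = 0") (use exec.If_true exec.If_false in fastforce)+
  then show "runs W (If b c1 c2) M Q" using Q unfolding runs_def by blast
qed

lemma runs_While: "runs W (While b c) M Q \<longleftrightarrow>
    (\<exists>x. eval W M b = Some x \<and>
       (if x = 0 then Q (1 + expr_cost b) M
        else runs W c M (\<lambda>t1 M1. runs W (While b c) M1 (\<lambda>t2. Q (1 + expr_cost b + t1 + t2)))))"
proof
  assume "runs W (While b c) M Q"
  then obtain t M' where e: "exec W (While b c) M t M'" and Q: "Q t M'" unfolding runs_def by blast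
  from e show "\<exists>x. eval W M b = Some x \<and>
       (if x = 0 then Q (1 + expr_cost b) M
        else runs W c M (\<lambda>t1 M1. runs W (While b c) M1 (\<lambda>t2. Q (1 + expr_cost b + t1 + t2))))"
    by (rule WhileE) (use Q in \<open>auto simp: runs_def\<close>)
next
  assume "\<exists>x. eval W M b = Some x \<and>
       (if x = 0 then Q (1 + expr_cost b) M
        else runs W c M (\<lambda>t1 M1. runs W (While b c) M1 (\<lambda>t2. Q (1 + expr_cost b + t1 + t2))))"
  then obtain x where x: "eval W M b = Some x" and r: "if x = 0 then Q (1 + expr_cost b) M
        else runs W c M (\<lambda>t1 M1. runs W (While b c) M1 (\<lambda>t2. Q (1 + expr_cost b + t1 + t2)))" by blast
  show "runs W (While b c) M Q"
  proof (cases "x = 0")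
    case True
    then show ?thesis using x r exec.While_false unfolding runs_def by fastforce
  next
    case False
    then show ?thesis using x r exec.While_true[OF x False] unfolding runs_def by (auto, blast)
  qed
qed

text \<open>The literal \<open>Const 1\<close> is to survive simplification.\<close>

declare One_nat_def [simp del]

lemmas runs_basic = runs_Skip runs_Write runs_Seq runs_If

lemma as_word_less [simp]: "x < W \<Longrightarrow> as_word W x = Some x"
  by (simp add: as_word_def)

text \<open>A scalar variable is an array of which only cell 0 is used.\<close>

abbreviation Var :: "nat \<Rightarrow> expr" where "Var a \<equiv> Read a (Const 0)"
abbreviation Assign :: "nat \<Rightarrow> expr \<Rightarrow> com" (infix "::=" 70) where "a ::= e \<equiv> Write a (Const 0) e"
abbreviation Then :: "com \<Rightarrow> com \<Rightarrow> com" (infixr ";;" 60) where "c1 ;; c2 \<equiv> Seq c1 c2"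
abbreviation EPlus (infixl "\<oplus>" 85) where "x \<oplus> y \<equiv> Binop Plus x y"
abbreviation EMinus (infixl "\<ominus>" 85) where "x \<ominus> y \<equiv> Binop Minus x y"
abbreviation ETimes (infixl "\<otimes>" 90) where "x \<otimes> y \<equiv> Binop Times x y"
abbreviation EQuot (infixl "\<oslash>" 90) where "x \<oslash> y \<equiv> Binop Quotient x y"
abbreviation ELess (infix "\<prec>" 80) where "x \<prec> y \<equiv> Binop Less x y"
abbreviation EEqual (infix "\<doteq>" 80) where "x \<doteq> y \<equiv> Binop Equal x y"

abbreviation (input) unchanged :: "nat set \<Rightarrow> memory \<Rightarrow> memory \<Rightarrow> bool" where
  "unchanged X M M' \<equiv> \<forall>r. r \<notin> X \<longrightarrow> M' r = M r"

section \<open>Counting trees\<close>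

text \<open>A set \<open>F\<close> of colors below \<open>P = 2 ^ H\<close> is stored as a binary heap with the leaf \<open>P + c\<close> for
  the color \<open>c\<close>; every node holds the number of elements of \<open>F\<close> below it.\<close>

definition anc :: "nat \<Rightarrow> nat \<Rightarrow> bool" where
  "anc x y \<longleftrightarrow> (\<exists>h. y div 2 ^ h = x)"

lemma anc_step: "0 < x \<Longrightarrow> anc x y \<longleftrightarrow> x = y \<or> anc x (y div 2)"
proof
  assume "anc x y" then obtain h where h: "y div 2 ^ h = x" by (auto simp: anc_def)
  then show "x = y \<or> anc x (y div 2)"
    by (cases h) (auto simp: anc_def div_mult2_eq)
next
  assume "x = y \<or> anc x (y div 2)"
  then show "anc x y" unfolding anc_def
    by (metis div_by_1 div_mult2_eq power_0 power_Suc)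
qed

lemma anc_le: "anc x y \<Longrightarrow> x \<le> y"
  by (auto simp: anc_def)

definition tree_count :: "nat \<Rightarrow> nat set \<Rightarrow> nat \<Rightarrow> nat" where
  "tree_count H F x = card {c \<in> F. anc x (2 ^ H + c)}"

text \<open>A heap node at height \<open>h\<close> covers a block of \<open>2 ^ h\<close> leaves.
  The point is that \<open>x\<close> can only meet a leaf path at this height: a smaller height
  would put the leaf below \<open>2 ^ H\<close>, a larger one at \<open>2 * 2 ^ H\<close> or
  beyond.\<close>

lemma anc_interval:
  assumes x: "x * 2 ^ h = 2 ^ H + a" "a < 2 ^ H" and h: "h \<le> H" and c: "c < 2 ^ H"
  shows "anc x (2 ^ H + c) \<longleftrightarrow> a \<le> c \<and> c < a + 2 ^ h"
proof
  assume "a \<le> c \<and> c < a + 2 ^ h"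
  then have "(2 ^ H + c) div 2 ^ h = x" using x
    by (intro div_nat_eqI) (auto simp: algebra_simps)
  then show "anc x (2 ^ H + c)" by (auto simp: anc_def)
next
  assume "anc x (2 ^ H + c)"
  then obtain k where k: "(2 ^ H + c) div 2 ^ k = x" by (auto simp: anc_def)
  then have b: "x * 2 ^ k \<le> 2 ^ H + c" "2 ^ H + c < (x + 1) * 2 ^ k"
    using div_less_iff_less_mult[of "2 ^ k" "2 ^ H + c" "x + 1"]
      less_eq_div_iff_mult_less_eq[of "2 ^ k" x "2 ^ H + c"] by simp_all
  have "\<not> k < h"
  proof
    assume "k < h"
    have "2 ^ (Suc H - h) * 2 ^ h = 2 * (2::nat) ^ H" using h
      by (simp add: power_add[symmetric] del: power_Suc) simp
    then have "x * 2 ^ h < 2 ^ (Suc H - h) * 2 ^ h" using x by simp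
    then have "x + 1 \<le> 2 ^ (Suc H - h)" by simp
    then have "(x + 1) * 2 ^ k \<le> 2 ^ (Suc H - h) * 2 ^ k" by (rule mult_right_mono) simp
    also have "\<dots> = 2 ^ (Suc H - h + k)" by (simp add: power_add)
    also have "\<dots> \<le> 2 ^ H" using \<open>k < h\<close> h by (intro power_increasing) auto
    finally show False using b by simp
  qed
  moreover have "\<not> h < k"
  proof
    assume "h < k"
    then have "x * 2 ^ Suc h \<le> x * 2 ^ k" by (intro mult_left_mono power_increasing) auto
    then show False using b x c unfolding power_Suc by linarith
  qed
  ultimately have "k = h" by simp
  then show "a \<le> c \<and> c < a + 2 ^ h" using b x by (simp add: algebra_simps)
qed

text \<open>A leaf path cannot start at \<open>x\<close>, since \<open>x < 2 ^ H\<close>, so it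
  enters \<open>x\<close> through a child. Siblings never share a path: at different heights one
  would be at most half of the other.\<close>

lemma anc_children:
  assumes x: "0 < x" "x < 2 ^ H"
  shows "anc x (2 ^ H + c) \<longleftrightarrow> anc (2 * x) (2 ^ H + c) \<or> anc (2 * x + 1) (2 ^ H + c)"
    and "\<not> (anc (2 * x) y \<and> anc (2 * x + 1) y)"
proof -
  show "anc x (2 ^ H + c) \<longleftrightarrow> anc (2 * x) (2 ^ H + c) \<or> anc (2 * x + 1) (2 ^ H + c)"
  proof
    assume "anc x (2 ^ H + c)"
    then obtain h where h: "(2 ^ H + c) div 2 ^ h = x" by (auto simp: anc_def)
    then obtain k where "h = Suc k" using x by (cases h) auto
    then have "(2 ^ H + c) div 2 ^ k div 2 = x" using h
      by (metis div_mult2_eq power_Suc2)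
    then have "(2 ^ H + c) div 2 ^ k = 2 * x \<or> (2 ^ H + c) div 2 ^ k = 2 * x + 1" by linarith
    then show "anc (2 * x) (2 ^ H + c) \<or> anc (2 * x + 1) (2 ^ H + c)" by (auto simp: anc_def)
  next
    assume "anc (2 * x) (2 ^ H + c) \<or> anc (2 * x + 1) (2 ^ H + c)"
    then obtain k where "(2 ^ H + c) div 2 ^ k = 2 * x \<or> (2 ^ H + c) div 2 ^ k = 2 * x + 1"
      by (auto simp: anc_def)
    then have "(2 ^ H + c) div 2 ^ k div 2 = x" by auto
    then have "(2 ^ H + c) div 2 ^ Suc k = x" by (metis div_mult2_eq power_Suc2)
    then show "anc x (2 ^ H + c)" by (auto simp: anc_def simp del: power_Suc)
  qed
  show "\<not> (anc (2 * x) y \<and> anc (2 * x + 1) y)"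
  proof
    assume "anc (2 * x) y \<and> anc (2 * x + 1) y"
    then obtain i j where ij: "y div 2 ^ i = 2 * x" "y div 2 ^ j = 2 * x + 1" by (auto simp: anc_def)
    have *: "y div 2 ^ q \<le> (y div 2 ^ p) div 2" if "p < q" for p q
    proof -
      have "y div 2 ^ p div 2 = y div 2 ^ Suc p" by (metis div_mult2_eq power_Suc2)
      moreover have "y div 2 ^ q \<le> y div 2 ^ Suc p"
        using that by (intro div_le_mono2 power_increasing) auto
      ultimately show ?thesis by simp
    qed
    show False
    proof (cases i j rule: linorder_cases)
      case less
      then show False using *[of i j] ij by simp
    next
      case equal
      then show False using ij by simp
    next
      case greater
      then show False using *[of j i] ij x by simp
    qed
  qed
qed

context
  fixes H :: nat and F :: "nat set"
  assumes F: "F \<subseteq> {..<2 ^ H}"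
begin

lemma finite_colors: "finite F" using F finite_subset by blast

lemma tree_count_children:
  assumes x: "0 < x" "x < 2 ^ H"
  shows "tree_count H F x = tree_count H F (2 * x) + tree_count H F (2 * x + 1)"
proof -
  have "{c \<in> F. anc x (2 ^ H + c)} = {c \<in> F. anc (2 * x) (2 ^ H + c)} \<union> {c \<in> F. anc (2 * x + 1) (2 ^ H + c)}"
    using anc_children(1)[OF x] by blast
  moreover have "{c \<in> F. anc (2 * x) (2 ^ H + c)} \<inter> {c \<in> F. anc (2 * x + 1) (2 ^ H + c)} = {}"
    using anc_children(2)[OF x] by blast
  ultimately show ?thesis unfolding tree_count_def using finite_colors
    by (simp add: card_Un_disjoint)
qed

lemma tree_count_root: "tree_count H F 1 = card F"
proof -
  have "anc 1 (2 ^ H + c)" if "c < 2 ^ H" for c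
    using anc_interval[of 1 H H 0 c] that by simp
  then have "{c \<in> F. anc 1 (2 ^ H + c)} = F" using F by auto
  then show ?thesis by (simp add: tree_count_def)
qed

lemma tree_count_leaf: "c < 2 ^ H \<Longrightarrow> tree_count H F (2 ^ H + c) = (if c \<in> F then 1 else 0)"
proof -
  assume c: "c < 2 ^ H"
  have "anc (2 ^ H + c) (2 ^ H + d) \<longleftrightarrow> d = c" if "d \<in> F" for d
    using anc_interval[of "2 ^ H + c" 0 H c d] c F that by auto
  then have "{d \<in> F. anc (2 ^ H + c) (2 ^ H + d)} = (if c \<in> F then {c} else {})" by auto
  then show ?thesis by (simp add: tree_count_def)
qed

lemma tree_count_le: "tree_count H F x \<le> card F"
  unfolding tree_count_def using finite_colors by (intro card_mono) auto

lemma card_colors_le: "card F \<le> 2 ^ H"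
  using card_mono[OF _ F] by simp

lemma tree_count_insert:
  "c \<notin> F \<Longrightarrow> tree_count H (insert c F) x = tree_count H F x + (if anc x (2 ^ H + c) then 1 else 0)"
proof -
  assume c: "c \<notin> F"
  have "{d \<in> insert c F. anc x (2 ^ H + d)} =
    (if anc x (2 ^ H + c) then insert c {d \<in> F. anc x (2 ^ H + d)} else {d \<in> F. anc x (2 ^ H + d)})"
    by auto
  then show ?thesis unfolding tree_count_def using finite_colors c by simp
qed

lemma tree_count_remove:
  "c \<in> F \<Longrightarrow> tree_count H (F - {c}) x = tree_count H F x - (if anc x (2 ^ H + c) then 1 else 0)"
proof -
  assume c: "c \<in> F"
  have "{d \<in> F - {c}. anc x (2 ^ H + d)} =
    (if anc x (2 ^ H + c) then {d \<in> F. anc x (2 ^ H + d)} - {c} else {d \<in> F. anc x (2 ^ H + d)})"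
    by auto
  then show ?thesis unfolding tree_count_def using finite_colors c by simp
qed

end

section \<open>Adding and removing one color of a tree\<close>

definition tree_update_loop :: "binop \<Rightarrow> com" where
  "tree_update_loop f = While (Var 14) (Write 5 (Var 12 \<oplus> Var 14) (Binop f (Read 5 (Var 12 \<oplus> Var 14)) (Const 1)) ;;
       14 ::= Var 14 \<oslash> Const 2)"

definition tree_update :: "binop \<Rightarrow> com" where
  "tree_update f = 14 ::= Var 10 \<oplus> Var 13 ;;
     tree_update_loop f"

text \<open>Repeated halving visits exactly the ancestors. Cell \<open>K\<close> would be heap node
  0, where the loop stops, hence the guard \<open>K < i\<close>. The result describes all of array 5
  because the trees of all nodes and buckets share it.\<close>

lemma runs_tree_update_loop:
  assumes "M 14 0 < 2 ^ h" and "M 12 0 = K" and "K + 2 ^ h \<le> W" "3 \<le> W" "f = Plus \<or> f = Minus"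
    and "\<And>i. K < i \<Longrightarrow> i \<le> K + M 14 0 \<Longrightarrow> M 5 i + 1 < W"
  shows "runs W (tree_update_loop f) M
    (\<lambda>t M'. t \<le> 25 * h + 3 \<and> unchanged {5, 14} M M' \<and>
       M' 5 = (\<lambda>i. if K < i \<and> anc (i - K) (M 14 0) then apply_binop f (M 5 i) 1 else M 5 i))"
  using assms
proof (induction h arbitrary: M)
  case 0
  have "\<not> anc (i - K) 0" if "K < i" for i using that anc_le by fastforce
  with 0 show ?case unfolding tree_update_loop_def by (subst runs_While) (auto simp: fun_eq_iff)
next
  case (Suc h)
  show ?case
  proof (cases "M 14 0 = 0")
    case True
    have "\<not> anc (i - K) 0" if "K < i" for i using that anc_le by fastforce
    with True Suc.prems show ?thesis unfolding tree_update_loop_def by (subst runs_While) (auto simp: fun_eq_iff)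
  next
    case False
    define x where "x = M 14 0"
    have x: "0 < x" "x < 2 ^ Suc h" "K + x < W" using False Suc.prems by (auto simp: x_def)
    have m: "M 5 (K + x) + 1 < W" using Suc.prems(6)[of "K + x"] x by (simp add: x_def)
    have fm: "apply_binop f (M 5 (K + x)) 1 < W" using m Suc.prems(5) by auto
    define M1 where "M1 = M(5 := (M 5)(K + x := apply_binop f (M 5 (K + x)) 1),
      14 := (M 14)(0 := x div 2))"
    have "runs W (tree_update_loop f) M1
      (\<lambda>t M'. t \<le> 25 * h + 3 \<and> unchanged {5, 14} M1 M' \<and>
       M' 5 = (\<lambda>i. if K < i \<and> anc (i - K) (M1 14 0) then apply_binop f (M1 5 i) 1 else M1 5 i))"
    proof (rule Suc.IH)
      show "M1 14 0 < 2 ^ h" using x by (auto simp: M1_def)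
      show "M1 12 0 = K" "K + 2 ^ h \<le> W" using Suc.prems by (auto simp: M1_def)
      show "M1 5 i + 1 < W" if "K < i" "i \<le> K + M1 14 0" for i
      proof -
        have "i < K + x" using that x by (simp add: M1_def)
        then show ?thesis using Suc.prems(6)[of i] that by (simp add: M1_def x_def)
      qed
    qed (use Suc.prems in auto)
    then have "runs W (tree_update_loop f) M1
      (\<lambda>t M'. 23 + t \<le> 25 * Suc h + 3 \<and> unchanged {5, 14} M M' \<and>
       M' 5 = (\<lambda>i. if K < i \<and> anc (i - K) x then apply_binop f (M 5 i) 1 else M 5 i))"
    proof (rule runs_conseq)
      fix t M'
      assume *: "t \<le> 25 * h + 3 \<and> unchanged {5, 14} M1 M' \<and>
       M' 5 = (\<lambda>i. if K < i \<and> anc (i - K) (M1 14 0) then apply_binop f (M1 5 i) 1 else M1 5 i)"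
      have "M' 5 i = (if K < i \<and> anc (i - K) x then apply_binop f (M 5 i) 1 else M 5 i)" for i
      proof (cases "i = K + x")
        case True
        \<comment> \<open>The cell just written is not met again, so it changes exactly
          once.\<close>
        have "\<not> anc x (x div 2)" using anc_le[of x "x div 2"] x by auto
        moreover have "anc x x" using anc_step[of x x] x by simp
        ultimately show ?thesis using * True x by (simp add: M1_def)
      next
        case False
        then have "K < i \<Longrightarrow> anc (i - K) x \<longleftrightarrow> anc (i - K) (x div 2)"
          using anc_step[of "i - K" x] by auto
        then show ?thesis using * False by (auto simp: M1_def)
      qed
      with * show "23 + t \<le> 25 * Suc h + 3 \<and> unchanged {5, 14} M M' \<and>
       M' 5 = (\<lambda>i. if K < i \<and> anc (i - K) x then apply_binop f (M 5 i) 1 else M 5 i)"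
        by (auto simp: M1_def)
    qed
    moreover have "M 5 (K + x) < W" using m by simp
    ultimately show ?thesis using x fm Suc.prems(2,3,4) False unfolding tree_update_loop_def
      by (subst runs_While) (simp add: runs_basic x_def[symmetric] M1_def)
  qed
qed

lemma runs_tree_update:
  assumes "M 10 0 = 2 ^ H" "M 12 0 = K" "M 13 0 = c" "c < 2 ^ H" "K + 2 * 2 ^ H \<le> W" "3 \<le> W"
    and "f = Plus \<or> f = Minus"
    and "\<And>i. K < i \<Longrightarrow> i < K + 2 * 2 ^ H \<Longrightarrow> M 5 i + 1 < W"
  shows "runs W (tree_update f) M
    (\<lambda>t M'. t \<le> 25 * (H + 2) \<and> unchanged {5, 14} M M' \<and>
       M' 5 = (\<lambda>i. if K < i \<and> anc (i - K) (2 ^ H + c) then apply_binop f (M 5 i) 1 else M 5 i))"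
proof -
  let ?M = "M(14 := (M 14)(0 := 2 ^ H + c))"
  have *: "runs W (tree_update_loop f) ?M
    (\<lambda>t M'. t \<le> 25 * Suc H + 3 \<and> unchanged {5, 14} ?M M' \<and>
       M' 5 = (\<lambda>i. if K < i \<and> anc (i - K) (?M 14 0) then apply_binop f (?M 5 i) 1 else ?M 5 i))"
    by (rule runs_tree_update_loop) (use assms in auto)
  have "2 ^ H + c < W" using assms(4,5) by linarith
  then show ?thesis unfolding tree_update_def using assms(1-6)
    by (simp add: runs_basic) (rule runs_conseq[OF *], auto)
qed

section \<open>Searching for a color outside two sets\<close>

definition find_free_loop :: com where
  "find_free_loop = While (Var 14 \<prec> Var 10)
       (19 ::= Var 19 \<oslash> Const 2 ;; 14 ::= Const 2 \<otimes> Var 14 ;;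
        If (Read 5 (Var 12 \<oplus> Var 14) \<oplus> Read 5 (Var 18 \<oplus> Var 14) \<prec> Var 19)
          Skip (14 ::= Var 14 \<oplus> Const 1))"

definition find_free :: com where
  "find_free = 14 ::= Const 1 ;; 19 ::= Var 10 ;;
     find_free_loop ;;
     13 ::= Var 14 \<ominus> Var 10"

context
  fixes H W :: nat and F1 F2 :: "nat set"
  assumes F1: "F1 \<subseteq> {..<2 ^ H}" and F2: "F2 \<subseteq> {..<2 ^ H}" and W: "4 * 2 ^ H \<le> W"
begin

abbreviation (input) find_free_post where
  "find_free_post M h T \<equiv> \<lambda>t (M'::memory). t \<le> 50 * h + 6 \<and> unchanged {14, 19} M M' \<and>
     (\<exists>c<2 ^ H. M' 14 0 = 2 ^ H + c \<and> c \<le> T \<and>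
        tree_count H F1 (2 ^ H + c) + tree_count H F2 (2 ^ H + c) = 0)"

text \<open>Invariant: the subtree at \<open>M 14 0\<close>, whose leaves start at color
  \<open>a\<close>, counts fewer than \<open>2 ^ h\<close> elements, those of both sets counted
  twice, and \<open>a\<close> plus this count is at most \<open>T\<close>. A step to the right skips
  as many colors as there are leaves under the left child, but that child counts at least as many
  elements, so the bound by \<open>T\<close> survives. The color found need not be the least free
  one.\<close>

lemma runs_find_free_loop:
  assumes "M 10 0 = 2 ^ H" "M 12 0 = K1" "M 18 0 = K2" "K1 + 2 * 2 ^ H \<le> W" "K2 + 2 * 2 ^ H \<le> W"
    and "\<And>x. 0 < x \<Longrightarrow> x < 2 * 2 ^ H \<Longrightarrow> M 5 (K1 + x) = tree_count H F1 x"
    and "\<And>x. 0 < x \<Longrightarrow> x < 2 * 2 ^ H \<Longrightarrow> M 5 (K2 + x) = tree_count H F2 x"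
    and "M 19 0 = 2 ^ h" "M 14 0 * 2 ^ h = 2 ^ H + a" "a < 2 ^ H"
    and "tree_count H F1 (M 14 0) + tree_count H F2 (M 14 0) < 2 ^ h"
    and "a + (tree_count H F1 (M 14 0) + tree_count H F2 (M 14 0)) \<le> T"
  shows "runs W find_free_loop M (find_free_post M h T)"
  using assms
proof (induction h arbitrary: M a)
  case 0
  have "2 ^ H + a < W" using 0 W by linarith
  with 0 show ?case using W unfolding find_free_loop_def by (subst runs_While) auto
next
  case (Suc h)
  define x where "x = M 14 0"
  have x2: "2 * x * 2 ^ h = 2 ^ H + a" using Suc.prems(9) by (simp add: x_def)
  have "0 < x" using x2 by (cases "x = 0") auto
  have "x * 2 * 1 \<le> x * 2 * 2 ^ h" by (intro mult_left_mono) auto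
  then have "x * 2 \<le> 2 ^ H + a" using x2 by linarith
  then have xP: "x < 2 ^ H" using Suc.prems(10) by simp
  have ch1: "tree_count H F1 x = tree_count H F1 (2 * x) + tree_count H F1 (2 * x + 1)"
    and ch2: "tree_count H F2 x = tree_count H F2 (2 * x) + tree_count H F2 (2 * x + 1)"
    using tree_count_children[OF F1 \<open>0 < x\<close> xP] tree_count_children[OF F2 \<open>0 < x\<close> xP] by auto
  have M5: "M 5 (K1 + 2 * x) = tree_count H F1 (2 * x)" "M 5 (K2 + 2 * x) = tree_count H F2 (2 * x)"
    using Suc.prems(6,7) \<open>0 < x\<close> xP by auto
  have hH: "Suc h \<le> H"
  proof (rule ccontr)
    assume "\<not> Suc h \<le> H"
    then have "(2::nat) ^ Suc H \<le> 2 * 2 ^ h" by (metis not_less_eq_eq power_Suc power_increasing one_le_numeral)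
    also have "\<dots> \<le> x * (2 * 2 ^ h)" using \<open>0 < x\<close> by simp
    finally show False using x2 Suc.prems(10) by (simp add: algebra_simps)
  qed
  have hP: "2 ^ h < W"
  proof -
    have "(2::nat) ^ h \<le> 2 ^ H" using hH by (intro power_increasing) auto
    then show ?thesis using W one_le_power[of "2::nat" H] by linarith
  qed
  have hP2: "2 * 2 ^ h < W"
  proof -
    have "(2::nat) ^ Suc h \<le> 2 ^ H" using hH by (intro power_increasing) auto
    then show ?thesis using W xP by simp
  qed
  have c1: "tree_count H F1 (2 * x) \<le> 2 ^ H" "tree_count H F2 (2 * x) \<le> 2 ^ H"
    using tree_count_le card_colors_le F1 F2 order_trans by metis+
  have bnds: "2 * x < W" "2 * x + 1 < W" "K1 + 2 * x < W" "K2 + 2 * x < W" "x < W" "2 ^ H < W" "2 < W"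
    "tree_count H F1 (2 * x) < W" "tree_count H F2 (2 * x) < W"
    "tree_count H F1 (2 * x) + tree_count H F2 (2 * x) < W"
    using Suc.prems(4,5) xP W c1 \<open>0 < x\<close> by linarith+
  let ?left = "tree_count H F1 (2 * x) + tree_count H F2 (2 * x) < 2 ^ h"
  define y where "y = (if ?left then 2 * x else 2 * x + 1)"
  define b where "b = (if ?left then a else a + 2 ^ h)"
  define M1 where "M1 = M(19 := (M 19)(0 := 2 ^ h), 14 := (M 14)(0 := y))"
  have "b < 2 ^ H"
  proof (cases ?left)
    case False
    \<comment> \<open>the offset \<open>a\<close> is a multiple of \<open>2 ^ Suc h\<close>\<close>
    have "a + 2 ^ h < 2 ^ H"
    proof -
      have e: "(2::nat) ^ H = 2 ^ (H - Suc h) * 2 ^ Suc h" using hH by (simp add: power_add[symmetric] del: power_Suc)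
      have "x * 2 ^ Suc h < 2 * 2 ^ (H - Suc h) * 2 ^ Suc h" 
      proof -
        have "x * 2 ^ Suc h < 2 * 2 ^ H" using x2 Suc.prems(10) by (simp add: algebra_simps)
        then show ?thesis using e by (metis mult.assoc)
      qed
      then have "x + 1 \<le> 2 * 2 ^ (H - Suc h)" by simp
      then have "(x + 1) * 2 ^ Suc h \<le> 2 * 2 ^ (H - Suc h) * 2 ^ Suc h" by (intro mult_right_mono) auto
      then have "(x + 1) * 2 ^ Suc h \<le> 2 * 2 ^ H" using e by (simp add: mult.assoc)
      moreover have "(0::nat) < 2 ^ h" by simp
      moreover have "(x + 1) * 2 ^ Suc h = 2 ^ H + a + 2 * 2 ^ h" using x2 by (simp add: algebra_simps)
      ultimately show ?thesis by linarith
    qed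
    then show ?thesis using False by (simp add: b_def)
  qed (use Suc.prems(10) in \<open>simp add: b_def\<close>)
  have IH: "runs W find_free_loop M1 (find_free_post M1 h T)"
  proof (rule Suc.IH[of M1 b])
    show "M1 14 0 * 2 ^ h = 2 ^ H + b" using x2 by (simp add: M1_def y_def b_def algebra_simps)
    show "tree_count H F1 (M1 14 0) + tree_count H F2 (M1 14 0) < 2 ^ h"
      using Suc.prems(11) ch1 ch2 by (simp add: M1_def y_def x_def[symmetric])
    show "b + (tree_count H F1 (M1 14 0) + tree_count H F2 (M1 14 0)) \<le> T"
      using Suc.prems(12) ch1 ch2 by (simp add: M1_def y_def b_def x_def[symmetric])
  qed (use Suc.prems \<open>b < 2 ^ H\<close> in \<open>auto simp: M1_def\<close>)
  have IH': "runs W find_free_loop M1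
    (\<lambda>t M'. 45 + t \<le> 50 * Suc h + 6 \<and> unchanged {14, 19} M M' \<and>
       (\<exists>c<2 ^ H. M' 14 0 = 2 ^ H + c \<and> c \<le> T \<and>
          tree_count H F1 (2 ^ H + c) + tree_count H F2 (2 ^ H + c) = 0))"
    by (rule runs_conseq[OF IH]) (auto simp: M1_def)
  show ?case
  proof (cases ?left)
    case True
    then have e: "M(19 := (M 19)(0 := 2 ^ h), 14 := (M 14)(0 := 2 * x)) = M1" by (simp add: M1_def y_def)
    show ?thesis unfolding find_free_loop_def using bnds hP hP2 xP Suc.prems(1-3,8) M5 True
      by (subst runs_While)
        (auto simp: runs_basic x_def[symmetric] e find_free_loop_def[symmetric] intro!: runs_conseq[OF IH'])
  next
    case False
    then have e: "M(19 := (M 19)(0 := 2 ^ h), 14 := (M 14)(0 := 2 * x + 1)) = M1" by (simp add: M1_def y_def)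
    show ?thesis unfolding find_free_loop_def using bnds hP hP2 xP Suc.prems(1-3,8) M5 False
      by (subst runs_While)
        (auto simp: runs_basic x_def[symmetric] e find_free_loop_def[symmetric] intro!: runs_conseq[OF IH'])
  qed
qed

text \<open>At the root the invariant of the loop holds with \<open>T\<close> the total number of
  forbidden colors. The resulting bound on the color is what limits the palette.\<close>

lemma runs_find_free:
  assumes "M 10 0 = 2 ^ H" "M 12 0 = K1" "M 18 0 = K2" "K1 + 2 * 2 ^ H \<le> W" "K2 + 2 * 2 ^ H \<le> W"
    and "\<And>x. 0 < x \<Longrightarrow> x < 2 * 2 ^ H \<Longrightarrow> M 5 (K1 + x) = tree_count H F1 x"
    and "\<And>x. 0 < x \<Longrightarrow> x < 2 * 2 ^ H \<Longrightarrow> M 5 (K2 + x) = tree_count H F2 x"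
    and card: "card F1 + card F2 < 2 ^ H"
  shows "runs W find_free M
    (\<lambda>t M'. t \<le> 50 * (H + 1) \<and> unchanged {13, 14, 19} M M' \<and>
       M' 13 0 < 2 ^ H \<and> M' 13 0 \<notin> F1 \<and> M' 13 0 \<notin> F2 \<and> M' 13 0 \<le> card F1 + card F2)"
proof -
  let ?M = "M(14 := (M 14)(0 := 1), 19 := (M 19)(0 := 2 ^ H))"
  have *: "runs W find_free_loop ?M (find_free_post ?M H (card F1 + card F2))"
    by (rule runs_find_free_loop[where a = 0 and ?K1.0 = K1 and ?K2.0 = K2])
      (use assms tree_count_root[OF F1] tree_count_root[OF F2] in auto)
  have "2 ^ H < W" "2 < W" using W one_le_power[of "2::nat" H] by linarith+
  then show ?thesis unfolding find_free_def using assms(1)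
    apply (simp add: runs_basic)
    apply (rule runs_conseq[OF *])
    apply (elim conjE exE)
    subgoal for t M' c
      using W tree_count_leaf[OF F1, of c] tree_count_leaf[OF F2, of c] by (auto split: if_splits)
    done
qed

end

section \<open>Selecting a color by its rank\<close>

definition select_loop :: com where
  "select_loop = While (Var 14 \<prec> Var 10)
     (14 ::= Const 2 \<otimes> Var 14 ;;
      If (Var 21 \<prec> Read 5 (Var 12 \<oplus> Var 14)) Skip
        (21 ::= Var 21 \<ominus> Read 5 (Var 12 \<oplus> Var 14) ;; 14 ::= Var 14 \<oplus> Const 1))"

definition select :: com where
  "select = 14 ::= Const 1 ;; 21 ::= Var 20 ;; select_loop ;; 13 ::= Var 14 \<ominus> Var 10"

context
  fixes H W :: nat and F :: "nat set"
  assumes F: "F \<subseteq> {..<2 ^ H}" and W: "4 * 2 ^ H \<le> W"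
begin

abbreviation (input) select_post where
  "select_post M h k \<equiv> \<lambda>t (M'::memory). t \<le> 50 * h + 6 \<and> unchanged {14, 21} M M' \<and>
     (\<exists>c\<in>F. M' 14 0 = 2 ^ H + c \<and> card {d \<in> F. d < c} = k)"

text \<open>Invariant: the elements before the first color \<open>a\<close> of the current subtree,
  together with the rank still sought inside it, add up to \<open>k\<close>.\<close>

lemma runs_select_loop:
  assumes "M 10 0 = 2 ^ H" "M 12 0 = K" "K + 2 * 2 ^ H \<le> W"
    and "\<And>x. 0 < x \<Longrightarrow> x < 2 * 2 ^ H \<Longrightarrow> M 5 (K + x) = tree_count H F x"
    and "h \<le> H" "M 14 0 * 2 ^ h = 2 ^ H + a" "a < 2 ^ H"
    and "M 21 0 < tree_count H F (M 14 0)" "card {c \<in> F. c < a} + M 21 0 = k"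
  shows "runs W select_loop M (select_post M h k)"
  using assms
proof (induction h arbitrary: M a)
  case 0
  have "2 ^ H + a < W" using 0 W by linarith
  moreover have "a \<in> F" using 0 tree_count_leaf[OF F, of a] by (auto split: if_splits)
  moreover have "M 21 0 = 0" using 0 tree_count_leaf[OF F, of a] by (auto split: if_splits)
  ultimately show ?case using W 0 unfolding select_loop_def by (subst runs_While) auto
next
  case (Suc h)
  define x where "x = M 14 0"
  have x2: "2 * x * 2 ^ h = 2 ^ H + a" using Suc.prems(6) by (simp add: x_def)
  have "0 < x" using x2 by (cases "x = 0") auto
  have "x * 2 * 1 \<le> x * 2 * 2 ^ h" by (intro mult_left_mono) auto
  then have "x * 2 \<le> 2 ^ H + a" using x2 by linarith
  then have xP: "x < 2 ^ H" using Suc.prems(7) by simp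
  note ch = tree_count_children[OF F \<open>0 < x\<close> xP]
  have M5: "M 5 (K + 2 * x) = tree_count H F (2 * x)" using Suc.prems(4) \<open>0 < x\<close> xP by auto
  have c1: "tree_count H F y \<le> 2 ^ H" for y
    using tree_count_le[OF F] card_colors_le[OF F] order_trans by metis
  have bnds: "2 * x < W" "2 * x + 1 < W" "K + 2 * x < W" "x < W" "2 ^ H < W" "2 < W"
    "tree_count H F (2 * x) < W" "M 21 0 < W"
    using Suc.prems(3,8) xP W c1[of x] c1[of "2 * x"] \<open>0 < x\<close> unfolding x_def[symmetric] by linarith+
  let ?left = "M 21 0 < tree_count H F (2 * x)"
  have lt: "{c \<in> F. c < a + 2 ^ h} = {c \<in> F. c < a} \<union> {c \<in> F. anc (2 * x) (2 ^ H + c)}"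
    using anc_interval[OF x2 Suc.prems(7)] Suc.prems(5) F by auto
  have dj: "{c \<in> F. c < a} \<inter> {c \<in> F. anc (2 * x) (2 ^ H + c)} = {}"
    using anc_interval[OF x2 Suc.prems(7)] Suc.prems(5) F by auto
  have card: "card {c \<in> F. c < a + 2 ^ h} = card {c \<in> F. c < a} + tree_count H F (2 * x)"
    unfolding lt tree_count_def by (rule card_Un_disjoint) (use finite_colors[OF F] dj in auto)
  show ?case
  proof (cases ?left)
    case True
    define M1 where "M1 = M(14 := (M 14)(0 := 2 * x))"
    have IH: "runs W select_loop M1
      (select_post M1 h k)"
      by (rule Suc.IH[of M1 a]) (use Suc.prems True x2 in \<open>auto simp: M1_def\<close>)
    show ?thesis unfolding select_loop_def using bnds xP Suc.prems(1-3) M5 True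
      by (subst runs_While) (auto simp: runs_basic x_def[symmetric] M1_def[symmetric]
        select_loop_def[symmetric] intro!: runs_conseq[OF IH], auto simp: M1_def)
  next
    case False
    define M1 where "M1 = M(21 := (M 21)(0 := M 21 0 - tree_count H F (2 * x)), 14 := (M 14)(0 := 2 * x + 1))"
    have "a + 2 ^ h < 2 ^ H"
    proof -
      have "2 * x + 1 < 2 * 2 ^ (H - h)"
      proof -
        have "2 * x * 2 ^ h < 2 * 2 ^ (H - h) * 2 ^ h" using x2 Suc.prems(5,7)
          by (simp add: power_add[symmetric] mult.assoc)
        then have "2 * x < 2 * 2 ^ (H - h)" by simp
        moreover have "even ((2::nat) ^ (H - h))" using Suc.prems(5) by simp
        ultimately show ?thesis by presburger
      qed
      then have "(2 * x + 1) * 2 ^ h < 2 * 2 ^ (H - h) * 2 ^ h" by simp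
      then have "(2 * x + 1) * 2 ^ h < 2 * 2 ^ H" using Suc.prems(5)
        by (simp add: power_add[symmetric] mult.assoc)
      then show ?thesis using x2 by (simp add: algebra_simps)
    qed
    then have IH: "runs W select_loop M1
      (select_post M1 h k)"
      by (intro Suc.IH[of M1 "a + 2 ^ h"])
        (use Suc.prems False x2 card ch in \<open>auto simp: M1_def algebra_simps x_def[symmetric]\<close>)
    show ?thesis unfolding select_loop_def using bnds xP Suc.prems(1-3) M5 False
      by (subst runs_While) (auto simp: runs_basic x_def[symmetric]
        select_loop_def[symmetric] M1_def[symmetric] intro!: runs_conseq[OF IH], auto simp: M1_def)
  qed
qed

lemma runs_select:
  assumes "M 10 0 = 2 ^ H" "M 12 0 = K" "K + 2 * 2 ^ H \<le> W"
    and "\<And>x. 0 < x \<Longrightarrow> x < 2 * 2 ^ H \<Longrightarrow> M 5 (K + x) = tree_count H F x"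
    and k: "M 20 0 < card F"
  shows "runs W select M
    (\<lambda>t M'. t \<le> 50 * (H + 1) \<and> unchanged {13, 14, 21} M M' \<and>
       M' 13 0 \<in> F \<and> card {d \<in> F. d < M' 13 0} = M 20 0)"
proof -
  let ?M = "M(14 := (M 14)(0 := 1), 21 := (M 21)(0 := M 20 0))"
  have *: "runs W select_loop ?M (select_post ?M H (M 20 0))"
    by (rule runs_select_loop[where a = 0]) (use assms tree_count_root[OF F] in auto)
  have "2 ^ H < W" "2 < W" "M 20 0 < W" using W k card_colors_le[OF F] one_le_power[of "2::nat" H]
    by linarith+
  then show ?thesis unfolding select_def using assms(1)
    apply (simp add: runs_basic)
    apply (rule runs_conseq[OF *])
    apply (elim conjE bexE)
    subgoal for t M' c
      using W F by (auto 0 4)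
    done
qed

end

section \<open>The stored graph\<close>

text \<open>An edge is mapped to its color and bucket. The bucket is recorded rather than derived
  from the levels, because while a node is being moved some of its edges are still in the old
  bucket.\<close>

type_synonym state = "nat set \<rightharpoonup> nat \<times> nat"

text \<open>Scalars 15 and 16 hold an edge, 13 its color (counted from 0) and 17 its bucket. Arrays 1 and 2
  hold the color and the bucket of every edge, array 3 the neighbor along a color, array 4 the levels
  and array 5 one counting tree for the colors of every bucket of every node; the bucket number
  \<open>B - 1\<close> stands for all edges at the node. Scalars 10 and 11 hold \<open>2 ^ H\<close> and \<open>B\<close>.\<close>

definition keyed :: "binop \<Rightarrow> nat \<Rightarrow> expr \<Rightarrow> com" where
  "keyed f r e = 12 ::= (Var r \<otimes> Var 11 \<oplus> e) \<otimes> Var 11 ;; tree_update f"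

definition edge_update :: "binop \<Rightarrow> com" where
  "edge_update f = keyed f 15 (Var 17) ;; keyed f 15 (Var 11 \<ominus> Const 1) ;;
     keyed f 16 (Var 17) ;; keyed f 16 (Var 11 \<ominus> Const 1)"

definition remove_edge :: com where
  "remove_edge = 13 ::= Read 1 (Var 15 \<otimes> Var 0 \<oplus> Var 16) \<ominus> Const 1 ;;
     17 ::= Read 2 (Var 15 \<otimes> Var 0 \<oplus> Var 16) ;; edge_update Minus"

definition add_edge :: com where
  "add_edge = edge_update Plus ;;
     Write 1 (Var 15 \<otimes> Var 0 \<oplus> Var 16) (Var 13 \<oplus> Const 1) ;;
     Write 1 (Var 16 \<otimes> Var 0 \<oplus> Var 15) (Var 13 \<oplus> Const 1) ;;
     Write 2 (Var 15 \<otimes> Var 0 \<oplus> Var 16) (Var 17) ;;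
     Write 2 (Var 16 \<otimes> Var 0 \<oplus> Var 15) (Var 17) ;;
     Write 3 (Var 15 \<otimes> Var 11 \<oplus> Var 13) (Var 16) ;;
     Write 3 (Var 16 \<otimes> Var 11 \<oplus> Var 13) (Var 15)"

lemma index_inject:
  "b < k \<Longrightarrow> b' < k \<Longrightarrow> a * k + b = a' * k + b' \<longleftrightarrow> a = a' \<and> b = b'" for a b k :: nat
  by (metis add.commute mod_less mod_mult_self2 mult.commute add_right_cancel
      mult_cancel1 not_less_zero)

text \<open>\<open>2 * n \<le> 2 ^ H\<close> guarantees a free color, as each of the two forbidden
  sets has fewer than \<open>n\<close> elements. The last three conditions make addresses,
  thresholds, and the potential together with the stack size representable in a word.\<close>

locale coloring_ram =
  fixes n \<alpha> N H W :: nat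
  assumes n_ge: "2 \<le> n" and \<alpha>_ge: "1 \<le> \<alpha>" and N_ge: "1 \<le> N"
    and H_ge: "2 * n \<le> 2 ^ H" and H_le: "2 ^ H < 4 * n"
    and W_index: "(4 * N * 2 ^ H) ^ 3 \<le> W"
    and W_threshold: "(4 * N + 5) * \<alpha> < W"
    and W_stack: "2 * (N * (n * n * (4 * (2 * N * H) + 2)) +
      5 * (n * (2 * N * H * ((2 * N + 1) ^ 2 * \<alpha>)))) + 4 * N < W"
begin

text \<open>A common base for addresses: it exceeds every node, bucket number and heap index, so
  that the cells \<open>(v * B + j) * B + x\<close> are distinct, and one multiplication computes it
  from \<open>2 ^ H\<close>.\<close>

definition B :: nat where "B = 4 * N * 2 ^ H"

definition L :: nat where "L = 2 * N * H"

definition full :: nat where "full = B - 1"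

lemma B_bounds: "4 * 2 ^ H \<le> B" "4 * N \<le> B" "L + 3 \<le> B" "n \<le> 2 ^ H" "4 \<le> (2::nat) ^ H" "16 \<le> B" "2 \<le> H"
proof -
  show 1: "4 * 2 ^ H \<le> B" using N_ge by (simp add: B_def)
  have "4 * N * 1 \<le> 4 * N * 2 ^ H" by (intro mult_left_mono) auto
  then show "4 * N \<le> B" by (simp add: B_def)
  show 2: "4 \<le> (2::nat) ^ H" using n_ge H_ge by simp
  show "n \<le> 2 ^ H" using H_ge by simp
  show "16 \<le> B" using 1 2 by simp
  have "H < 2 ^ H" by (rule less_exp)
  then have "2 * N * H \<le> 2 * N * 2 ^ H" by (intro mult_left_mono) auto
  moreover have "1 * 4 \<le> N * 2 ^ H" by (intro mult_mono) (use N_ge 2 in auto)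
  ultimately show "L + 3 \<le> B" unfolding L_def B_def by linarith
  show "2 \<le> H"
  proof (rule ccontr)
    assume "\<not> 2 \<le> H"
    then have "H = 0 \<or> H = 1" by auto
    then show False using 2 by auto
  qed
qed

lemma full_less [simp]: "full < B" "B - 1 = full"
  using B_bounds by (simp_all add: full_def)

lemma B_cube: "B * B * B \<le> W"
  using W_index by (simp add: B_def power3_eq_cube)

lemma node_less_B: "v < n \<Longrightarrow> v < B"
  using B_bounds by linarith

lemma index2_less: "v < B \<Longrightarrow> j < B \<Longrightarrow> v * B + j < B * B"
proof -
  assume "v < B" "j < B"
  then have "v * B + j < (v + 1) * B" by (simp add: algebra_simps)
  also have "\<dots> \<le> B * B" using \<open>v < B\<close> by (intro mult_right_mono) auto
  finally show ?thesis .
qed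

lemma index3_less: "v < B \<Longrightarrow> j < B \<Longrightarrow> x < B \<Longrightarrow> (v * B + j) * B + x < B * B * B"
proof -
  assume a: "v < B" "j < B" "x < B"
  have "(v * B + j) * B + x < (v * B + j + 1) * B" using a by (simp add: algebra_simps)
  also have "\<dots> \<le> B * B * B" using index2_less[OF a(1,2)] by (intro mult_right_mono) auto
  finally show ?thesis .
qed

lemma BB_le: "B * B \<le> W" and B_le: "B < W"
proof -
  have "B * B * 1 \<le> B * B * B" using B_bounds by (intro mult_left_mono) auto
  then show 1: "B * B \<le> W" using B_cube by linarith
  have "B * 16 \<le> B * B" using B_bounds by (intro mult_left_mono) auto
  then show "B < W" using 1 B_bounds by linarith
qed

lemma word_index [simp]:
  assumes "v < n"
  shows "j < B \<Longrightarrow> v * B + j < W" "v * B < W" "j < B \<Longrightarrow> (v * B + j) * B < W"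
    "j < B \<Longrightarrow> x < B \<Longrightarrow> (v * B + j) * B + x < W" "v < W" "w < n \<Longrightarrow> v * n + w < W" "v * n < W"
proof -
  have v: "v < B" by (rule node_less_B[OF assms])
  show 1: "v * B + j < W" if "j < B" for j using index2_less[OF v that] BB_le by simp
  show "v * B < W" using 1[of 0] B_bounds by simp
  show 2: "(v * B + j) * B + x < W" if "j < B" "x < B" for j x
    using index3_less[OF v that] B_cube by simp
  show "(v * B + j) * B < W" if "j < B" using 2[OF that, of 0] B_bounds by simp
  show "v < W" using v B_le by simp
  have n: "n \<le> B" using B_bounds by linarith
  show 3: "v * n + w < W" if "w < n" for w
  proof -
    have "v * n + w \<le> v * B + w" using n by simp
    also have "\<dots> < W" using 1[of w] that node_less_B by simp
    finally show ?thesis .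
  qed
  show "v * n < W" using 3[of 0] n_ge by simp
qed

lemma word_small [simp]: "n < W" "B < W" "2 ^ H < W" "0 < W" "1 < W" "2 < W" "full < W" "x < 2 ^ H \<Longrightarrow> x < W"
  "x < 2 ^ H \<Longrightarrow> x + 1 < W" "j < B \<Longrightarrow> j < W" "4 < W" "3 < W"
  using B_le B_bounds full_less by linarith+

definition colors :: "state \<Rightarrow> nat \<Rightarrow> nat \<Rightarrow> nat set" where
  "colors S v j = {c. \<exists>w j'. S {v, w} = Some (c, j') \<and> (j = j' \<or> j = full)}"

text \<open>The last clause is properness. In this form it says that a node and a color determine
  the neighbor, which lets array 3 be indexed by node and color.\<close>

definition valid_state :: "state \<Rightarrow> bool" where
  "valid_state S \<longleftrightarrow> graph_on n (dom S) \<and>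
     (\<forall>e c j. S e = Some (c, j) \<longrightarrow> c < 2 ^ H \<and> j < full) \<and>
     (\<forall>v w w' c j j'. S {v, w} = Some (c, j) \<longrightarrow> S {v, w'} = Some (c, j') \<longrightarrow> w = w')"

abbreviation count :: "memory \<Rightarrow> nat \<Rightarrow> nat \<Rightarrow> nat \<Rightarrow> nat" where
  "count M v j x \<equiv> M 5 ((v * B + j) * B + x)"

text \<open>Arrays 1 to 3 are unconstrained at absent edges, so uncoloring an edge has to change
  only the trees. The shift by one arises because output colors start at 1 and leaves at 0.\<close>

definition represents :: "state \<Rightarrow> (nat \<Rightarrow> nat) \<Rightarrow> memory \<Rightarrow> bool" where
  "represents S l M \<longleftrightarrow> valid_state S \<and> M 0 0 = n \<and> M 0 1 = \<alpha> \<and>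
     (\<forall>v<n. M 4 v = l v \<and> l v < full) \<and>
     (\<forall>u v c j. S {u, v} = Some (c, j) \<longrightarrow>
        M 1 (u * n + v) = c + 1 \<and> M 2 (u * n + v) = j \<and> M 3 (u * B + c) = v) \<and>
     (\<forall>v j x. v < n \<longrightarrow> j < B \<longrightarrow> 0 < x \<longrightarrow> x < 2 * 2 ^ H \<longrightarrow>
        count M v j x = tree_count H (colors S v j) x)"

text \<open>Only \<open>represents\<close> persists between updates; the two scalars are recomputed
  by \<open>init\<close> at the start of each one.\<close>

definition ready :: "state \<Rightarrow> (nat \<Rightarrow> nat) \<Rightarrow> memory \<Rightarrow> bool" where
  "ready S l M \<longleftrightarrow> represents S l M \<and> M 10 0 = 2 ^ H \<and> M 11 0 = B"

lemma represents_cong: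
  "(\<And>a. a \<in> {0, 1, 2, 3, 4, 5} \<Longrightarrow> M' a = M a) \<Longrightarrow> represents S l M' \<longleftrightarrow> represents S l M"
  by (simp add: represents_def)

lemma ready_cong:
  "(\<And>a. a \<in> {0, 1, 2, 3, 4, 5, 10, 11} \<Longrightarrow> M' a = M a) \<Longrightarrow> ready S l M' \<longleftrightarrow> ready S l M"
proof -
  assume a: "\<And>a. a \<in> {0, 1, 2, 3, 4, 5, 10, 11} \<Longrightarrow> M' a = M a"
  have "represents S l M' \<longleftrightarrow> represents S l M" by (rule represents_cong) (use a in auto)
  then show ?thesis using a by (simp add: ready_def)
qed

lemma ready_upd [simp]:
  "a \<notin> {0, 1, 2, 3, 4, 5, 10, 11} \<Longrightarrow> ready S l (M(a := f)) \<longleftrightarrow> ready S l M"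
  by (rule ready_cong) auto

lemma valid_stateD:
  assumes "valid_state S" "S {u, v} = Some (c, j)"
  shows "u < n" "v < n" "u \<noteq> v" "c < 2 ^ H" "j < full" "S {v, u} = Some (c, j)"
proof -
  have "v \<in> adj (dom S) u" using assms by (auto simp: adj_def)
  then show "u < n" "v < n" "u \<noteq> v" using assms graph_on_adj by (auto simp: valid_state_def)
  show "c < 2 ^ H" "j < full" using assms by (auto simp: valid_state_def)
  show "S {v, u} = Some (c, j)" using assms by (simp add: insert_commute)
qed

lemma colors_bounded: "valid_state S \<Longrightarrow> colors S v j \<subseteq> {..<2 ^ H}"
  by (auto simp: colors_def valid_state_def)

lemma count_less:
  assumes "represents S l M" "v < n" "j < B" "0 < x" "x < 2 * 2 ^ H"
  shows "count M v j x \<le> 2 ^ H"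
proof -
  have F: "colors S v j \<subseteq> {..<2 ^ H}" using assms colors_bounded by (simp add: represents_def)
  have "count M v j x = tree_count H (colors S v j) x" using assms by (simp add: represents_def)
  also have "\<dots> \<le> 2 ^ H" using tree_count_le[OF F] card_colors_le[OF F] order_trans by blast
  finally show ?thesis .
qed

text \<open>By properness the deleted edge is the only one of color \<open>c\<close> at either
  endpoint, so the color really leaves both sets.\<close>

lemma colors_delete:
  assumes S: "valid_state S" and e: "S {u, v} = Some (c, j)"
  shows "colors (S({u, v} := None)) a b =
    (if a \<in> {u, v} \<and> b \<in> {j, full} then colors S a b - {c} else colors S a b)"
proof -
  have uniq: "w = w'" if "S {x, w} = Some (k, i)" "S {x, w'} = Some (k, i')" for x w w' k i i'
    using S that unfolding valid_state_def by blast
  have *: "colors (S({x, y} := None)) x b = (if b \<in> {j, full} then colors S x b - {c} else colors S x b)"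
    if xy: "S {x, y} = Some (c, j)" for x y
  proof -
    have "{x, w} = {x, y} \<longleftrightarrow> w = y" for w by (auto simp: doubleton_eq_iff)
    then have ev: "(S({x, y} := None)) {x, w} = Some z \<longleftrightarrow> w \<noteq> y \<and> S {x, w} = Some z" for w z by simp
    have 1: "d \<noteq> c" if "S {x, w} = Some (d, i)" "w \<noteq> y" for d w i using xy uniq that by blast
    have 2: "w \<noteq> y" if "S {x, w} = Some (d, i)" "d \<noteq> c" for d w i using xy that by auto
    have 3: "i = j" if "S {x, w} = Some (c, i)" for w i
      using uniq[OF xy that] xy that by simp
    show ?thesis unfolding colors_def ev using 1 2 3 by (cases "b \<in> {j, full}") (simp, blast)+
  qed
  consider "a = u" | "a = v" | "a \<notin> {u, v}" by blast
  then show ?thesis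
  proof cases
    case 1
    then show ?thesis using *[OF e] by simp
  next
    case 2
    then show ?thesis using *[of v u] e by (simp add: insert_commute)
  next
    case 3
    then have "{a, w} \<noteq> {u, v}" for w by (auto simp: doubleton_eq_iff)
    then show ?thesis using 3 by (simp add: colors_def)
  qed
qed

lemma colors_insert:
  assumes S: "S {u, v} = None"
  shows "colors (S({u, v} \<mapsto> (c, j))) a b =
    (if a \<in> {u, v} \<and> b \<in> {j, full} then insert c (colors S a b) else colors S a b)"
proof -
  have *: "colors (S({x, y} \<mapsto> (c, j))) x b = (if b \<in> {j, full} then insert c (colors S x b) else colors S x b)"
    if xy: "S {x, y} = None" for x y
  proof -
    have "{x, w} = {x, y} \<longleftrightarrow> w = y" for w by (auto simp: doubleton_eq_iff)
    then have ev: "(S({x, y} \<mapsto> (c, j))) {x, w} = Some (d, i) \<longleftrightarrow>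
        w = y \<and> d = c \<and> i = j \<or> S {x, w} = Some (d, i)" for w d i using xy by auto
    show ?thesis unfolding colors_def ev
    proof (cases "b \<in> {j, full}")
      case False
      then show "{d. \<exists>w i. (w = y \<and> d = c \<and> i = j \<or> S {x, w} = Some (d, i)) \<and> (b = i \<or> b = full)} =
        (if b \<in> {j, full} then insert c {d. \<exists>w i. S {x, w} = Some (d, i) \<and> (b = i \<or> b = full)}
         else {d. \<exists>w i. S {x, w} = Some (d, i) \<and> (b = i \<or> b = full)})" by auto
    qed (simp, blast)
  qed
  consider "a = u" | "a = v" | "a \<notin> {u, v}" by blast
  then show ?thesis
  proof cases
    case 1
    then show ?thesis using *[OF S] by simp
  next
    case 2
    then show ?thesis using *[of v u] S by (simp add: insert_commute)
  next
    case 3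
    then have "{a, w} \<noteq> {u, v}" for w by (auto simp: doubleton_eq_iff)
    then show ?thesis using 3 by (simp add: colors_def)
  qed
qed

abbreviation (input) counts_updated ::
    "binop \<Rightarrow> nat set \<Rightarrow> nat set \<Rightarrow> nat \<Rightarrow> memory \<Rightarrow> memory \<Rightarrow> bool" where
  "counts_updated f V J c M M' \<equiv> \<forall>a b x. b < B \<longrightarrow> x < 2 * 2 ^ H \<longrightarrow> count M' a b x =
     (if a \<in> V \<and> b \<in> J \<and> 0 < x \<and> anc x (2 ^ H + c)
      then apply_binop f (count M a b x) 1 else count M a b x)"

lemma runs_keyed:
  assumes M: "M 10 0 = 2 ^ H" "M 11 0 = B" "M r 0 = v" "v < n" "M 13 0 = c" "c < 2 ^ H"
    and e: "eval W M e = Some j" "j < B" and f: "f = Plus \<or> f = Minus"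
    and cnt: "\<And>x. 0 < x \<Longrightarrow> x < 2 * 2 ^ H \<Longrightarrow> count M v j x \<le> 2 ^ H"
  shows "runs W (keyed f r e) M (\<lambda>t M'. t \<le> 25 * (H + 2) + 15 + expr_cost e \<and>
    unchanged {5, 12, 14} M M' \<and>
    (\<forall>a b x. b < B \<longrightarrow> x < 2 * 2 ^ H \<longrightarrow> count M' a b x =
      (if a = v \<and> b = j \<and> 0 < x \<and> anc x (2 ^ H + c) then apply_binop f (count M a b x) 1 else count M a b x)))"
proof -
  let ?K = "(v * B + j) * B"
  let ?M = "M(12 := (M 12)(0 := ?K))"
  have bnd: "?K + 2 * 2 ^ H \<le> W"
    using index3_less[OF node_less_B[OF M(4)] e(2), of "2 * 2 ^ H"] B_cube B_bounds by simp
  have "runs W (tree_update f) ?M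
    (\<lambda>t M'. t \<le> 25 * (H + 2) \<and> unchanged {5, 14} ?M M' \<and>
       M' 5 = (\<lambda>i. if ?K < i \<and> anc (i - ?K) (2 ^ H + c) then apply_binop f (?M 5 i) 1 else ?M 5 i))"
  proof (rule runs_tree_update)
    show "3 \<le> W" using B_le B_bounds by linarith
    fix i assume i: "?K < i" "i < ?K + 2 * 2 ^ H"
    then have "M 5 i \<le> 2 ^ H" using cnt[of "i - ?K"] by simp
    then show "?M 5 i + 1 < W" using B_le B_bounds by simp
  qed (use M e bnd f in auto)
  then have "runs W (tree_update f) ?M (\<lambda>t M'. t \<le> 25 * (H + 2) \<and>
    unchanged {5, 12, 14} M M' \<and>
    (\<forall>a b x. b < B \<longrightarrow> x < 2 * 2 ^ H \<longrightarrow> count M' a b x =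
      (if a = v \<and> b = j \<and> 0 < x \<and> anc x (2 ^ H + c) then apply_binop f (count M a b x) 1 else count M a b x)))"
  proof (rule runs_conseq, intro conjI allI impI)
    fix t and M' :: memory and a b x :: nat
    assume *: "t \<le> 25 * (H + 2) \<and> unchanged {5, 14} ?M M' \<and>
       M' 5 = (\<lambda>i. if ?K < i \<and> anc (i - ?K) (2 ^ H + c) then apply_binop f (?M 5 i) 1 else ?M 5 i)"
      and b: "b < B" and x: "x < 2 * 2 ^ H"
    have xB: "x < B" using x B_bounds by linarith
    \<comment> \<open>A changed cell lies at most \<open>2 ^ H + c < B\<close> beyond
      \<open>?K\<close>; hence it belongs to the addressed tree, and node, bucket and heap index can
      be read off its address.\<close>
    have "?K < (a * B + b) * B + x \<and> anc ((a * B + b) * B + x - ?K) (2 ^ H + c) \<longleftrightarrow>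
      a = v \<and> b = j \<and> 0 < x \<and> anc x (2 ^ H + c)"
    proof
      assume l: "?K < (a * B + b) * B + x \<and> anc ((a * B + b) * B + x - ?K) (2 ^ H + c)"
      let ?y = "(a * B + b) * B + x - ?K"
      have "?y \<le> 2 ^ H + c" using l anc_le by blast
      then have y: "?y < B" using M(6) B_bounds by linarith
      have "(a * B + b) * B + x = ?K + ?y" using l by simp
      then have 1: "a * B + b = v * B + j" "x = ?y" using index_inject[OF xB y] by blast+
      then have "a = v" "b = j" using index_inject[OF b e(2)] by blast+
      then show "a = v \<and> b = j \<and> 0 < x \<and> anc x (2 ^ H + c)" using l by simp
    qed auto
    then show "count M' a b x =
      (if a = v \<and> b = j \<and> 0 < x \<and> anc x (2 ^ H + c) then apply_binop f (count M a b x) 1 else count M a b x)"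
      using * by simp
  qed auto
  note * = this
  show ?thesis unfolding keyed_def using M e
    by (simp add: runs_basic) (rule runs_conseq[OF *], simp)
qed

lemma runs_edge_update:
  assumes M: "M 10 0 = 2 ^ H" "M 11 0 = B" "M 15 0 = u" "u < n" "M 16 0 = v" "v < n" "u \<noteq> v"
    "M 13 0 = c" "c < 2 ^ H" "M 17 0 = j" "j < full" and f: "f = Plus \<or> f = Minus"
    and cnt: "\<And>a b x. a < n \<Longrightarrow> b < B \<Longrightarrow> 0 < x \<Longrightarrow> x < 2 * 2 ^ H \<Longrightarrow> count M a b x \<le> 2 ^ H"
  shows "runs W (edge_update f) M (\<lambda>t M'. t \<le> 100 * (H + 2) + 80 \<and>
    unchanged {5, 12, 14} M M' \<and>
    (counts_updated f {u, v} {j, full} c M M'))"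
proof -
  have j: "j < B" "j \<noteq> full" using M(11) full_less(1) by linarith+
  let ?upd = "\<lambda>M M' v j. \<forall>a b x. b < B \<longrightarrow> x < 2 * 2 ^ H \<longrightarrow> count M' a b x =
      (if a = v \<and> b = j \<and> 0 < x \<and> anc x (2 ^ H + c) then apply_binop f (count M a b x) 1 else count M a b x)"
  show ?thesis unfolding edge_update_def runs_Seq
  proof (rule runs_conseq[OF runs_keyed[where v = u and j = j and c = c]], goal_cases)
    case (11 t1 M1)
    then have 1: "t1 \<le> 25 * (H + 2) + 17" "unchanged {5, 12, 14} M M1" "?upd M M1 u j" by auto
    show ?case
    proof (rule runs_conseq[OF runs_keyed[where v = u and j = "full" and c = c]], goal_cases)
      case (11 t2 M2)
      then have 2: "t2 \<le> 25 * (H + 2) + 19" "unchanged {5, 12, 14} M1 M2" "?upd M1 M2 u (full)" by auto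
      show ?case
      proof (rule runs_conseq[OF runs_keyed[where v = v and j = j and c = c]], goal_cases)
        case (11 t3 M3)
        then have 3: "t3 \<le> 25 * (H + 2) + 17" "unchanged {5, 12, 14} M2 M3" "?upd M2 M3 v j" by auto
        show ?case
        proof (rule runs_conseq[OF runs_keyed[where v = v and j = "full" and c = c]], goal_cases)
          case (11 t4 M4)
          then have 4: "t4 \<le> 25 * (H + 2) + 19" "unchanged {5, 12, 14} M3 M4" "?upd M3 M4 v (full)" by auto
          have "t1 + (t2 + (t3 + t4)) \<le> 100 * (H + 2) + 80" using 1(1) 2(1) 3(1) 4(1) by simp
          moreover have "unchanged {5, 12, 14} M M4" using 1(2) 2(2) 3(2) 4(2) by simp
          moreover have "count M4 a b x =
            (if a \<in> {u, v} \<and> b \<in> {j, full} \<and> 0 < x \<and> anc x (2 ^ H + c)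
             then apply_binop f (count M a b x) 1 else count M a b x)" if "b < B" "x < 2 * 2 ^ H" for a b x
            unfolding 4(3)[rule_format, OF that] 3(3)[rule_format, OF that] 2(3)[rule_format, OF that]
              1(3)[rule_format, OF that] using M(7) j by auto
          ultimately show ?case by simp
        qed (use 1 2 3 M f j cnt in auto)
      qed (use 1 2 M f j cnt in auto)
    qed (use 1 M f j cnt in auto)
  qed (use M f j cnt in auto)
qed

abbreviation (input) remove_edge_post where
  "remove_edge_post S l c j M \<equiv> \<lambda>t M'. t \<le> 200 * (H + 2) \<and> ready S l M' \<and>
     unchanged {5, 12, 13, 14, 17} M M' \<and> M' 13 0 = c \<and> M' 17 0 = j"

lemma runs_remove_edge:
  assumes r: "ready S l M" and e: "S {u, v} = Some (c, j)" and M: "M 15 0 = u" "M 16 0 = v"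
  shows "runs W remove_edge M (remove_edge_post (S({u, v} := None)) l c j M)"
proof -
  have S: "valid_state S" using r by (simp add: ready_def represents_def)
  note d = valid_stateD[OF S e]
  have jB: "j < B" using d(5) full_less(1) by linarith
  have cells: "M 1 (u * n + v) = c + 1" "M 2 (u * n + v) = j" "M 0 0 = n"
    using r e by (auto simp: ready_def represents_def)
  let ?M = "M(13 := (M 13)(0 := c), 17 := (M 17)(0 := j))"
  have r': "ready S l ?M" using r by simp
  have "valid_state (S({u, v} := None))" using S
    unfolding valid_state_def graph_on_def by (auto split: if_splits)
  note S' = this
  have *: "runs W (edge_update Minus) ?M (\<lambda>t M'. t \<le> 100 * (H + 2) + 80 \<and>
    unchanged {5, 12, 14} ?M M' \<and>
    (counts_updated Minus {u, v} {j, full} c ?M M'))"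
    by (rule runs_edge_update)
      (use r' d M count_less[of S l ?M] in \<open>auto simp: ready_def\<close>)
  have **: "runs W (edge_update Minus) ?M (\<lambda>t M'. t \<le> 100 * (H + 2) + 80 \<and>
    ready (S({u, v} := None)) l M' \<and>
    unchanged {5, 12, 13, 14, 17} M M' \<and> M' 13 0 = c \<and> M' 17 0 = j)"
  proof (rule runs_conseq[OF *], goal_cases)
    case (1 t M')
    then have fr: "unchanged {5, 12, 14} ?M M'"
      and cnt: "\<And>a b x. b < B \<Longrightarrow> x < 2 * 2 ^ H \<Longrightarrow> count M' a b x =
      (if a \<in> {u, v} \<and> b \<in> {j, full} \<and> 0 < x \<and> anc x (2 ^ H + c)
       then count M a b x - 1 else count M a b x)" by auto
    have "count M' a b x = tree_count H (colors (S({u, v} := None)) a b) x"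
      if "a < n" "b < B" "0 < x" "x < 2 * 2 ^ H" for a b x
    proof (cases "a \<in> {u, v} \<and> b \<in> {j, full}")
      case True
      have "c \<in> colors S a b" using True e d(6) by (auto simp: colors_def)
      then show ?thesis
        using True r that tree_count_remove[OF colors_bounded[OF S]] unfolding cnt[OF that(2,4)]
        by (simp add: colors_delete[OF S e] ready_def represents_def)
    next
      case False
      then show ?thesis
        using r that unfolding cnt[OF that(2,4)] colors_delete[OF S e]
        by (auto simp: ready_def represents_def)
    qed
    then have "ready (S({u, v} := None)) l M'"
      using r S' fr by (auto simp: ready_def represents_def split: if_splits)
    then show ?case using 1 by auto
  qed
  have "c + 1 < W" using d(4) by simp
  then show ?thesis unfolding remove_edge_def using d jB cells M
    by (simp add: runs_basic) (rule runs_conseq[OF **], simp)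
qed

text \<open>That \<open>c\<close> is free at both ends keeps the state proper, makes every affected
  count grow by exactly one, and ensures that the overwritten cells of array 3 belong to no other
  edge.\<close>

lemma runs_add_edge:
  assumes r: "ready S l M" and e: "S {u, v} = None" and M: "M 15 0 = u" "M 16 0 = v"
    "M 13 0 = c" "M 17 0 = j" and uv: "u < n" "v < n" "u \<noteq> v" "c < 2 ^ H" "j < full"
    and free: "c \<notin> colors S u (full)" "c \<notin> colors S v (full)"
  shows "runs W add_edge M (\<lambda>t M'. t \<le> 200 * (H + 2) \<and> ready (S({u, v} \<mapsto> (c, j))) l M' \<and>
    unchanged {1, 2, 3, 5, 12, 14} M M')"
proof -
  have S: "valid_state S" using r by (simp add: ready_def represents_def)
  let ?S = "S({u, v} \<mapsto> (c, j))"
  have jB: "j < B" using uv(5) full_less(1) by linarith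
  have n: "M 0 0 = n" using r by (simp add: ready_def represents_def)
  have eq: "{a, b} = {u, v} \<longleftrightarrow> a = u \<and> b = v \<or> a = v \<and> b = u" for a b by (auto simp: doubleton_eq_iff)
  have fr1: "S {u, w} \<noteq> Some (c, j')" "S {v, w} \<noteq> Some (c, j')" for w j'
    using free by (auto simp: colors_def)
  have S': "valid_state ?S" unfolding valid_state_def
  proof (intro conjI allI impI)
    show "graph_on n (dom ?S)" using S uv unfolding valid_state_def graph_on_def by auto
    show "k < 2 ^ H" "i < full" if "?S e = Some (k, i)" for e k i
      using S uv that by (auto simp: valid_state_def split: if_splits)
    show "w = w'" if "?S {x, w} = Some (k, i)" "?S {x, w'} = Some (k, i')" for x w w' k i i'
    proof (cases "{x, w} = {u, v} \<or> {x, w'} = {u, v}")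
      case True
      then show ?thesis using that fr1 uv(3) by (auto simp: eq split: if_splits)
    next
      case False
      then have "S {x, w} = Some (k, i)" "S {x, w'} = Some (k, i')" using that by auto
      then show ?thesis using S unfolding valid_state_def by blast
    qed
  qed
  have *: "runs W (edge_update Plus) M (\<lambda>t M'. t \<le> 100 * (H + 2) + 80 \<and>
    unchanged {5, 12, 14} M M' \<and>
    (counts_updated Plus {u, v} {j, full} c M M'))"
    by (rule runs_edge_update) (use r uv M count_less[of S l M] in \<open>auto simp: ready_def\<close>)
  show ?thesis unfolding add_edge_def runs_Seq[of _ "edge_update Plus"]
  proof (rule runs_conseq[OF *], goal_cases)
    case (1 t M1)
    then have t: "t \<le> 100 * (H + 2) + 80" and fr: "unchanged {5, 12, 14} M M1"
      and cnt: "\<And>a b x. b < B \<Longrightarrow> x < 2 * 2 ^ H \<Longrightarrow> count M1 a b x =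
      (if a \<in> {u, v} \<and> b \<in> {j, full} \<and> 0 < x \<and> anc x (2 ^ H + c)
       then count M a b x + 1 else count M a b x)" by auto
    define M2 where "M2 = M1(1 := (M 1)(u * n + v := c + 1, v * n + u := c + 1),
      2 := (M 2)(u * n + v := j, v * n + u := j),
      3 := (M 3)(u * B + c := v, v * B + c := u))"
    have cB: "c < B" using uv(4) B_bounds by linarith
    have "count M2 a b x = tree_count H (colors ?S a b) x"
      if "a < n" "b < B" "0 < x" "x < 2 * 2 ^ H" for a b x
    proof (cases "a \<in> {u, v} \<and> b \<in> {j, full}")
      case True
      have "c \<notin> colors S a b" using True free by (auto simp: colors_def)
      moreover have "count M2 a b x = count M1 a b x" by (simp add: M2_def)
      ultimately show ?thesis
        using True r that tree_count_insert[OF colors_bounded[OF S]] unfolding cnt[OF that(2,4)]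
        by (simp add: colors_insert[of S u v, OF e] ready_def represents_def cnt)
    next
      case False
      have "count M2 a b x = count M1 a b x" by (simp add: M2_def)
      then show ?thesis
        using r that False unfolding cnt[OF that(2,4)] colors_insert[of S u v, OF e]
        by (auto simp: ready_def represents_def cnt)
    qed
    moreover have "M2 1 (a * n + b) = k + 1 \<and> M2 2 (a * n + b) = i \<and> M2 3 (a * B + k) = b"
      if ab: "?S {a, b} = Some (k, i)" for a b k i
    proof -
      note d = valid_stateD[OF S' ab]
      have kB: "k < B" using d(4) B_bounds by linarith
      have ix: "a * n + b = u * n + v \<longleftrightarrow> a = u \<and> b = v" "a * n + b = v * n + u \<longleftrightarrow> a = v \<and> b = u"
        "a * B + k = u * B + c \<longleftrightarrow> a = u \<and> k = c" "a * B + k = v * B + c \<longleftrightarrow> a = v \<and> k = c"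
        using index_inject d uv cB kB by auto
      show ?thesis
      proof (cases "{a, b} = {u, v}")
        case True
        then have "k = c" "i = j" using ab by auto
        then show ?thesis using True ix uv(3) by (auto simp: M2_def eq)
      next
        case False
        then have "S {a, b} = Some (k, i)" using ab by auto
        moreover have "a * n + b \<noteq> u * n + v" "a * n + b \<noteq> v * n + u"
          unfolding ix using False by (auto simp: insert_commute)
        moreover have "a * B + k \<noteq> u * B + c" "a * B + k \<noteq> v * B + c"
          unfolding ix using calculation(1) fr1 by auto
        moreover have "M 1 (a * n + b) = k + 1 \<and> M 2 (a * n + b) = i \<and> M 3 (a * B + k) = b"
          using r calculation(1) unfolding ready_def represents_def by blast
        moreover have "M2 1 = (M 1)(u * n + v := c + 1, v * n + u := c + 1)"
          "M2 2 = (M 2)(u * n + v := j, v * n + u := j)"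
          "M2 3 = (M 3)(u * B + c := v, v * B + c := u)" by (simp_all add: M2_def)
        ultimately show ?thesis by (metis fun_upd_other)
      qed
    qed
    ultimately have "ready ?S l M2"
      using r S' fr unfolding ready_def represents_def by (simp add: M2_def)
    moreover have "unchanged {1, 2, 3, 5, 12, 14} M M2" using fr by (simp add: M2_def)
    moreover have "u * n + v \<noteq> v * n + u" "u * B + c \<noteq> v * B + c"
      using index_inject[of v n u u v] index_inject[OF cB cB] uv by auto
    ultimately show ?case using t fr M uv jB n r
      by (simp add: runs_basic M2_def ready_def cB)
  qed
qed

end

text \<open>Simplification of a program stops in front of the first command without a rewrite rule.\<close>

lemma runs_weak_cong [cong]: "M = M' \<Longrightarrow> runs W c M Q \<longleftrightarrow> runs W c M' Q"
  by simp

section \<open>Coloring an edge\<close>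

text \<open>Scalar 24 saves \<open>y\<close>, because \<open>remove_edge\<close> takes its operands
  from 15 and 16. Without a conflict, clearing 22 ends the loop and 23 gets a dummy value; otherwise
  the pair in 15 and 16 becomes the uncolored edge with its lower endpoint first.\<close>

definition color_step :: com where
  "color_step =
     12 ::= (Var 16 \<otimes> Var 11 \<oplus> (Var 11 \<ominus> Const 1)) \<otimes> Var 11 ;;
     18 ::= (Var 15 \<otimes> Var 11 \<oplus> Read 4 (Var 15)) \<otimes> Var 11 ;; find_free ;;
     If (Read 5 ((Var 15 \<otimes> Var 11 \<oplus> (Var 11 \<ominus> Const 1)) \<otimes> Var 11 \<oplus> (Var 10 \<oplus> Var 13)))
       (23 ::= Read 3 (Var 15 \<otimes> Var 11 \<oplus> Var 13) ;; 24 ::= Var 16 ;; 16 ::= Var 23 ;;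
        remove_edge ;; 16 ::= Var 24)
       (22 ::= Const 0 ;; 23 ::= Const 0) ;;
     17 ::= Read 4 (Var 15) ;; add_edge ;; 16 ::= Var 15 ;; 15 ::= Var 23"

definition color_loop :: com where
  "color_loop = While (Var 22) color_step"

context coloring_ram
begin

text \<open>Consequently the bucket \<open>l v\<close> at \<open>v\<close> holds precisely the edges
  to nodes not below \<open>v\<close>, and its tree root yields the upper degree. This may fail only
  in the middle of a move.\<close>

definition consistent :: "state \<Rightarrow> (nat \<Rightarrow> nat) \<Rightarrow> bool" where
  "consistent S l \<longleftrightarrow> (\<forall>u v c j. S {u, v} = Some (c, j) \<longrightarrow> j = min (l u) (l v))"

lemma card_colors:
  assumes S: "valid_state S"
  shows "card (colors S v j) = card {w \<in> adj (dom S) v. j = snd (the (S {v, w})) \<or> j = full}"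
proof -
  let ?A = "{w \<in> adj (dom S) v. j = snd (the (S {v, w})) \<or> j = full}"
  have "colors S v j = (\<lambda>w. fst (the (S {v, w}))) ` ?A"
    by (force simp: colors_def adj_def image_iff)
  moreover have "inj_on (\<lambda>w. fst (the (S {v, w}))) ?A"
  proof (rule inj_onI)
    fix x y assume "x \<in> ?A" "y \<in> ?A" and eq: "fst (the (S {v, x})) = fst (the (S {v, y}))"
    then obtain c i d k where "S {v, x} = Some (c, i)" "S {v, y} = Some (d, k)"
      by (auto simp: adj_def)
    then show "x = y" using S eq unfolding valid_state_def by simp blast
  qed
  ultimately show ?thesis by (simp add: card_image)
qed

lemma card_colors_full: "valid_state S \<Longrightarrow> card (colors S v full) = card (adj (dom S) v)"
  by (simp add: card_colors)

lemma consistent_snd: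
  assumes "consistent S l" "w \<in> adj (dom S) v"
  shows "snd (the (S {v, w})) = min (l v) (l w)"
proof -
  obtain c j where cj: "S {v, w} = Some (c, j)" using assms(2) by (auto simp: adj_def)
  then have "j = min (l v) (l w)" using assms(1) unfolding consistent_def by blast
  then show ?thesis using cj by simp
qed

lemma card_colors_level:
  assumes "valid_state S" "consistent S l" "l v < full"
  shows "card (colors S v (l v)) = deg_above (dom S) l v (l v)"
proof -
  have "l v = snd (the (S {v, w})) \<or> l v = full \<longleftrightarrow> l v \<le> l w" if "w \<in> adj (dom S) v" for w
    unfolding consistent_snd[OF assms(2) that] using assms(3) by linarith
  then show ?thesis unfolding card_colors[OF assms(1)] deg_above_def
    by (intro arg_cong[where f = card] Collect_cong) blast
qed

text \<open>The neighbors from level \<open>l v - 1\<close> upwards are spread over two buckets of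
  \<open>v\<close>, so the condition for falling can be read off two tree roots.\<close>

lemma card_colors_below:
  assumes S: "valid_state S" and c: "consistent S l" and l: "l v < full" "0 < l v"
  shows "card (colors S v (l v)) + card (colors S v (l v - 1)) = deg_above (dom S) l v (l v - 1)"
proof -
  have fin: "finite (adj (dom S) v)" using S finite_adj by (auto simp: valid_state_def)
  have "card (colors S v (l v - 1)) = card {w \<in> adj (dom S) v. l w = l v - 1}"
  proof -
    have "l v - 1 = snd (the (S {v, w})) \<or> l v - 1 = full \<longleftrightarrow> l w = l v - 1"
      if "w \<in> adj (dom S) v" for w
      unfolding consistent_snd[OF c that] using l by linarith
    then show ?thesis unfolding card_colors[OF S]
      by (intro arg_cong[where f = card] Collect_cong) blast
  qed
  moreover have "{w \<in> adj (dom S) v. l v - 1 \<le> l w} =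
      {w \<in> adj (dom S) v. l v \<le> l w} \<union> {w \<in> adj (dom S) v. l w = l v - 1}" by auto
  moreover have "card ({w \<in> adj (dom S) v. l v \<le> l w} \<union> {w \<in> adj (dom S) v. l w = l v - 1}) =
      card {w \<in> adj (dom S) v. l v \<le> l w} + card {w \<in> adj (dom S) v. l w = l v - 1}"
    using fin l by (intro card_Un_disjoint) auto
  ultimately show ?thesis using card_colors_level[OF S c l(1)] by (simp add: deg_above_def)
qed

lemma card_colors_less:
  assumes "valid_state S" "v < n"
  shows "card (colors S v j) < n"
proof -
  have g: "graph_on n (dom S)" using assms by (simp add: valid_state_def)
  have "card (colors S v j) \<le> card (adj (dom S) v)"
    unfolding card_colors[OF assms(1)] using finite_adj[OF g] by (intro card_mono) auto
  then show ?thesis using card_adj_less[OF g assms(2)] by simp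
qed

lemma readyD:
  assumes "ready S l M"
  shows "valid_state S" "M 0 0 = n" "M 0 1 = \<alpha>" "M 10 0 = 2 ^ H" "M 11 0 = B"
    "v < n \<Longrightarrow> M 4 v = l v" "v < n \<Longrightarrow> l v < full" "v < n \<Longrightarrow> l v < B"
    "S {u, v} = Some (c, j) \<Longrightarrow> M 3 (u * B + c) = v"
    "v < n \<Longrightarrow> j < B \<Longrightarrow> 0 < x \<Longrightarrow> x < 2 * 2 ^ H \<Longrightarrow> count M v j x = tree_count H (colors S v j) x"
    "v < n \<Longrightarrow> j < B \<Longrightarrow> count M v j 1 = card (colors S v j)"
proof -
  show v: "valid_state S" using assms by (simp add: ready_def represents_def)
  show 1: "v < n \<Longrightarrow> l v < full" using assms by (simp add: ready_def represents_def)
  show "l v < B" if "v < n" using 1[OF that] full_less(1) by linarith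
  show "count M v j 1 = card (colors S v j)" if "v < n" "j < B"
  proof -
    have "count M v j 1 = tree_count H (colors S v j) 1"
      using assms that B_bounds by (simp add: ready_def represents_def)
    then show ?thesis using tree_count_root[OF colors_bounded[OF v]] by simp
  qed
  show "S {u, v} = Some (c, j) \<Longrightarrow> M 3 (u * B + c) = v"
    using assms unfolding ready_def represents_def by blast
qed (use assms in \<open>simp_all add: ready_def represents_def\<close>)

abbreviation (input) color_vars :: "nat set" where
  "color_vars \<equiv> {1, 2, 3, 5, 12, 13, 14, 15, 16, 17, 18, 19, 22, 23, 24}"

abbreviation (input) color_step_post where
  "color_step_post S l x y M \<equiv> \<lambda>t M'. t \<le> 600 * (H + 2) \<and> unchanged color_vars M M' \<and>
    (\<exists>k \<le> card (colors S y full) + card (colors S x (l x)).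
       M' 22 0 = 0 \<and> ready (S({x, y} \<mapsto> (k, l x))) l M' \<or>
       (\<exists>z j. S {x, z} = Some (k, j) \<and> l z < l x \<and> M' 22 = M 22 \<and> M' 15 0 = z \<and> M' 16 0 = x \<and>
          ready (S({x, z} := None, {x, y} \<mapsto> (k, l x))) l M'))"

abbreviation (input) color_loop_post where
  "color_loop_post E D K l S x M \<equiv> \<lambda>t (M'::memory). t \<le> (l x + 1) * (600 * (H + 2) + 3) + 3 \<and>
    unchanged color_vars M M' \<and>
    (\<exists>S' R. ready S' l M' \<and> dom S' = E \<and> consistent S' l \<and>
       (\<forall>e c j. S' e = Some (c, j) \<longrightarrow> c < D + K) \<and>
       finite R \<and> card R \<le> l x + 1 \<and> (\<forall>e. e \<notin> R \<longrightarrow> S' e = S e))"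

lemma runs_color_step:
  assumes r: "ready S l M" and M: "M 15 0 = x" "M 16 0 = y" and xy: "x < n" "y < n" "x \<noteq> y"
    and e: "S {x, y} = None" and c: "consistent S l" and le: "l x \<le> l y"
  shows "runs W color_step M (color_step_post S l x y M)"
proof -
  define Q where "Q = (color_step_post S l x y M)"
  let ?T = "card (colors S y full) + card (colors S x (l x))"
  note rd = readyD[OF r]
  note S = rd(1)
  have lx: "l x < full" "l x < B" "M 4 x = l x" using rd(6,7,8)[OF xy(1)] by auto
  define M1 where "M1 = M(12 := (M 12)(0 := (y * B + full) * B), 18 := (M 18)(0 := (x * B + l x) * B))"
  have r1: "ready S l M1" using r by (simp add: M1_def)
  note rd1 = readyD[OF r1]
  have T: "?T < 2 ^ H"
    using card_colors_less[OF S xy(1), of "l x"] card_colors_less[OF S xy(2), of full] H_ge by linarith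
  have Kb: "(v * B + j) * B + 2 * 2 ^ H \<le> W" if "v < n" "j < B" for v j
    using index3_less[OF node_less_B[OF that(1)] that(2), of "2 * 2 ^ H"] B_cube B_bounds by simp
  have ff: "runs W find_free M1
    (\<lambda>t M'. t \<le> 50 * (H + 1) \<and> unchanged {13, 14, 19} M1 M' \<and>
       M' 13 0 < 2 ^ H \<and> M' 13 0 \<notin> colors S y full \<and> M' 13 0 \<notin> colors S x (l x) \<and> M' 13 0 \<le> ?T)"
  proof (rule runs_find_free[where ?K1.0 = "(y * B + full) * B" and ?K2.0 = "(x * B + l x) * B"])
    show "4 * 2 ^ H \<le> W" using B_bounds B_le by linarith
    show "M1 5 ((y * B + full) * B + i) = tree_count H (colors S y full) i"
      if "0 < i" "i < 2 * 2 ^ H" for i using rd1(10)[OF xy(2) full_less(1) that] .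
    show "M1 5 ((x * B + l x) * B + i) = tree_count H (colors S x (l x)) i"
      if "0 < i" "i < 2 * 2 ^ H" for i using rd1(10)[OF xy(1) lx(2) that] .
  qed (use S colors_bounded rd1 Kb xy lx T in \<open>auto simp: M1_def\<close>)
  have fr1: "M1 a = M a" if "a \<notin> {12, 18}" for a using that by (simp add: M1_def)
  have "runs W color_step M Q"
    unfolding color_step_def using M xy lx rd(4,5)
    apply (simp add: runs_basic)
    apply (fold M1_def)
    apply (rule runs_conseq[OF ff])
    subgoal premises p for t M2
    proof -
      define k where "k = M2 13 0"
      have t: "t \<le> 50 * (H + 1)" and k: "k < 2 ^ H" "k \<notin> colors S y full" "k \<notin> colors S x (l x)" "k \<le> ?T"
        using p by (auto simp: k_def)
      have fr2: "M2 a = M a" if "a \<notin> {12, 13, 14, 18, 19}" for a using p fr1 that by simp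
      have r2: "ready S l M2" by (rule ready_cong[THEN iffD2, OF _ r]) (use fr2 in auto)
      note rd2 = readyD[OF r2]
      have regs: "M2 15 0 = x" "M2 16 0 = y" "M2 22 = M 22" using fr2 M by auto
      have kB: "2 ^ H + k < B" "k < B" using k(1) B_bounds by linarith+
      have kW: "2 ^ H + k < W" "k < W" using kB B_le by linarith+
      have leaf: "count M2 x full (2 ^ H + k) = (if k \<in> colors S x full then 1 else 0)"
        using rd2(10)[OF xy(1) full_less(1), of "2 ^ H + k"] k(1) tree_count_leaf[OF colors_bounded[OF S] k(1)]
        by simp
      note facts = leaf regs rd2(4,5,6) lx xy kB kW k_def[symmetric]
      show ?thesis
      proof (cases "k \<in> colors S x full")
        case False
        define M3 where "M3 = M2(22 := (M 22)(0 := 0), 23 := (M2 23)(0 := 0), 17 := (M2 17)(0 := l x))"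
        have add: "runs W add_edge M3 (\<lambda>t M'. t \<le> 200 * (H + 2) \<and> ready (S({x, y} \<mapsto> (k, l x))) l M' \<and>
          unchanged {1, 2, 3, 5, 12, 14} M3 M')"
          by (rule runs_add_edge) (use r2 e regs xy k lx False in \<open>simp_all add: M3_def k_def\<close>)
        show ?thesis using False
          apply (simp add: runs_basic facts)
          apply (fold M3_def)
          apply (rule runs_conseq[OF add])
          subgoal premises p4 for t4 M4
          proof -
            have m: "M4 15 0 = x" "M4 23 0 = 0" "M4 22 0 = 0" using p4 regs by (auto simp: M3_def)
            have "M4 a = M a" if "a \<notin> color_vars" for a
              using p4 fr2 that by (simp add: M3_def)
            then show ?thesis using p4 t m xy k(4) by (auto simp: runs_basic Q_def)
          qed
          done
      next
        case True
        then obtain z j where z: "S {x, z} = Some (k, j)" by (auto simp: colors_def)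
        note d = valid_stateD[OF S z]
        have j: "j = min (l x) (l z)" using c z unfolding consistent_def by blast
        \<comment> \<open>The color \<open>k\<close> avoids the bucket \<open>l x\<close> of
          \<open>x\<close>, so the conflicting edge is filed lower, which only a lower level of
          \<open>z\<close> can cause.\<close>
        have "j \<noteq> l x" using z k(3) by (auto simp: colors_def)
        then have lz: "l z < l x" using j by (simp add: min_def split: if_splits)
        have M3z: "M2 3 (x * B + k) = z" using rd2(9)[OF z] .
        let ?S1 = "S({x, z} := None)"
        define M3 where "M3 = M2(23 := (M2 23)(0 := z), 24 := (M2 24)(0 := y), 16 := (M2 16)(0 := z))"
        have rem: "runs W remove_edge M3 (remove_edge_post ?S1 l k j M3)"
          by (rule runs_remove_edge[where S = S and u = x and v = z and c = k and j = j]) (use r2 regs z in \<open>simp_all add: M3_def\<close>)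
        have free: "k \<notin> colors ?S1 x full" "k \<notin> colors ?S1 y full"
          using colors_delete[OF S z] k(2) by auto
        have e1: "?S1 {x, y} = None" using e by simp
        show ?thesis using True
          apply (simp add: runs_basic facts d M3z)
          apply (fold M3_def)
          apply (rule runs_conseq[OF rem])
          subgoal premises p4 for t4 M4
          proof -
            have reg4: "M4 15 0 = x" "M4 24 0 = y" "M4 4 x = l x" "M4 23 0 = z" "M4 13 0 = k"
              using p4 regs lx fr2 by (auto simp: M3_def)
            define M5 where "M5 = M4(16 := (M4 16)(0 := y), 17 := (M4 17)(0 := l x))"
            have add: "runs W add_edge M5 (\<lambda>t M'. t \<le> 200 * (H + 2) \<and>
              ready (?S1({x, y} \<mapsto> (k, l x))) l M' \<and> unchanged {1, 2, 3, 5, 12, 14} M5 M')"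
              by (rule runs_add_edge) (use p4 e1 reg4 xy k lx free in \<open>simp_all add: M5_def\<close>)
            show ?thesis
              apply (simp add: runs_basic reg4 xy lx)
              apply (fold M5_def)
              apply (rule runs_conseq[OF add])
              subgoal premises p6 for t6 M6
              proof -
                have m: "M6 15 0 = x" "M6 23 0 = z" "M6 22 = M 22"
                  using p6 reg4 p4 fr2 by (auto simp: M5_def M3_def)
                have "M6 a = M a"
                  if "a \<notin> color_vars" for a
                  using p6 p4 fr2 that by (simp add: M5_def M3_def)
                then show ?thesis using p6 p4 t m xy k(4) d z lz by (auto simp: runs_basic Q_def)
              qed
              done
          qed
          done
      qed
    qed
    done
  then show ?thesis unfolding Q_def .
qed

text \<open>The conflicting edge at the lower endpoint \<open>x\<close> leads to a node \<open>z\<close> of smaller level, since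
  the new color avoids all edges from \<open>x\<close> to nodes that are not below \<open>x\<close>. Hence the loop ends
  after at most \<open>l x + 1\<close> steps.\<close>

lemma runs_color_loop:
  assumes "ready S l M" "M 22 0 = 1" "M 15 0 = x" "M 16 0 = y" "graph_on n E"
    "{x, y} \<in> E" "dom S = E - {{x, y}}" "consistent S l" "l x \<le> l y"
    "\<And>v. v < n \<Longrightarrow> card (adj E v) \<le> D"
    "card (colors S x (l x)) \<le> K" "\<And>v. v < n \<Longrightarrow> l v < l x \<Longrightarrow> deg_above E l v (l v) \<le> K"
    "\<And>e c j. S e = Some (c, j) \<Longrightarrow> c < D + K"
  shows "runs W color_loop M (color_loop_post E D K l S x M)"
  using assms
proof (induction "l x" arbitrary: S M x y rule: less_induct)
  case less
  note r = less.prems(1) and M = less.prems(2-4) and g = less.prems(5) and E = less.prems(6)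
    and dom = less.prems(7) and cons = less.prems(8) and le = less.prems(9) and D = less.prems(10)
    and K = less.prems(11) and K' = less.prems(12) and bnd = less.prems(13)
  note S = readyD(1)[OF r]
  have xy: "x < n" "y < n" "x \<noteq> y" using graph_on_adj[OF g, of y x] E by (auto simp: adj_def)
  have e: "S {x, y} = None" using dom by blast
  \<comment> \<open>The edge \<open>xy\<close> counts towards the degree of \<open>y\<close> but is
    uncolored. This makes the inequality strict, as needed for colors that start at 0.\<close>
  have T: "card (colors S y full) + card (colors S x (l x)) < D + K"
  proof -
    have "adj (dom S) y \<subseteq> adj E y - {x}" using dom by (auto simp: adj_def insert_commute)
    then have "card (adj (dom S) y) \<le> card (adj E y - {x})"
      using finite_adj[OF g] by (intro card_mono) auto
    also have "\<dots> < card (adj E y)"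
      by (rule card_Diff1_less[OF finite_adj[OF g]]) (use E in \<open>simp add: adj_def insert_commute\<close>)
    finally show ?thesis using D[OF xy(2)] K card_colors_full[OF S] by simp
  qed
  define Q where "Q = (color_loop_post E D K l S x M)"
  have "runs W color_loop M Q"
    unfolding color_loop_def using M(1)
    apply (subst runs_While)
    apply (simp add: runs_basic)
    apply (fold color_loop_def)
    apply (rule runs_conseq[OF runs_color_step[OF r M(2,3) xy e cons le]])
    subgoal premises p for t M1
    proof -
      have t: "t \<le> 600 * (H + 2)" and fr: "unchanged color_vars M M1"
        using p by blast+
      obtain k where k: "k \<le> card (colors S y full) + card (colors S x (l x))"
        and alt: "M1 22 0 = 0 \<and> ready (S({x, y} \<mapsto> (k, l x))) l M1 \<or>
         (\<exists>z j. S {x, z} = Some (k, j) \<and> l z < l x \<and> M1 22 = M 22 \<and> M1 15 0 = z \<and> M1 16 0 = x \<and>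
          ready (S({x, z} := None, {x, y} \<mapsto> (k, l x))) l M1)" using p by blast
      have cons': "consistent (S'({x, y} \<mapsto> (k, l x))) l" if "consistent S' l" for S'
        unfolding consistent_def
      proof (intro allI impI)
        fix u v c j assume a: "(S'({x, y} \<mapsto> (k, l x))) {u, v} = Some (c, j)"
        show "j = min (l u) (l v)"
        proof (cases "{u, v} = {x, y}")
          case True
          then have "j = l x" using a by simp
          then show ?thesis using True le by (auto simp: doubleton_eq_iff)
        next
          case False
          then have "S' {u, v} = Some (c, j)" using a by simp
          then show ?thesis using that unfolding consistent_def by blast
        qed
      qed
      from alt show ?thesis
      proof
        assume a: "M1 22 0 = 0 \<and> ready (S({x, y} \<mapsto> (k, l x))) l M1"
        let ?S = "S({x, y} \<mapsto> (k, l x))"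
        have "dom ?S = E" using dom E by auto
        moreover have "\<forall>e c j. ?S e = Some (c, j) \<longrightarrow> c < D + K" using bnd k T by (auto split: if_splits)
        moreover have "6 + t \<le> (l x + 1) * (600 * (H + 2) + 3) + 3"
        proof -
          have "X \<le> (l x + 1) * X" for X by simp
          then have *: "600 * (H + 2) + 3 + 3 \<le> (l x + 1) * (600 * (H + 2) + 3) + 3" by (rule add_right_mono)
          then show ?thesis using t by (intro order_trans[OF _ *]) simp
        qed
        ultimately have "Q (6 + t) M1" unfolding Q_def
          using a t fr cons'[OF cons] by (intro conjI exI[of _ ?S] exI[of _ "{{x, y}}"]) auto
        then show ?thesis using a unfolding color_loop_def
          by (subst runs_While) (simp add: add.commute)
      next
        assume "\<exists>z j. S {x, z} = Some (k, j) \<and> l z < l x \<and> M1 22 = M 22 \<and> M1 15 0 = z \<and> M1 16 0 = x \<and>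
          ready (S({x, z} := None, {x, y} \<mapsto> (k, l x))) l M1"
        then obtain z j where z: "S {x, z} = Some (k, j)" "l z < l x" "M1 22 = M 22" "M1 15 0 = z" "M1 16 0 = x"
          and r1: "ready (S({x, z} := None, {x, y} \<mapsto> (k, l x))) l M1" by blast
        let ?S = "S({x, z} := None, {x, y} \<mapsto> (k, l x))"
        have zd: "z < n" "x \<noteq> z" using valid_stateD[OF S z(1)] by auto
        have zx: "{z, x} = {x, z}" by auto
        have zE: "{x, z} \<in> E" "{x, z} \<noteq> {x, y}" using z(1) dom by auto
        have dom1: "dom ?S = E - {{z, x}}" using dom E zE zx by auto
        have c1: "consistent ?S l"
        proof (rule cons')
          show "consistent (S({x, z} := None)) l" using cons unfolding consistent_def
            by (metis fun_upd_apply option.distinct(1))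
        qed
        \<comment> \<open>For \<open>z\<close> the bound comes from the full graph \<open>E\<close>.
          For the first lower endpoint it is assumed about the state instead: there the inserted
          edge is still missing, whereas in \<open>E\<close> it may already exceed the
          threshold.\<close>
        have cz: "card (colors ?S z (l z)) \<le> K"
        proof -
          have v1: "valid_state ?S" using readyD(1)[OF r1] .
          have "card (colors ?S z (l z)) = deg_above (dom ?S) l z (l z)"
            using card_colors_level[OF v1 c1] readyD(7)[OF r1 zd(1)] by simp
          also have "\<dots> \<le> deg_above E l z (l z)" unfolding dom1 deg_above_def
            using finite_adj[OF g] by (intro card_mono) (auto simp: adj_def)
          finally show ?thesis using K'[OF zd(1) z(2)] by simp
        qed
        have IH: "runs W color_loop M1 (color_loop_post E D K l ?S z M1)"
        proof (rule less.hyps[OF z(2) r1 _ z(4,5) g _ dom1 c1 _ D cz])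
          show "M1 22 0 = 1" using z(3) M(1) by simp
          show "{z, x} \<in> E" using zE zx by simp
          show "l z \<le> l x" using z(2) by simp
          show "deg_above E l v (l v) \<le> K" if "v < n" "l v < l z" for v
            using K' that z(2) by simp
          show "c < D + K" if "?S e = Some (c, j)" for e c j
            using that bnd k T by (auto split: if_splits)
        qed
        show ?thesis
        proof (rule runs_conseq[OF IH], goal_cases)
          case (1 t2 M2)
          then obtain S' R where S': "ready S' l M2" "dom S' = E" "consistent S' l"
             "\<forall>e c j. S' e = Some (c, j) \<longrightarrow> c < D + K"
             and R: "finite R" "card R \<le> l z + 1" "\<forall>e. e \<notin> R \<longrightarrow> S' e = ?S e" by blast
          let ?R = "insert {x, y} R"
          \<comment> \<open>The edge uncolored in this step is colored again later and thus already
            belongs to the recursive set; each step adds only \<open>{x, y}\<close>.\<close>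
          have "{x, z} \<in> R"
          proof (rule ccontr)
            assume "{x, z} \<notin> R"
            then have "S' {x, z} = ?S {x, z}" using R(3) by blast
            then show False using zE S'(2) by auto
          qed
          then have "\<forall>e. e \<notin> ?R \<longrightarrow> S' e = S e" using R(3) by auto
          moreover have "card ?R \<le> l x + 1" using R z(2) by (simp add: card_insert_if)
          moreover have "3 + t + t2 \<le> (l x + 1) * (600 * (H + 2) + 3) + 3"
          proof -
            have "(l z + 2) * (600 * (H + 2) + 3) \<le> (l x + 1) * (600 * (H + 2) + 3)"
              using z(2) by (intro mult_right_mono) auto
            moreover have "(l z + 2) * (600 * (H + 2) + 3) = (l z + 1) * (600 * (H + 2) + 3) + (600 * (H + 2) + 3)"
              by (simp add: algebra_simps)
            ultimately show ?thesis using 1 t by linarith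
          qed
          moreover have "M2 a = M a"
            if "a \<notin> color_vars" for a
            using 1 fr that by metis
          ultimately have "Q (3 + t + t2) M2" unfolding Q_def using S' R(1) by blast
          then show ?case by (simp add: add.commute)
        qed
      qed
    qed
    done
  then show ?case unfolding Q_def .
qed

end

section \<open>Moving a node to another level\<close>

text \<open>Scalar 27 holds the moved node, 28 its old level, 20 the number of edges of the old bucket that
  are still to be checked and 26 the size of the stack in array 6.\<close>

definition rebucket_step :: com where
  "rebucket_step =
     20 ::= Var 20 \<ominus> Const 1 ;; 12 ::= (Var 27 \<otimes> Var 11 \<oplus> Var 28) \<otimes> Var 11 ;; select ;;
     15 ::= Var 27 ;; 16 ::= Read 3 (Var 27 \<otimes> Var 11 \<oplus> Var 13) ;;
     If (Read 4 (Var 15) \<prec> Read 4 (Var 16)) (30 ::= Read 4 (Var 15)) (30 ::= Read 4 (Var 16)) ;;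
     If (Var 30 \<doteq> Var 28) Skip
       (remove_edge ;; 17 ::= Var 30 ;; add_edge ;;
        Write 6 (Var 26) (Var 16) ;; 26 ::= Var 26 \<oplus> Const 1)"

definition rebucket_loop :: com where
  "rebucket_loop = While (Var 20) rebucket_step"

definition rebucket :: "expr \<Rightarrow> com" where
  "rebucket e = 28 ::= Read 4 (Var 27) ;; Write 4 (Var 27) e ;;
     20 ::= Read 5 ((Var 27 \<otimes> Var 11 \<oplus> Var 28) \<otimes> Var 11 \<oplus> Const 1) ;; rebucket_loop"

text \<open>A violating node stays on the stack while it moves, since it may have to move again; it
  is popped only once its condition holds.\<close>

definition fix_loop :: "expr \<Rightarrow> expr \<Rightarrow> com" where
  "fix_loop b e = While (Var 26) (27 ::= Read 6 (Var 26 \<ominus> Const 1) ;;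
     If b (rebucket e) (26 ::= Var 26 \<ominus> Const 1))"

lemma rank_strict_mono:
  "finite F \<Longrightarrow> c \<in> F \<Longrightarrow> c < d \<Longrightarrow> card {x \<in> F. x < c} < card {x \<in> F. x < d}" for c d :: nat
  by (rule psubset_card_mono) auto

context coloring_ram
begin

abbreviation (input) rebucket_vars :: "nat set" where
  "rebucket_vars \<equiv> {1, 2, 3, 5, 6, 12, 13, 14, 15, 16, 17, 20, 21, 26, 30}"

abbreviation (input) rebucket_alt where
  "rebucket_alt S l v i k s M M' \<equiv>
     \<exists>c w. S {v, w} = Some (c, i) \<and> card {d \<in> colors S v i. d < c} = k \<and>
      (if min (l v) (l w) = i then ready S l M' \<and> M' 6 = M 6 \<and> M' 26 = M 26
       else ready (S({v, w} \<mapsto> (c, min (l v) (l w)))) l M' \<and> M' 6 = (M 6)(s := w) \<and> M' 26 0 = s + 1)"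

lemma runs_rebucket_step:
  assumes r: "ready S l M" and M: "M 27 0 = v" "M 28 0 = i" "M 20 0 = Suc k" "M 26 0 = s"
    and v: "v < n" "i < full" and k: "k < card (colors S v i)" and s: "s + 1 < W"
  shows "runs W rebucket_step M (\<lambda>t M'. t \<le> 600 * (H + 2) \<and>
    unchanged rebucket_vars M M' \<and> M' 20 0 = k \<and>
    (rebucket_alt S l v i k s M M'))"
    (is "runs W _ M ?Q")
proof -
  define Q where "Q = ?Q"
  note rd = readyD[OF r]
  note S = rd(1)
  have iB: "i < B" using v(2) full_less(1) by linarith
  have F: "colors S v i \<subseteq> {..<2 ^ H}" using colors_bounded[OF S] .
  have kW: "Suc k < W" "k < W" using k card_colors_less[OF S v(1), of i] word_small(1) by linarith+
  define M1 where "M1 = M(20 := (M 20)(0 := k), 12 := (M 12)(0 := (v * B + i) * B))"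
  have r1: "ready S l M1" using r by (simp add: M1_def)
  have sel: "runs W select M1
    (\<lambda>t M'. t \<le> 50 * (H + 1) \<and> unchanged {13, 14, 21} M1 M' \<and>
       M' 13 0 \<in> colors S v i \<and> card {d \<in> colors S v i. d < M' 13 0} = M1 20 0)"
  proof (rule runs_select[OF F, where K = "(v * B + i) * B"])
    show "4 * 2 ^ H \<le> W" using B_bounds B_le by linarith
    show "(v * B + i) * B + 2 * 2 ^ H \<le> W"
      using index3_less[OF node_less_B[OF v(1)] iB, of "2 * 2 ^ H"] B_cube B_bounds by simp
    show "M1 5 ((v * B + i) * B + x) = tree_count H (colors S v i) x" if "0 < x" "x < 2 * 2 ^ H" for x
      using readyD(10)[OF r1 v(1) iB that] .
  qed (use readyD(4)[OF r1] k in \<open>auto simp: M1_def\<close>)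
  have "runs W rebucket_step M Q"
    unfolding rebucket_step_def using M v iB kW rd(5)
    apply (simp add: runs_basic)
    apply (fold M1_def)
    apply (rule runs_conseq[OF sel])
    subgoal premises p for t M2
    proof -
      define c where "c = M2 13 0"
      have t: "t \<le> 50 * (H + 1)" and c: "c \<in> colors S v i" "card {d \<in> colors S v i. d < c} = k"
        using p by (auto simp: c_def M1_def)
      have fr2: "M2 a = M a" if "a \<notin> {12, 13, 14, 20, 21}" for a using p that by (simp add: M1_def)
      have r2: "ready S l M2" by (rule ready_cong[THEN iffD2, OF _ r]) (use fr2 in auto)
      note rd2 = readyD[OF r2]
      obtain w j where "S {v, w} = Some (c, j)" "i = j \<or> i = full" using c(1) by (auto simp: colors_def)
      then have w: "S {v, w} = Some (c, i)" using v(2) by auto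
      note d = valid_stateD[OF S w]
      have cB: "c < B" "c < W" using d(4) B_bounds B_le by linarith+
      define b where "b = min (l v) (l w)"
      have lvl: "M2 4 v = l v" "M2 4 w = l w" "l v < W" "l w < W" "i < W" "M2 3 (v * B + c) = w"
        using rd2(6)[OF v(1)] rd2(6)[OF d(2)] rd2(8)[OF v(1)] rd2(8)[OF d(2)] iB B_le rd2(9)[OF w] by linarith+
      have regs: "M2 27 0 = v" "M2 28 0 = i" "M2 26 0 = s" "M2 11 0 = B" "M2 20 0 = k" "M2 13 0 = c"
        using fr2 M p rd2(5) by (auto simp: c_def M1_def)
      define M3 where "M3 = M2(15 := (M2 15)(0 := v), 16 := (M2 16)(0 := w), 30 := (M2 30)(0 := b))"
      have r3: "ready S l M3" using r2 by (simp add: M3_def)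
      have bW: "b < W" "b < full" using lvl rd2(7)[OF v(1)] by (auto simp: b_def)
      have M3': "l v < l w \<Longrightarrow> M2(15 := (M2 15)(0 := v), 16 := (M2 16)(0 := w), 30 := (M2 30)(0 := l v)) = M3"
        "\<not> l v < l w \<Longrightarrow> M2(15 := (M2 15)(0 := v), 16 := (M2 16)(0 := w), 30 := (M2 30)(0 := l w)) = M3"
        by (auto simp: M3_def b_def min_def)
      have fr3: "M3 a = M a" if "a \<notin> {12, 13, 14, 15, 16, 20, 21, 30}" for a using fr2 that by (simp add: M3_def)
      have M3r: "M3 15 0 = v" "M3 16 0 = w" "M3 30 0 = b" "M3 28 0 = i" "M3 26 0 = s" "M3 20 0 = k"
        using regs by (auto simp: M3_def)
      \<comment> \<open>The time \<open>m\<close> of the commands executed before this point is left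
        open here and fixed when the pieces are joined.\<close>
      have main: "runs W (If (Var 30 \<doteq> Var 28) Skip
       (remove_edge ;; 17 ::= Var 30 ;; add_edge ;;
        Write 6 (Var 26) (Var 16) ;; 26 ::= Var 26 \<oplus> Const 1)) M3 (\<lambda>t' M'. \<forall>m \<le> 100. Q (m + t + t') M')"
      proof (cases "b = i")
        case True
        have "rebucket_alt S l v i k s M M3"
          using w c True r3 fr3 by (intro exI[of _ c] exI[of _ w]) (simp add: b_def)
        then show ?thesis using True M3r lvl bW t fr3 by (simp add: runs_basic Q_def)
      next
        case False
        let ?S1 = "S({v, w} := None)"
        have rem: "runs W remove_edge M3 (remove_edge_post ?S1 l c i M3)"
          by (rule runs_remove_edge[OF r3 w]) (use M3r in auto)
        have free: "c \<notin> colors ?S1 v full" "c \<notin> colors ?S1 w full"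
          using colors_delete[OF S w] by auto
        show ?thesis using False M3r lvl bW
          apply (simp add: runs_basic)
          apply (rule runs_conseq[OF rem])
          subgoal premises p4 for t4 M4
          proof -
            have m4: "M4 15 0 = v" "M4 16 0 = w" "M4 30 0 = b" "M4 13 0 = c" using p4 M3r by auto
            define M5 where "M5 = M4(17 := (M4 17)(0 := b))"
            have add: "runs W add_edge M5 (\<lambda>t M'. t \<le> 200 * (H + 2) \<and>
              ready (?S1({v, w} \<mapsto> (c, b))) l M' \<and> unchanged {1, 2, 3, 5, 12, 14} M5 M')"
              by (rule runs_add_edge) (use p4 m4 d bW free in \<open>simp_all add: M5_def\<close>)
            show ?thesis
              apply (simp add: runs_basic m4 bW)
              apply (fold M5_def)
              apply (rule runs_conseq[OF add])
              subgoal premises p6 for t6 M6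
              proof -
                have fr6: "M6 a = M3 a" if "a \<notin> {1, 2, 3, 5, 12, 13, 14, 17}" for a
                  using p6 p4 that by (simp add: M5_def)
                then have m: "M6 26 0 = s" "M6 16 0 = w" "M6 20 0 = k" "M6 6 = M 6" using M3r fr3 by auto
                define M7 where "M7 = M6(6 := (M 6)(s := w), 26 := (M6 26)(0 := s + 1))"
                have r7: "ready (S({v, w} \<mapsto> (c, b))) l M7" using p6 by (simp add: M7_def)
                have fr7: "unchanged rebucket_vars M M7"
                  using fr6 fr3 by (simp add: M7_def)
                have "rebucket_alt S l v i k s M M7"
                  using w c False r7 by (intro exI[of _ c] exI[of _ w]) (simp add: b_def M7_def)
                moreover have "M7 20 0 = k" using m by (simp add: M7_def)
                ultimately have "Q q M7" if "q \<le> 600 * (H + 2)" for q using fr7 that unfolding Q_def by blast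
                moreover have "s < W" using s by simp
                moreover have "t6 \<le> 200 * (H + 2)" "t4 \<le> 200 * (H + 2)" using p6 p4 by blast+
                ultimately show ?thesis using t m s d(1,2) B_bounds(7)
                  by (simp add: runs_basic M7_def[symmetric])
              qed
              done
          qed
          done
      qed
      show ?thesis
      proof (cases "l v < l w")
        case True
        show ?thesis using True regs lvl cB v d
          apply (simp add: runs_basic M3'(1)[OF True] c_def[symmetric] del: runs_If)
          apply (simp add: runs_If[of W "Read 4 (Var 15) \<prec> Read 4 (Var 16)"] runs_Write M3'(1)[OF True])
          apply (rule runs_conseq[OF main])
          apply (erule allE[of _ 47])
          apply (simp add: algebra_simps)
          done
      next
        case False
        show ?thesis using False regs lvl cB v d
          apply (simp add: runs_basic M3'(2)[OF False] c_def[symmetric] del: runs_If)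
          apply (simp add: runs_If[of W "Read 4 (Var 15) \<prec> Read 4 (Var 16)"] runs_Write M3'(2)[OF False])
          apply (rule runs_conseq[OF main])
          apply (erule allE[of _ 47])
          apply (simp add: algebra_simps)
          done
      qed
    qed
    done
  then show ?thesis unfolding Q_def .
qed

end

context coloring_ram
begin

definition stack :: "memory \<Rightarrow> nat set" where
  "stack M = M 6 ` {..<M 26 0}"

definition same_colors :: "state \<Rightarrow> state \<Rightarrow> bool" where
  "same_colors S S' \<longleftrightarrow> (\<forall>e. map_option fst (S' e) = map_option fst (S e))"

lemma same_colors_dom: "same_colors S S' \<Longrightarrow> dom S' = dom S"
proof -
  assume "same_colors S S'"
  then have "S' e = None \<longleftrightarrow> S e = None" for e
    unfolding same_colors_def by (metis map_option_is_None)
  then show ?thesis by (simp add: dom_def)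
qed

abbreviation (input) rebucket_loop_post where
  "rebucket_loop_post S l v i k M \<equiv> \<lambda>t (M'::memory). t \<le> k * (600 * (H + 2) + 3) + 3 \<and>
    unchanged rebucket_vars M M' \<and>
    M' 26 0 \<le> M 26 0 + k \<and> stack M \<subseteq> stack M' \<and> stack M' \<subseteq> stack M \<union> {..<n} \<and>
    (\<forall>w c. S {v, w} = Some (c, i) \<longrightarrow> min (l v) (l w) \<noteq> i \<longrightarrow> w \<in> stack M') \<and>
    (\<exists>S'. ready S' l M' \<and> consistent S' l \<and> same_colors S S')"

text \<open>Ranks are processed downwards: taking the color of rank \<open>k\<close> out of the
  bucket leaves smaller ranks unchanged. Throughout, every misfiled edge is at \<open>v\<close> in
  bucket \<open>i\<close>, and those of rank at least \<open>k\<close> are settled; for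
  \<open>k = 0\<close> this yields consistency.\<close>

lemma runs_rebucket_loop:
  assumes "ready S l M" "M 27 0 = v" "M 28 0 = i" "M 20 0 = k" "v < n" "i < full"
    "k \<le> card (colors S v i)" "M 26 0 + k < W"
    "\<And>w c. S {v, w} = Some (c, i) \<Longrightarrow> k \<le> card {d \<in> colors S v i. d < c} \<Longrightarrow> min (l v) (l w) = i"
    "\<And>u w c j. S {u, w} = Some (c, j) \<Longrightarrow> j = min (l u) (l w) \<or> j = i \<and> (u = v \<or> w = v)"
  shows "runs W rebucket_loop M (rebucket_loop_post S l v i k M)"
  using assms
proof (induction k arbitrary: S M)
  case 0
  note p = 0
  have ok: "min (l v) (l w) = i" if "S {v, w} = Some (c, i)" for w c using p(9)[OF that] by simp
  have "consistent S l" unfolding consistent_def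
  proof (intro allI impI)
    fix u w c j assume a: "S {u, w} = Some (c, j)"
    show "j = min (l u) (l w)"
    proof (rule ccontr)
      assume "j \<noteq> min (l u) (l w)"
      then have "j = i" "u = v \<or> w = v" using p(10)[OF a] by auto
      then show False using ok[of w c] ok[of u c] a \<open>j \<noteq> min (l u) (l w)\<close>
        by (auto simp: insert_commute min.commute)
    qed
  qed
  moreover have "same_colors S S" by (simp add: same_colors_def)
  ultimately show ?case unfolding rebucket_loop_def using p ok
    by (subst runs_While) (auto simp: runs_basic)
next
  case (Suc k)
  note p = Suc.prems
  note S = readyD(1)[OF p(1)]
  define F where "F = colors S v i"
  have finF: "finite F" using colors_bounded[OF S] finite_subset unfolding F_def by blast
  have kF: "k < card F" using p(7) by (simp add: F_def)
  define Q where "Q = (rebucket_loop_post S l v i (Suc k) M)"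
  have step: "runs W rebucket_step M (\<lambda>t M'. t \<le> 600 * (H + 2) \<and>
    unchanged rebucket_vars M M' \<and> M' 20 0 = k \<and>
    (rebucket_alt S l v i k (M 26 0) M M'))"
    by (rule runs_rebucket_step) (use p in auto)
  have "runs W rebucket_loop M Q"
    unfolding rebucket_loop_def using p(4,7) card_colors_less[OF S p(5), of i] word_small(1)
    apply (subst runs_While)
    apply (simp add: runs_basic)
    apply (fold rebucket_loop_def)
    apply (rule runs_conseq[OF step])
    subgoal premises q for t M1
    proof -
      have t: "t \<le> 600 * (H + 2)"
        and fr: "unchanged rebucket_vars M M1"
        and k1: "M1 20 0 = k" using q by blast+
      obtain c w where w: "S {v, w} = Some (c, i)" and rank: "card {d \<in> F. d < c} = k"
        and alt: "if min (l v) (l w) = i then ready S l M1 \<and> M1 6 = M 6 \<and> M1 26 = M 26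
       else ready (S({v, w} \<mapsto> (c, min (l v) (l w)))) l M1 \<and> M1 6 = (M 6)(M 26 0 := w) \<and> M1 26 0 = M 26 0 + 1"
        using q unfolding F_def by blast
      have uniq: "w' = w" if "S {v, w'} = Some (c, j)" for w' j
        using S w that unfolding valid_state_def by blast
      have cF: "c \<in> F" using w by (auto simp: F_def colors_def)
      have regs: "M1 27 0 = v" "M1 28 0 = i" using fr p(2,3) by auto
      have wn: "w < n" using valid_stateD[OF S w] by simp
      have time: "3 + t + t' \<le> Suc k * (600 * (H + 2) + 3) + 3" if "t' \<le> k * (600 * (H + 2) + 3) + 3" for t'
        using that t by simp
      show ?thesis
      proof (cases "min (l v) (l w) = i")
        case True
        then have r1: "ready S l M1" and m: "M1 6 = M 6" "M1 26 = M 26" using alt by auto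
        have IH: "runs W rebucket_loop M1 (rebucket_loop_post S l v i k M1)"
        proof (rule Suc.IH[OF r1 regs k1 p(5,6) _ _ _ p(10)])
          show "k \<le> card (colors S v i)" "M1 26 0 + k < W" using p(7,8) m by auto
          fix w' c' assume w': "S {v, w'} = Some (c', i)" "k \<le> card {d \<in> colors S v i. d < c'}"
          have c'F: "c' \<in> F" using w' by (auto simp: F_def colors_def)
          show "min (l v) (l w') = i"
          proof (cases "c' = c")
            case True
            then show ?thesis using uniq w' \<open>min (l v) (l w) = i\<close> by blast
          next
            case False
            then have "card {d \<in> F. d < c'} \<noteq> k"
              using rank_strict_mono[OF finF cF, of c'] rank_strict_mono[OF finF c'F, of c] rank by linarith
            then have "Suc k \<le> card {d \<in> colors S v i. d < c'}" using w'(2) by (simp add: F_def)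
            then show ?thesis using p(9)[OF w'(1)] by blast
          qed
        qed
        have st: "stack M1 = stack M" by (simp add: stack_def m)
        show ?thesis
        proof (rule runs_conseq[OF IH], goal_cases)
          case (1 t' M')
          then have "Q (3 + t + t') M'" using time[of t'] fr unfolding Q_def st m by fastforce
          then show ?case by (simp add: add.commute)
        qed
      next
        case False
        define b where "b = min (l v) (l w)"
        let ?S = "S({v, w} \<mapsto> (c, b))"
        have r1: "ready ?S l M1" and m: "M1 6 = (M 6)(M 26 0 := w)" "M1 26 0 = M 26 0 + 1"
          using alt False by (auto simp: b_def)
        have st: "stack M1 = insert w (stack M)"
          unfolding stack_def m by (auto simp: lessThan_Suc image_iff)
        have bi: "b \<noteq> i" using False by (simp add: b_def)
        have vw: "{v, w'} = {v, w} \<longleftrightarrow> w' = w" for w' by (auto simp: doubleton_eq_iff)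
        have F1: "colors ?S v i = F - {c}"
        proof -
          have "colors ?S v i = colors (S({v, w} := None)) v i"
            using colors_insert[of "S({v, w} := None)" v w c b v i] bi p(6) by simp
          then show ?thesis using colors_delete[OF S w, of v i] by (simp add: F_def)
        qed
        have sc: "same_colors S ?S" using w by (simp add: same_colors_def)
        have IH: "runs W rebucket_loop M1 (rebucket_loop_post ?S l v i k M1)"
        proof (rule Suc.IH[OF r1 regs k1 p(5,6)])
          show "k \<le> card (colors ?S v i)" using kF cF finF by (simp add: F1)
          show "M1 26 0 + k < W" using p(8) m by simp
          fix w' c' assume w': "?S {v, w'} = Some (c', i)" "k \<le> card {d \<in> colors ?S v i. d < c'}"
          have ww: "w' \<noteq> w" using w'(1) bi by auto
          then have w'S: "S {v, w'} = Some (c', i)" using w'(1) vw by simp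
          then have c'F: "c' \<in> F" by (auto simp: F_def colors_def)
          have cc: "c' \<noteq> c" using uniq w'S ww by blast
          \<comment> \<open>A color below \<open>c\<close> keeps its rank, which is less than
            \<open>k\<close>. So \<open>c'\<close> lies above \<open>c\<close>, and its rank before
            the removal was at least \<open>Suc k\<close>.\<close>
          have "\<not> c' < c"
          proof
            assume "c' < c"
            then have "{d \<in> F - {c}. d < c'} = {d \<in> F. d < c'}" by auto
            then show False using rank_strict_mono[OF finF c'F \<open>c' < c\<close>] rank w'(2) by (simp add: F1)
          qed
          then have "{d \<in> F. d < c'} = insert c {d \<in> F - {c}. d < c'}" using cF cc by auto
          then have "card {d \<in> F. d < c'} = Suc (card {d \<in> F - {c}. d < c'})" using finF by simp
          then have "Suc k \<le> card {d \<in> colors S v i. d < c'}" using w'(2) by (simp add: F1 F_def)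
          then show "min (l v) (l w') = i" using p(9)[OF w'S] by blast
        next
          fix u' w' c' j assume a: "?S {u', w'} = Some (c', j)"
          show "j = min (l u') (l w') \<or> j = i \<and> (u' = v \<or> w' = v)"
          proof (cases "{u', w'} = {v, w}")
            case True
            then have "j = b" using a by simp
            then show ?thesis using True by (auto simp: b_def doubleton_eq_iff min.commute)
          next
            case False
            then have "S {u', w'} = Some (c', j)" using a by simp
            then show ?thesis by (rule p(10))
          qed
        qed
        show ?thesis
        proof (rule runs_conseq[OF IH], goal_cases)
          case (1 t' M')
          then obtain S' where S': "ready S' l M'" "consistent S' l" "same_colors ?S S'" by blast
          have "same_colors S S'" using sc S'(3) unfolding same_colors_def by metis
          moreover have "w' \<in> stack M'" if "S {v, w'} = Some (c', i)" "min (l v) (l w') \<noteq> i" for w' c'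
          proof (cases "w' = w")
            case True
            then show ?thesis using 1 st by blast
          next
            case False
            then have "?S {v, w'} = Some (c', i)" using that vw by simp
            then show ?thesis using 1 that by blast
          qed
          moreover have "M' 26 0 \<le> M 26 0 + Suc k" using 1 m by simp
          moreover have "stack M \<subseteq> stack M'" "stack M' \<subseteq> stack M \<union> {..<n}" using 1 st wn by auto
          moreover have "unchanged rebucket_vars M M'"
            using 1 fr by simp
          ultimately have "Q (3 + t + t') M'" using time[of t'] 1 S' unfolding Q_def by blast
          then show ?case by (simp add: add.commute)
        qed
      qed
    qed
    done
  then show ?case unfolding Q_def .
qed

section \<open>Moving one node completely\<close>

abbreviation (input) move_vars :: "nat set" where
  "move_vars \<equiv> {1, 2, 3, 4, 5, 6, 12, 13, 14, 15, 16, 17, 20, 21, 26, 28, 30}"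

abbreviation (input) rebucket_post where
  "rebucket_post S l v i M \<equiv> \<lambda>t M'. t \<le> (deg_above (dom S) l v (l v) + 1) * (600 * (H + 2) + 50) \<and>
    unchanged move_vars M M' \<and>
    M' 26 0 \<le> M 26 0 + deg_above (dom S) l v (l v) \<and> stack M \<subseteq> stack M' \<and> stack M' \<subseteq> stack M \<union> {..<n} \<and>
    (\<forall>w. w \<in> adj (dom S) v \<longrightarrow> l v \<le> l w \<longrightarrow> min i (l w) \<noteq> l v \<longrightarrow> w \<in> stack M') \<and>
    (\<exists>S'. ready S' (l(v := i)) M' \<and> consistent S' (l(v := i)) \<and> same_colors S S')"

text \<open>Searching the old bucket suffices: an edge to a node below \<open>v\<close> is filed
  under the level of that node, and stays there because the new level is at least every level
  smaller than the old one.\<close>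

lemma runs_rebucket:
  assumes r: "ready S l M" and c: "consistent S l" and M: "M 27 0 = v" and v: "v < n"
    and e: "\<And>M. M 28 0 = l v \<Longrightarrow> eval W M e = Some i" "expr_cost e = 4"
    and i: "i < full" "\<And>x. x < l v \<Longrightarrow> x \<le> i" and s: "M 26 0 + deg_above (dom S) l v (l v) < W"
  shows "runs W (rebucket e) M (rebucket_post S l v i M)"
    (is "runs W _ M ?Q")
proof -
  define Q where "Q = ?Q"
  note rd = readyD[OF r]
  note S = rd(1)
  let ?k = "deg_above (dom S) l v (l v)"
  have lv: "M 4 v = l v" "l v < full" "l v < B" "l v < W" using rd(6,7,8)[OF v] B_le by linarith+
  have k: "card (colors S v (l v)) = ?k" by (rule card_colors_level[OF S c lv(2)])
  have cnt: "count M v (l v) 1 = ?k" using rd(11)[OF v lv(3)] k by simp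
  have kW: "?k < W" using s by simp
  have iW: "i < W" using i(1) full_less(1) B_le by linarith
  have idx: "(v * B + l v) * B + 1 < W" using v lv B_bounds by simp
  define M1 where "M1 = M(28 := (M 28)(0 := l v), 4 := (M 4)(v := i), 20 := (M 20)(0 := ?k))"
  have nadj: "w \<noteq> v" if "S {v, w} = Some x" for w x
    using valid_stateD(3)[OF S, of v w "fst x" "snd x"] that by auto
  have r1: "ready S (l(v := i)) M1"
    using r i(1) by (simp add: ready_def represents_def M1_def)
  have bk: "j = min (l u) (l w)" if "S {u, w} = Some (d, j)" for u w d j
    using c that unfolding consistent_def by blast
  have loop: "runs W rebucket_loop M1 (rebucket_loop_post S (l(v := i)) v (l v) ?k M1)"
  proof (rule runs_rebucket_loop[OF r1])
    fix w d assume a: "S {v, w} = Some (d, l v)" and "?k \<le> card {x \<in> colors S v (l v). x < d}"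
    moreover have "card {x \<in> colors S v (l v). x < d} < card (colors S v (l v))"
    proof (rule psubset_card_mono)
      show "finite (colors S v (l v))" using colors_bounded[OF S] finite_subset by blast
      show "{x \<in> colors S v (l v). x < d} \<subset> colors S v (l v)" using a by (auto simp: colors_def)
    qed
    ultimately show "min ((l(v := i)) v) ((l(v := i)) w) = l v" using k by simp
  next
    fix u w d j assume a: "S {u, w} = Some (d, j)"
    note d = valid_stateD[OF S a]
    have j: "j = min (l u) (l w)" using bk[OF a] .
    show "j = min ((l(v := i)) u) ((l(v := i)) w) \<or> j = l v \<and> (u = v \<or> w = v)"
    proof -
      have "l u < l v \<longrightarrow> l u \<le> i" "l w < l v \<longrightarrow> l w \<le> i" using i(2) by auto
      then show ?thesis using j d(3) by (auto simp: min_def)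
    qed
  qed (use M k v lv s in \<open>auto simp: M1_def\<close>)
  have st: "stack M1 = stack M" by (simp add: stack_def M1_def)
  have "runs W (rebucket e) M Q"
    unfolding rebucket_def using M v lv kW iW idx cnt rd(5)
    apply (simp add: runs_basic e)
    apply (fold M1_def)
    apply (rule runs_conseq[OF loop])
    subgoal premises p for t M'
    proof -
      have "w \<in> stack M'" if w: "w \<in> adj (dom S) v" "l v \<le> l w" "min i (l w) \<noteq> l v" for w
      proof -
        obtain d j where dj: "S {v, w} = Some (d, j)" using w(1) by (auto simp: adj_def)
        then have "j = l v" using bk[OF dj] w(2) by simp
        then show ?thesis using p dj nadj[OF dj] w(3) by (metis fun_upd_apply)
      qed
      moreover have "M' a = M a"
        if "a \<notin> move_vars" for a
        using p that by (simp add: M1_def)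
      moreover have "M' 26 0 \<le> M 26 0 + ?k" "stack M \<subseteq> stack M'" "stack M' \<subseteq> stack M \<union> {..<n}"
        using p st by (simp_all add: M1_def)
      moreover have "\<exists>S'. ready S' (l(v := i)) M' \<and> consistent S' (l(v := i)) \<and> same_colors S S'"
        using p by blast
      moreover have "40 + t \<le> (?k + 1) * (600 * (H + 2) + 50)"
      proof -
        have "?k * (600 * (H + 2) + 3) \<le> ?k * (600 * (H + 2) + 50)" by (intro mult_left_mono) auto
        moreover have "(?k + 1) * (600 * (H + 2) + 50) = ?k * (600 * (H + 2) + 50) + (600 * (H + 2) + 50)" by (simp add: algebra_simps)
        moreover have "t \<le> ?k * (600 * (H + 2) + 3) + 3" using p by blast
        ultimately show ?thesis by linarith
      qed
      ultimately have "Q q M'" if "q \<le> 40 + t" for q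
        using order_trans[OF that, of "(?k + 1) * (600 * (H + 2) + 50)"] unfolding Q_def by blast
      then show ?thesis using e(2) by simp
    qed
    done
  then show ?thesis unfolding Q_def .
qed

section \<open>Repairing all levels at amortized cost\<close>

abbreviation (input) fix_loop_post where
  "fix_loop_post Inv viol pot S l M \<equiv> \<lambda>t (M'::memory). \<exists>S' l'. ready S' l' M' \<and> consistent S' l' \<and>
    same_colors S S' \<and> Inv l' \<and> (\<forall>v<n. \<not> viol l' v) \<and>
    N * t + (600 * (H + 2) + 120) * (2 * pot l') \<le> (600 * (H + 2) + 120) * (2 * pot l + N * M 26 0) + N * 3"

text \<open>Stated for both directions at once. A move with upper degree \<open>d\<close> lowers
  \<open>2 * pot\<close> by \<open>2 * N * (d + 1)\<close>: one half funds at most \<open>d\<close>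
  new stack entries, the other the time of the move, and each entry funds its own removal. Time
  carries the factor \<open>N\<close> because the potential is scaled. The same credit is the
  induction measure and bounds the stack size. By \<open>new\<close>, fresh violators are neighbors
  whose edge to \<open>v\<close> was refiled, hence they were pushed.\<close>

lemma runs_fix_loop:
  fixes pot :: "(nat \<Rightarrow> nat) \<Rightarrow> nat"
  assumes b: "\<And>S l M v. ready S l M \<Longrightarrow> consistent S l \<Longrightarrow> dom S = E \<Longrightarrow> M 27 0 = v \<Longrightarrow> v < n \<Longrightarrow>
      \<exists>x. eval W M b = Some x \<and> (x \<noteq> 0 \<longleftrightarrow> viol l v)" "expr_cost b \<le> 50"
    and e: "\<And>M i. M 28 0 = i \<Longrightarrow> i < full \<Longrightarrow> eval W M e = Some (nl i)" "expr_cost e = 4"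
    and inv: "\<And>l v. Inv l \<Longrightarrow> v < n \<Longrightarrow> viol l v \<Longrightarrow> Inv (l(v := nl (l v)))"
    and nl: "\<And>l v. Inv l \<Longrightarrow> v < n \<Longrightarrow> viol l v \<Longrightarrow> nl (l v) < full \<and> (\<forall>x<l v. x \<le> nl (l v))"
    and pot: "\<And>l v. Inv l \<Longrightarrow> v < n \<Longrightarrow> viol l v \<Longrightarrow>
      pot (l(v := nl (l v))) + N * (deg_above E l v (l v) + 1) \<le> pot l"
    and new: "\<And>l v w. Inv l \<Longrightarrow> v < n \<Longrightarrow> viol l v \<Longrightarrow> w < n \<Longrightarrow> w \<noteq> v \<Longrightarrow> viol (l(v := nl (l v))) w \<Longrightarrow>
      viol l w \<or> w \<in> adj E v \<and> l v \<le> l w \<and> min (nl (l v)) (l w) \<noteq> l v"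
    and init: "ready S l M" "consistent S l" "dom S = E" "Inv l" "stack M \<subseteq> {..<n}"
      "\<And>v. v < n \<Longrightarrow> viol l v \<Longrightarrow> v \<in> stack M" "2 * pot l + N * M 26 0 < W"
  shows "runs W (fix_loop b e) M (fix_loop_post Inv viol pot S l M)"
  using init
proof (induction "2 * pot l + N * M 26 0" arbitrary: S l M rule: less_induct)
  case less
  note p = less.prems
  let ?C = "600 * (H + 2) + 120"
  note rd = readyD[OF p(1)]
  have spW: "M 26 0 < W"
  proof -
    have "1 * M 26 0 \<le> N * M 26 0" using N_ge by (rule mult_right_mono) simp
    then show ?thesis using p(7) by linarith
  qed
  define Q where "Q = (fix_loop_post Inv viol pot S l M)"
  have refl: "same_colors S S" by (simp add: same_colors_def)
  have "runs W (fix_loop b e) M Q"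
  proof (cases "M 26 0 = 0")
    case True
    then have "stack M = {}" by (simp add: stack_def)
    then have "Q 3 M" unfolding Q_def using p refl True by (intro exI[of _ S] exI[of _ l]) auto
    then show ?thesis unfolding fix_loop_def using True by (subst runs_While) simp
  next
    case False
    define v where "v = M 6 (M 26 0 - 1)"
    have vs: "v \<in> stack M" using False by (auto simp: stack_def v_def)
    then have v: "v < n" using p(5) by auto
    define M1 where "M1 = M(27 := (M 27)(0 := v))"
    have r1: "ready S l M1" using p(1) by (simp add: M1_def)
    have m1: "M1 27 0 = v" "M1 26 0 = M 26 0" "stack M1 = stack M" by (simp_all add: M1_def stack_def)
    obtain x where x: "eval W M1 b = Some x" "x \<noteq> 0 \<longleftrightarrow> viol l v"
      using b(1)[OF r1 p(2,3) m1(1) v] by blast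
    have spW': "M 26 0 - 1 < W" using spW by simp
    have bW: "M 6 (M 26 0 - 1) < W" using v by (simp add: v_def[symmetric])
    \<comment> \<open>One iteration: it takes time \<open>T\<close>, at most \<open>?C * d\<close>,
      while the credit drops from \<open>q\<close> to \<open>q2\<close> by at least
      \<open>N * d\<close>; \<open>t2\<close> and \<open>q'\<close> belong to the remaining
      iterations.\<close>
    have arith: "N * (T + t2) + ?C * q' \<le> ?C * q + N * 3"
      if "N * t2 + ?C * q' \<le> ?C * q2 + N * 3" "q2 + N * d \<le> q" "T \<le> ?C * d" for t2 q' q2 q d T :: nat
    proof -
      have "N * T \<le> N * (?C * d)" using that(3) by (rule mult_left_mono) simp
      also have "\<dots> = ?C * (N * d)" by (rule mult.left_commute)
      finally have "N * T + ?C * q2 \<le> ?C * (N * d + q2)" by (simp only: distrib_left add_le_mono1)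
      also have "\<dots> \<le> ?C * q" using that(2) by (intro mult_left_mono) auto
      finally show ?thesis using that(1) unfolding distrib_left by linarith
    qed
    show ?thesis
    proof (cases "viol l v")
      case False
      define M2 where "M2 = M1(26 := (M1 26)(0 := M 26 0 - 1))"
      have r2: "ready S l M2" using r1 by (simp add: M2_def)
      have m2: "M2 26 0 = M 26 0 - 1" by (simp add: M2_def)
      have "{..<M 26 0} = insert (M 26 0 - 1) {..<M 26 0 - 1}" using \<open>M 26 0 \<noteq> 0\<close> by auto
      then have st: "stack M = insert v (stack M2)"
        by (simp add: stack_def M2_def M1_def v_def)
      have dec: "2 * pot l + N * M2 26 0 + N * 1 \<le> 2 * pot l + N * M 26 0"
      proof -
        have "M 26 0 = M2 26 0 + 1" using m2 \<open>M 26 0 \<noteq> 0\<close> by simp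
        then show ?thesis by (simp only: distrib_left)
      qed
      have IH: "runs W (fix_loop b e) M2 (fix_loop_post Inv viol pot S l M2)"
      proof (rule less.hyps[OF _ r2 p(2,3,4)])
        show "2 * pot l + N * M2 26 0 < 2 * pot l + N * M 26 0" "2 * pot l + N * M2 26 0 < W"
          using dec N_ge p(7) by linarith+
        show "stack M2 \<subseteq> {..<n}" using st p(5) by blast
        show "w \<in> stack M2" if "w < n" "viol l w" for w
          using p(6)[OF that] st that(2) False by (metis insertE)
      qed
      have *: "runs W (fix_loop b e) M2 (\<lambda>t. Q (17 + expr_cost b + t))"
      proof (rule runs_conseq[OF IH], goal_cases)
        case (1 t M')
        then obtain S' l' where *: "ready S' l' M'" "consistent S' l'" "same_colors S S'" "Inv l'"
          "\<forall>v<n. \<not> viol l' v" "N * t + ?C * (2 * pot l') \<le> ?C * (2 * pot l + N * M2 26 0) + N * 3" by blast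
        have "N * (17 + expr_cost b + t) + ?C * (2 * pot l') \<le> ?C * (2 * pot l + N * M 26 0) + N * 3"
          by (rule arith[OF *(6) dec]) (use b(2) in simp)
        then show ?case unfolding Q_def using * by blast
      qed
      show ?thesis using x \<open>M 26 0 \<noteq> 0\<close> spW spW' bW False unfolding fix_loop_def
        apply (subst runs_While)
        apply (simp add: runs_basic v_def[symmetric] M1_def[symmetric] m1)
        apply (fold M2_def fix_loop_def)
        apply (rule runs_conseq[OF *])
        apply (simp add: add.commute add.left_commute)
        done
    next
      case True
      let ?i = "nl (l v)" and ?d = "deg_above E l v (l v)"
      let ?l = "l(v := ?i)"
      have nlv: "?i < full" "\<And>x. x < l v \<Longrightarrow> x \<le> ?i" using nl[OF p(4) v True] by auto
      have pt: "pot ?l + N * (?d + 1) \<le> pot l" by (rule pot[OF p(4) v True])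
      have spd: "M1 26 0 + deg_above (dom S) l v (l v) < W"
      proof -
        have "1 * (M 26 0 + ?d) \<le> N * (M 26 0 + ?d)" using N_ge by (rule mult_right_mono) simp
        also have "\<dots> \<le> 2 * pot l + N * M 26 0" using pt by (simp add: distrib_left)
        finally show ?thesis using p(3,7) m1 by simp
      qed
      have reb: "runs W (rebucket e) M1 (rebucket_post S l v ?i M1)"
        by (rule runs_rebucket[OF r1 p(2) m1(1) v _ e(2) nlv spd]) (use e(1) rd(7)[OF v] in auto)
      have *: "runs W (rebucket e) M1 (\<lambda>t1 M2. runs W (fix_loop b e) M2 (\<lambda>t2. Q (11 + expr_cost b + t1 + t2)))"
      proof (rule runs_conseq[OF reb], goal_cases)
        case (1 t1 M2)
        note q = 1[unfolded p(3) m1(2,3)]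
        then obtain S2 where S2: "ready S2 ?l M2" "consistent S2 ?l" "same_colors S S2" by blast
        have dom2: "dom S2 = E" using same_colors_dom[OF S2(3)] p(3) by simp
        have sp2: "N * M2 26 0 \<le> N * M 26 0 + N * ?d"
          using q mult_left_mono[of "M2 26 0" "M 26 0 + ?d" N] by (simp add: distrib_left)
        have dec: "2 * pot ?l + N * M2 26 0 + N * (?d + 1) \<le> 2 * pot l + N * M 26 0"
          using sp2 pt by (simp add: distrib_left)
        have pos: "0 < N * (?d + 1)" using N_ge by simp
        have IH: "runs W (fix_loop b e) M2 (fix_loop_post Inv viol pot S2 ?l M2)"
        proof (rule less.hyps[OF _ S2(1,2) dom2 inv[OF p(4) v True]])
          show "2 * pot ?l + N * M2 26 0 < 2 * pot l + N * M 26 0" "2 * pot ?l + N * M2 26 0 < W"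
            using dec pos p(7) by linarith+
          show "stack M2 \<subseteq> {..<n}" using q p(5) by blast
          show "w \<in> stack M2" if w: "w < n" "viol ?l w" for w
          proof (cases "w = v")
            case True
            then show ?thesis using vs q by blast
          next
            case False
            show ?thesis using new[OF p(4) v True w(1) False w(2)] p(6)[OF w(1)] q by blast
          qed
        qed
        show ?case
        proof (rule runs_conseq[OF IH], goal_cases)
          case (1 t M')
          then obtain S' l' where *: "ready S' l' M'" "consistent S' l'" "same_colors S2 S'" "Inv l'"
            "\<forall>v<n. \<not> viol l' v" "N * t + ?C * (2 * pot l') \<le> ?C * (2 * pot ?l + N * M2 26 0) + N * 3" by blast
          have "11 + expr_cost b + t1 \<le> ?C * (?d + 1)"
          proof -
            have "11 + expr_cost b \<le> (?d + 1) * 70" using b(2) by simp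
            moreover have "t1 \<le> (?d + 1) * (600 * (H + 2) + 50)" using q by blast
            ultimately have "11 + expr_cost b + t1 \<le> (?d + 1) * 70 + (?d + 1) * (600 * (H + 2) + 50)"
              by (rule add_mono)
            also have "\<dots> = ?C * (?d + 1)" by (simp add: algebra_simps)
            finally show ?thesis .
          qed
          then have "N * (11 + expr_cost b + t1 + t) + ?C * (2 * pot l') \<le> ?C * (2 * pot l + N * M 26 0) + N * 3"
            by (rule arith[OF *(6) dec])
          moreover have "same_colors S S'" using S2(3) *(3) by (simp add: same_colors_def)
          ultimately show ?case unfolding Q_def using * by blast
        qed
      qed
      show ?thesis using x \<open>M 26 0 \<noteq> 0\<close> spW spW' bW True unfolding fix_loop_def
        apply (subst runs_While)
        apply (simp add: runs_basic v_def[symmetric] M1_def[symmetric] m1)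
        apply (fold fix_loop_def)
        apply (rule runs_conseq[OF *])
        apply (erule runs_conseq)
        apply (simp add: add.commute add.left_commute)
        done
    qed
  qed
  then show ?case unfolding Q_def .
qed

end

section \<open>Processing an update\<close>

text \<open>In the absence of preprocessing this runs at every update; its cost is only
  logarithmic.\<close>

definition init :: "nat \<Rightarrow> com" where
  "init N = 10 ::= Const 1 ;; While (Var 10 \<prec> Const 2 \<otimes> Var 0) (10 ::= Const 2 \<otimes> Var 10) ;;
     11 ::= Const (4 * N) \<otimes> Var 10"

text \<open>An update of one edge can only make its two endpoints violate a level condition.\<close>

definition push_endpoints :: com where
  "push_endpoints = Write 6 (Const 0) (Read 0 (Const 3)) ;; Write 6 (Const 1) (Read 0 (Const 4)) ;;
     26 ::= Const 2"

definition raise_cond :: "nat \<Rightarrow> expr" where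
  "raise_cond N = Const (4 * N + 5) \<otimes> Read 0 (Const 1) \<prec>
     Const N \<otimes> Read 5 ((Var 27 \<otimes> Var 11 \<oplus> Read 4 (Var 27)) \<otimes> Var 11 \<oplus> Const 1)"

text \<open>The product serves as a conjunction. Both factors are always evaluated; on level 0 the
  truncated subtraction makes the second read refer to bucket 0 again, which does no harm.\<close>

definition lower_cond :: "nat \<Rightarrow> expr" where
  "lower_cond N = (Const 0 \<prec> Read 4 (Var 27)) \<otimes>
     (Const N \<otimes> (Read 5 ((Var 27 \<otimes> Var 11 \<oplus> Read 4 (Var 27)) \<otimes> Var 11 \<oplus> Const 1) \<oplus>
        Read 5 ((Var 27 \<otimes> Var 11 \<oplus> (Read 4 (Var 27) \<ominus> Const 1)) \<otimes> Var 11 \<oplus> Const 1))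
      \<prec> Const (2 * N + 1) \<otimes> Read 0 (Const 1))"

text \<open>Coloring precedes the repair of the levels: at that moment the degree bounds of the old
  graph still hold for the colored edges.\<close>

definition insert_edge :: "nat \<Rightarrow> com" where
  "insert_edge N =
     If (Read 4 (Read 0 (Const 4)) \<prec> Read 4 (Read 0 (Const 3)))
       (15 ::= Read 0 (Const 4) ;; 16 ::= Read 0 (Const 3))
       (15 ::= Read 0 (Const 3) ;; 16 ::= Read 0 (Const 4)) ;;
     22 ::= Const 1 ;; color_loop ;; push_endpoints ;; fix_loop (raise_cond N) (Var 28 \<oplus> Const 1)"

definition delete_edge :: "nat \<Rightarrow> com" where
  "delete_edge N = 15 ::= Read 0 (Const 3) ;; 16 ::= Read 0 (Const 4) ;; remove_edge ;;
     push_endpoints ;; fix_loop (lower_cond N) (Var 28 \<ominus> Const 1)"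

definition coloring_program :: "nat \<Rightarrow> com" where
  "coloring_program N = init N ;; If (Read 0 (Const 2)) (insert_edge N) (delete_edge N)"

context coloring_ram
begin

lemma runs_init_loop:
  assumes "M 0 0 = n" "M 10 0 = 2 ^ (H - h)" "h \<le> H"
  shows "runs W (While (Var 10 \<prec> Const 2 \<otimes> Var 0) (10 ::= Const 2 \<otimes> Var 10)) M
    (\<lambda>t M'. t \<le> 20 * h + 20 \<and> M' 10 0 = 2 ^ H \<and> (\<forall>a. a \<noteq> 10 \<longrightarrow> M' a = M a))"
  using assms
proof (induction h arbitrary: M)
  case 0
  have "2 * n < W" using H_ge word_small(3) by linarith
  then show ?case using 0 H_ge by (subst runs_While) (simp add: runs_basic)
next
  case (Suc h)
  have "2 * n < W" using H_ge word_small(3) by linarith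
  have e: "(2::nat) ^ (H - h) = 2 * 2 ^ (H - Suc h)" using Suc.prems(3) by (metis Suc_diff_le diff_Suc_Suc power_Suc)
  have le: "(2::nat) ^ (H - h) \<le> 2 ^ H" by (rule power_increasing) auto
  have lt: "2 ^ (H - Suc h) < 2 * n" using le e H_le by linarith
  have w: "2 ^ (H - Suc h) < W" "2 * 2 ^ (H - Suc h) < W" using le e word_small(3) by linarith+
  let ?M = "M(10 := (M 10)(0 := 2 * 2 ^ (H - Suc h)))"
  have IH: "runs W (While (Var 10 \<prec> Const 2 \<otimes> Var 0) (10 ::= Const 2 \<otimes> Var 10)) ?M
    (\<lambda>t M'. t \<le> 20 * h + 20 \<and> M' 10 0 = 2 ^ H \<and> (\<forall>a. a \<noteq> 10 \<longrightarrow> M' a = ?M a))"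
    by (rule Suc.IH) (use Suc.prems e in auto)
  show ?case using Suc.prems(1,2) lt w \<open>2 * n < W\<close>
    apply (subst runs_While)
    apply (simp add: runs_basic)
    apply (rule runs_conseq[OF IH])
    apply simp
    done
qed

lemma runs_init:
  assumes r: "represents S l M"
  shows "runs W (init N) M (\<lambda>t M'. t \<le> 20 * (H + 2) \<and> ready S l M' \<and>
    unchanged {10, 11} M M')"
proof -
  define Q where "Q = (\<lambda>t M'. t \<le> 20 * (H + 2) \<and> ready S l M' \<and> unchanged {10, 11} M M')"
  let ?M = "M(10 := (M 10)(0 := 1))"
  have n: "M 0 0 = n" using r by (simp add: represents_def)
  have loop: "runs W (While (Var 10 \<prec> Const 2 \<otimes> Var 0) (10 ::= Const 2 \<otimes> Var 10)) ?M
    (\<lambda>t M'. t \<le> 20 * H + 20 \<and> M' 10 0 = 2 ^ H \<and> (\<forall>a. a \<noteq> 10 \<longrightarrow> M' a = ?M a))"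
    by (rule runs_init_loop) (use n in auto)
  have w: "4 * N < W" "4 * N * 2 ^ H = B" using B_bounds B_le by (auto simp: B_def)
  have "runs W (init N) M Q" unfolding init_def
    apply (simp add: runs_basic)
    apply (rule runs_conseq[OF loop])
    subgoal premises p for t M1
    proof -
      have "represents S l (M1(11 := (M1 11)(0 := B)))"
        by (rule represents_cong[THEN iffD2, OF _ r]) (use p in auto)
      then show ?thesis using p w by (simp add: runs_basic Q_def ready_def)
    qed
    done
  then show ?thesis unfolding Q_def .
qed

lemma push_endpoints_spec:
  assumes "M 0 3 = u" "M 0 4 = v" "u < n" "v < n"
  shows "runs W push_endpoints M (\<lambda>t M'. t \<le> 20 \<and> stack M' = {u, v} \<and> M' 26 0 = 2 \<and>
    unchanged {6, 26} M M')"
proof -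
  have "{..<2::nat} = {0, 1}" by auto
  then show ?thesis unfolding push_endpoints_def using assms by (simp add: runs_basic stack_def)
qed

text \<open>The largest upper degree that does not force a rise, and so the number of colors needed
  beyond the maximum degree.\<close>

definition K :: nat where "K = (4 * N + 5) * \<alpha> div N"

definition up_viol :: "nat set set \<Rightarrow> (nat \<Rightarrow> nat) \<Rightarrow> nat \<Rightarrow> bool" where
  "up_viol E l v \<longleftrightarrow> (4 * N + 5) * \<alpha> < N * deg_above E l v (l v)"

definition down_viol :: "nat set set \<Rightarrow> (nat \<Rightarrow> nat) \<Rightarrow> nat \<Rightarrow> bool" where
  "down_viol E l v \<longleftrightarrow> 0 < l v \<and> N * deg_above E l v (l v - 1) < (2 * N + 1) * \<alpha>"

definition pot :: "nat set set \<Rightarrow> (nat \<Rightarrow> nat) \<Rightarrow> nat" where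
  "pot E l = potential n \<alpha> N L E l"

text \<open>\<open>D\<close> will be the maximum degree over the whole sequence. It occurs in the
  analysis only; no memory cell holds it.\<close>

definition invariant :: "nat \<Rightarrow> nat set set \<Rightarrow> state \<Rightarrow> (nat \<Rightarrow> nat) \<Rightarrow> memory \<Rightarrow> bool" where
  "invariant D E S l M \<longleftrightarrow> represents S l M \<and> dom S = E \<and> consistent S l \<and>
     (\<forall>e c j. S e = Some (c, j) \<longrightarrow> c < D + K) \<and>
     (\<forall>v<n. \<not> up_viol E l v \<and> \<not> down_viol E l v)"

lemma not_up_viol: "\<not> up_viol E l v \<Longrightarrow> deg_above E l v (l v) \<le> K"
  using N_ge by (simp add: up_viol_def K_def less_eq_div_iff_mult_less_eq mult.commute)

lemma level_less_L:
  assumes "graph_on n E" "arboricity {..<n} E \<le> \<alpha>" "\<And>v. v < n \<Longrightarrow> \<not> down_viol E l v" "v < n"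
  shows "l v < L"
  unfolding L_def
proof (rule level_bound[OF assms(1,2) N_ge \<alpha>_ge _ _ assms(4)])
  show "n < 2 ^ H" using H_ge n_ge by linarith
  show "(2 * N + 1) * \<alpha> \<le> N * deg_above E l v (l v - 1)" if "v < n" "0 < l v" for v
    using assms(3)[OF that(1)] that(2) by (auto simp: down_viol_def)
qed

lemma pot_word:
  assumes "graph_on n E" "\<And>v. v < n \<Longrightarrow> l v \<le> L"
  shows "2 * pot E l + N * 2 < W"
proof -
  define X where "X = N * (n * n * (4 * L + 2)) + 5 * (n * (L * ((2 * N + 1) ^ 2 * \<alpha>)))"
  have "pot E l \<le> X" unfolding pot_def X_def by (rule potential_le[OF assms])
  moreover have "2 * X + 4 * N < W" using W_stack unfolding X_def L_def .
  ultimately show ?thesis by linarith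
qed

lemma threshold_words: "4 * N + 5 < W" "(4 * N + 5) * \<alpha> < W" "2 * N + 1 < W" "(2 * N + 1) * \<alpha> < W" "N < W" "\<alpha> < W"
proof -
  show 1: "(4 * N + 5) * \<alpha> < W" by (rule W_threshold)
  have "(4 * N + 5) * 1 \<le> (4 * N + 5) * \<alpha>" using \<alpha>_ge by (rule mult_left_mono) simp
  then show 2: "4 * N + 5 < W" using le_less_trans[OF _ 1] by simp
  then show "2 * N + 1 < W" "N < W" by linarith+
  have "1 * \<alpha> \<le> (4 * N + 5) * \<alpha>" by (rule mult_right_mono) auto
  then show "\<alpha> < W" using le_less_trans[OF _ 1] by simp
  have "(2 * N + 1) * \<alpha> \<le> (4 * N + 5) * \<alpha>" by (rule mult_right_mono) auto
  then show "(2 * N + 1) * \<alpha> < W" using le_less_trans[OF _ 1] by blast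
qed

lemma N_count_word: "x < 2 * n \<Longrightarrow> N * x < W"
proof -
  assume "x < 2 * n"
  then have "x < B" using H_ge B_bounds(1) by linarith
  moreover have "N \<le> B" using B_bounds(2) by linarith
  ultimately have "N * x \<le> B * B" by (intro mult_mono) auto
  moreover have "N * x \<noteq> B * B"
  proof
    assume "N * x = B * B"
    moreover have "N * x \<le> B * x" using \<open>N \<le> B\<close> by simp
    moreover have "B * x < B * B" using \<open>x < B\<close> B_bounds(6) by simp
    ultimately show False by linarith
  qed
  ultimately show ?thesis using BB_le by linarith
qed

lemma eval_raise_cond:
  assumes r: "ready S l M" and c: "consistent S l" and M: "M 27 0 = v" "v < n"
  shows "eval W M (raise_cond N) = Some (if up_viol (dom S) l v then 1 else 0)"
proof -
  note rd = readyD[OF r]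
  have l: "l v < full" "l v < B" "M 4 v = l v" "l v < W" using rd(6,7,8)[OF M(2)] B_le by linarith+
  have cnt: "count M v (l v) 1 = deg_above (dom S) l v (l v)"
    using rd(11)[OF M(2) l(2)] card_colors_level[OF rd(1) c l(1)] by simp
  have g: "graph_on n (dom S)" using rd(1) by (simp add: valid_state_def)
  have d: "deg_above (dom S) l v (l v) < n" by (rule deg_above_less[OF g M(2)])
  have w: "N * deg_above (dom S) l v (l v) < W" "deg_above (dom S) l v (l v) < W"
    using N_count_word[of "deg_above (dom S) l v (l v)"] d word_small(1) by linarith+
  have idx: "(v * B + l v) * B + 1 < W" using M(2) l B_bounds by simp
  show ?thesis unfolding raise_cond_def up_viol_def
    using threshold_words w idx l cnt M rd(3,5) by simp
qed

lemma eval_lower_cond: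
  assumes r: "ready S l M" and c: "consistent S l" and M: "M 27 0 = v" "v < n"
  shows "\<exists>x. eval W M (lower_cond N) = Some x \<and> (x \<noteq> 0 \<longleftrightarrow> down_viol (dom S) l v)"
proof -
  note rd = readyD[OF r]
  have l: "l v < full" "l v < B" "M 4 v = l v" "l v < W" "l v - 1 < W" "l v - 1 < B"
    using rd(6,7,8)[OF M(2)] B_le by linarith+
  let ?a = "card (colors S v (l v))" and ?b = "card (colors S v (l v - 1))"
  have cnt: "count M v (l v) 1 = ?a" "count M v (l v - 1) 1 = ?b"
    using rd(11)[OF M(2)] l by auto
  have d: "?a < n" "?b < n" using card_colors_less[OF rd(1) M(2)] by auto
  have w: "N * (?a + ?b) < W" "?a < W" "?b < W" "?a + ?b < W"
    using N_count_word[of "?a + ?b"] d H_ge word_small(1,3) by linarith+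
  have idx: "(v * B + l v) * B + 1 < W" "(v * B + (l v - 1)) * B + 1 < W" using M(2) l B_bounds by simp_all
  have ev: "eval W M (lower_cond N) = Some ((if 0 < l v then 1 else 0) *
      (if N * (?a + ?b) < (2 * N + 1) * \<alpha> then 1 else 0))"
    unfolding lower_cond_def
    using threshold_words w idx l cnt M rd(3,5) by simp
  have "down_viol (dom S) l v \<longleftrightarrow> 0 < l v \<and> N * (?a + ?b) < (2 * N + 1) * \<alpha>"
    using card_colors_below[OF rd(1) c l(1)] by (auto simp: down_viol_def)
  then show ?thesis using ev by auto
qed

lemma full_plus: "full + 1 = B"
  unfolding full_def using B_bounds(6) by linarith

text \<open>A rise creates no node that must fall: the risen node has more than (4 + 5/N) \<alpha>
  neighbors from its old level upwards, and the others only gain. As no node must fall, sparsity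
  keeps all levels below \<open>L\<close>; applied after the rise, this shows that the new level is
  still in range.\<close>

lemma runs_raise_loop:
  assumes g: "graph_on n E" and ab: "arboricity {..<n} E \<le> \<alpha>"
    and r: "ready S l M" "consistent S l" "dom S = E" and dv: "\<And>v. v < n \<Longrightarrow> \<not> down_viol E l v"
    and st: "stack M \<subseteq> {..<n}" "\<And>v. v < n \<Longrightarrow> up_viol E l v \<Longrightarrow> v \<in> stack M" and sp: "M 26 0 = 2"
  shows "runs W (fix_loop (raise_cond N) (Var 28 \<oplus> Const 1)) M (fix_loop_post (\<lambda>l. \<forall>v<n. \<not> down_viol E l v) (up_viol E) (pot E) S l M)"
proof (rule runs_fix_loop[where nl = Suc and E = E and viol = "up_viol E" and Inv = "\<lambda>l. \<forall>v<n. \<not> down_viol E l v"])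
  let ?Inv = "\<lambda>l. \<forall>v<n. \<not> down_viol E l v"
  have lvl: "l v < L" if "?Inv l" "v < n" for l v using level_less_L[OF g ab] that by blast
  have nadj: "v \<notin> adj E v" for v using graph_on_adj[OF g] by blast
  show inv: "?Inv (l(v := Suc (l v)))" if a: "?Inv l" "v < n" "up_viol E l v" for l v
  proof (intro allI impI)
    fix w assume w: "w < n"
    show "\<not> down_viol E (l(v := Suc (l v))) w"
    proof (cases "w = v")
      case True
      have "(2 * N + 1) * \<alpha> \<le> (4 * N + 5) * \<alpha>" by (rule mult_right_mono) auto
      also have "\<dots> \<le> N * deg_above E l v (l v)" using a(3) by (simp add: up_viol_def)
      finally show ?thesis using True nadj by (simp add: down_viol_def deg_above_raise[OF g])
    next
      case False
      have "N * deg_above E l w k \<le> N * deg_above E (l(v := Suc (l v))) w k" for k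
        unfolding deg_above_raise[OF g] by (rule mult_left_mono) auto
      then show ?thesis using a(1) w False unfolding down_viol_def
        by (metis fun_upd_other le_less_trans)
    qed
  qed
  show "Suc (l v) < full \<and> (\<forall>x<l v. x \<le> Suc (l v))" if a: "?Inv l" "v < n" "up_viol E l v" for l v
  proof -
    have "Suc (l v) < L" using lvl[OF inv[OF a] a(2)] by simp
    then show ?thesis using B_bounds(3) full_plus by auto
  qed
  show "pot E (l(v := Suc (l v))) + N * (deg_above E l v (l v) + 1) \<le> pot E l"
    if a: "?Inv l" "v < n" "up_viol E l v" for l v
    unfolding pot_def
    by (rule potential_raise[where l = l and v = v, OF g a(2) lvl[OF a(1,2)] N_ge \<alpha>_ge]) (use a(3) in \<open>simp add: up_viol_def\<close>)
  show "up_viol E l w \<or> w \<in> adj E v \<and> l v \<le> l w \<and> min (Suc (l v)) (l w) \<noteq> l v"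
    if a: "?Inv l" "v < n" "up_viol E l v" "w < n" "w \<noteq> v" "up_viol E (l(v := Suc (l v))) w" for l v w
    using a(5,6) unfolding up_viol_def deg_above_raise[OF g] by (auto simp: adj_sym[of w] split: if_splits)
  show "2 * pot E l + N * M 26 0 < W" using pot_word[OF g] lvl dv sp by (simp add: less_imp_le)
  show "expr_cost (raise_cond N) \<le> 50" by (simp add: raise_cond_def)
  show "eval W M (Var 28 \<oplus> Const 1) = Some (Suc i)" if "M 28 0 = i" "i < full" for M i
  proof -
    have "i + 1 < W" "i < W" using that(2) full_less(1) B_le by linarith+
    then show ?thesis using that(1) by simp
  qed
  show "\<exists>x. eval W M (raise_cond N) = Some x \<and> (x \<noteq> 0 \<longleftrightarrow> up_viol E l v)"
    if "ready S l M" "consistent S l" "dom S = E" "M 27 0 = v" "v < n" for S l M v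
    using eval_raise_cond[OF that(1,2,4,5)] that(3) by auto
qed (use r dv st in auto)

text \<open>A fall creates no node that must rise: upper degrees of other nodes only shrink, and the
  fallen node keeps fewer than (2 + 1/N) \<alpha> neighbors above. The bound \<open>L\<close> is
  carried along, since the sparsity argument does not apply while some nodes must fall.\<close>

lemma runs_lower_loop:
  assumes g: "graph_on n E"
    and r: "ready S l M" "consistent S l" "dom S = E" and uv: "\<And>v. v < n \<Longrightarrow> \<not> up_viol E l v"
    and lv: "\<And>v. v < n \<Longrightarrow> l v \<le> L"
    and st: "stack M \<subseteq> {..<n}" "\<And>v. v < n \<Longrightarrow> down_viol E l v \<Longrightarrow> v \<in> stack M" and sp: "M 26 0 = 2"
  shows "runs W (fix_loop (lower_cond N) (Var 28 \<ominus> Const 1)) M (fix_loop_post (\<lambda>l. \<forall>v<n. \<not> up_viol E l v \<and> l v \<le> L) (down_viol E) (pot E) S l M)"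
proof (rule runs_fix_loop[where nl = "\<lambda>i. i - 1" and E = E and viol = "down_viol E"
      and Inv = "\<lambda>l. \<forall>v<n. \<not> up_viol E l v \<and> l v \<le> L"])
  let ?Inv = "\<lambda>l. \<forall>v<n. \<not> up_viol E l v \<and> l v \<le> L"
  have nadj: "v \<notin> adj E v" for v using graph_on_adj[OF g] by blast
  have low: "deg_above E l x k = deg_above E (l(v := l v - 1)) x k + (if v \<in> adj E x \<and> k = l v then 1 else 0)"
    if "down_viol E l v" for l v x k
    using that by (intro deg_above_lower[OF g]) (simp add: down_viol_def)
  show "?Inv (l(v := l v - 1))" if a: "?Inv l" "v < n" "down_viol E l v" for l v
  proof (intro allI impI conjI)
    fix w assume w: "w < n"
    show "(l(v := l v - 1)) w \<le> L" using a w by (auto simp: le_diff_conv trans_le_add1)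
    show "\<not> up_viol E (l(v := l v - 1)) w"
    proof (cases "w = v")
      case True
      have "N * deg_above E l v (l v - 1) < (2 * N + 1) * \<alpha>" using a(3) by (simp add: down_viol_def)
      also have "\<dots> \<le> (4 * N + 5) * \<alpha>" by (rule mult_right_mono) auto
      finally show ?thesis using True nadj low[OF a(3), of v "l v - 1"] by (simp add: up_viol_def)
    next
      case False
      have "N * deg_above E (l(v := l v - 1)) w (l w) \<le> N * deg_above E l w (l w)"
        unfolding low[OF a(3), of w "l w"] by (rule mult_left_mono) auto
      then show ?thesis using a(1) w False unfolding up_viol_def
        by (metis fun_upd_other less_le_trans)
    qed
  qed
  show "l v - 1 < full \<and> (\<forall>x<l v. x \<le> l v - 1)" if a: "?Inv l" "v < n" "down_viol E l v" for l v
  proof -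
    have "l v \<le> L" using a by simp
    then show ?thesis using B_bounds(3) full_plus by auto
  qed
  show "pot E (l(v := l v - 1)) + N * (deg_above E l v (l v) + 1) \<le> pot E l"
    if a: "?Inv l" "v < n" "down_viol E l v" for l v
    unfolding pot_def
    by (rule potential_lower[where l = l and v = v, OF g a(2) _ _ N_ge]) (use a in \<open>simp_all add: down_viol_def\<close>)
  show "down_viol E l w \<or> w \<in> adj E v \<and> l v \<le> l w \<and> min (l v - 1) (l w) \<noteq> l v"
    if a: "?Inv l" "v < n" "down_viol E l v" "w < n" "w \<noteq> v" "down_viol E (l(v := l v - 1)) w" for l v w
  \<comment> \<open>The condition of \<open>w\<close> involves the level \<open>l v\<close> only if
    \<open>w\<close> lies one level above \<open>v\<close>; then the edge \<open>vw\<close> changes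
    its bucket and \<open>w\<close> is pushed.\<close>
  proof (cases "v \<in> adj E w \<and> l w - 1 = l v")
    case True
    then show ?thesis using a(3) by (auto simp: adj_sym[of w] down_viol_def)
  next
    case False
    then have "deg_above E l w (l w - 1) = deg_above E (l(v := l v - 1)) w (l w - 1)"
      using low[OF a(3), of w "l w - 1"] by auto
    then show ?thesis using a(5,6) by (simp add: down_viol_def)
  qed
  show "2 * pot E l + N * M 26 0 < W" using pot_word[OF g] lv sp by simp
  show "expr_cost (lower_cond N) \<le> 50" by (simp add: lower_cond_def)
  show "eval W M (Var 28 \<ominus> Const 1) = Some (i - 1)" if "M 28 0 = i" "i < full" for M i
  proof -
    have "i - 1 < W" "i < W" using that(2) full_less(1) B_le by linarith+
    then show ?thesis using that(1) by simp
  qed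
  show "\<exists>x. eval W M (lower_cond N) = Some x \<and> (x \<noteq> 0 \<longleftrightarrow> down_viol E l v)"
    if "ready S l M" "consistent S l" "dom S = E" "M 27 0 = v" "v < n" for S l M v
    using eval_lower_cond[OF that(1,2,4,5)] that(3) by auto
qed (use r uv lv st in auto)

definition C :: nat where "C = 600 * (H + 2) + 120"

lemma represents_input: "represents S l (input_update x M) \<longleftrightarrow> represents S l M"
  by (cases x) (simp_all add: represents_def)

text \<open>\<open>T\<close> is the time outside the repair loop and \<open>pot0\<close> the
  potential right after the change of the graph; its allowed jump covers insertion and deletion
  alike. The term \<open>N * 2\<close> is the credit of the two endpoints on the initial
  stack.\<close>

lemma amortized_bound:
  assumes t: "T \<le> C * (L + 1)" and p: "pot0 \<le> p + N * (10 * N * L + 2)"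
    and f: "N * t + C * (2 * q) \<le> C * (2 * pot0 + N * 2) + N * 3"
  shows "N * (T + t) + 2 * C * q \<le> 2 * C * p + N * (C * (50 * N * L))"
proof -
  have "2 * N * 2 \<le> 2 * N * H" using B_bounds(7) by (rule mult_left_mono) simp
  then have L4: "4 * N \<le> L" by (simp add: L_def)
  then have L: "4 \<le> L" using N_ge by linarith
  have NL: "L \<le> N * L" using N_ge by simp
  have "N * T \<le> N * (C * (L + 1))" using t by (rule mult_left_mono) simp
  moreover have "C * (2 * pot0 + N * 2) \<le> C * (2 * (p + N * (10 * N * L + 2)) + N * 2)"
    using p by (intro mult_left_mono) auto
  moreover have "N * 3 \<le> N * (C * 1)" by (rule mult_left_mono) (auto simp: C_def)
  moreover have "N * (T + t) + 2 * C * q = N * T + (N * t + C * (2 * q))" by (simp add: algebra_simps)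
  ultimately have "N * (T + t) + 2 * C * q \<le>
      N * (C * (L + 1)) + C * (2 * (p + N * (10 * N * L + 2)) + N * 2) + N * (C * 1)"
    using f by linarith
  also have "\<dots> = 2 * C * p + N * (C * (L + 20 * (N * L) + 8))" by (simp add: algebra_simps)
  also have "\<dots> \<le> 2 * C * p + N * (C * (50 * (N * L)))"
  proof -
    have "L + 20 * (N * L) + 8 \<le> 50 * (N * L)" using L NL by linarith
    then show ?thesis by (intro add_left_mono mult_left_mono) auto
  qed
  finally show ?thesis by (simp add: mult.assoc)
qed

section \<open>Insertion and deletion of an edge\<close>

abbreviation (input) update_post where
  "update_post D E E' S l \<equiv> \<lambda>t M'. \<exists>S' l' R. invariant D E' S' l' M' \<and> finite R \<and> card R \<le> L + 1 \<and>
    (\<forall>e. e \<notin> R \<longrightarrow> map_option fst (S' e) = map_option fst (S e)) \<and>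
    N * t + 2 * C * pot E' l' \<le> 2 * C * pot E l + N * (C * (50 * N * L))"

lemma runs_insert:
  assumes inv: "invariant D E S l M" and g: "graph_on n E" and ab: "arboricity {..<n} E \<le> \<alpha>"
    and uv: "u < n" "v < n" "u \<noteq> v" "{u, v} \<notin> E" and ab': "arboricity {..<n} (insert {u, v} E) \<le> \<alpha>"
    and D: "\<And>x. x < n \<Longrightarrow> card (adj (insert {u, v} E) x) \<le> D"
  shows "runs W (coloring_program N) (input_update (Insert u v) M) (update_post D E (insert {u, v} E) S l)"
    (is "runs W _ _ ?Q")
proof -
  define Q where "Q = ?Q"
  let ?E = "insert {u, v} E"
  define M0 where "M0 = input_update (Insert u v) M"
  have r0: "represents S l M0" using inv by (simp only: M0_def represents_input invariant_def)
  have in0: "M0 0 2 = 1" "M0 0 3 = u" "M0 0 4 = v" by (auto simp: M0_def)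
  have dom: "dom S = E" and cons: "consistent S l" and bnd: "\<And>e c j. S e = Some (c, j) \<Longrightarrow> c < D + K"
    and nv: "\<And>v. v < n \<Longrightarrow> \<not> up_viol E l v" "\<And>v. v < n \<Longrightarrow> \<not> down_viol E l v"
    using inv by (auto simp: invariant_def)
  have g': "graph_on n ?E" using g uv by (auto simp: graph_on_def)
  have lL: "l w < L" if "w < n" for w by (rule level_less_L[OF g ab nv(2) that])
  define x where "x = (if l v < l u then v else u)"
  define y where "y = (if l v < l u then u else v)"
  have xy: "{x, y} = {u, v}" "l x \<le> l y" "x < n" "y < n" using uv by (auto simp: x_def y_def)
  have nv': "\<not> down_viol ?E l w" if "w < n" for w
  proof -
    have "N * deg_above E l w k \<le> N * deg_above ?E l w k" for k
      by (intro mult_left_mono deg_above_insert_edge[OF g]) auto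
    then show ?thesis using nv(2)[OF that] unfolding down_viol_def by (meson le_less_trans)
  qed
  have uv': "w \<in> {u, v}" if "w < n" "up_viol ?E l w" for w
  proof (rule ccontr)
    assume "w \<notin> {u, v}"
    then have "N * deg_above ?E l w (l w) \<le> N * deg_above E l w (l w)"
      using deg_above_insert_edge(2)[OF g, of "{u, v}" l w "l w"] by (intro mult_left_mono) auto
    then show False using nv(1)[OF that(1)] that(2) unfolding up_viol_def by linarith
  qed
  have "runs W (coloring_program N) M0 Q"
    unfolding coloring_program_def
    apply (simp add: runs_basic)
    apply (rule runs_conseq[OF runs_init[OF r0]])
    subgoal premises p1 for t1 M1
    proof -
      have r1: "ready S l M1" and in1: "M1 0 2 = 1" "M1 0 3 = u" "M1 0 4 = v" using p1 in0 by auto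
      note rd = readyD[OF r1]
      have lv: "M1 4 u = l u" "M1 4 v = l v" "l u < W" "l v < W"
        using rd(6)[OF uv(1)] rd(6)[OF uv(2)] rd(8)[OF uv(1)] rd(8)[OF uv(2)] B_le by linarith+
      define M2 where "M2 = M1(15 := (M1 15)(0 := x), 16 := (M1 16)(0 := y), 22 := (M1 22)(0 := 1))"
      have r2: "ready S l M2" using r1 by (simp add: M2_def)
      have loop: "runs W color_loop M2 (color_loop_post ?E D K l S x M2)"
      proof (rule runs_color_loop[OF r2, where y = y])
        show "dom S = ?E - {{x, y}}" using dom uv(4) xy(1) by auto
        show "card (colors S x (l x)) \<le> K"
          using card_colors_level[OF rd(1) cons rd(7)[OF xy(3)]] not_up_viol[OF nv(1)[OF xy(3)]] dom by simp
        show "deg_above ?E l w (l w) \<le> K" if w: "w < n" "l w < l x" for w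
        proof -
          \<comment> \<open>As \<open>x\<close> is the lower endpoint, nodes strictly below it are
            untouched by the insertion and keep their old degree bound.\<close>
          have "w \<notin> {u, v}" using w xy by (auto simp: x_def split: if_splits)
          then show ?thesis using uv'[OF w(1)] not_up_viol by blast
        qed
      qed (use g' xy cons D bnd in \<open>auto simp: M2_def\<close>)
      have rest: "runs W (color_loop ;; push_endpoints ;; fix_loop (raise_cond N) (Var 28 \<oplus> Const 1)) M2
        (\<lambda>t M'. \<forall>m \<le> 60. Q (t1 + m + t) M')"
        apply (simp add: runs_basic)
        apply (rule runs_conseq[OF loop])
        subgoal premises p3 for t3 M3
        proof -
          obtain S3 R where S3: "ready S3 l M3" "dom S3 = ?E" "consistent S3 l"
            "\<forall>e c j. S3 e = Some (c, j) \<longrightarrow> c < D + K"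
            and R: "finite R" "card R \<le> l x + 1" "\<forall>e. e \<notin> R \<longrightarrow> S3 e = S e" using p3 by blast
          have in3: "M3 0 3 = u" "M3 0 4 = v" using p3 in1 by (auto simp: M2_def)
          show ?thesis
            apply (subst runs_Seq)
            apply (rule runs_conseq[OF push_endpoints_spec[of M3 u v, OF in3 uv(1,2)]])
            subgoal premises p4 for t4 M4
            proof -
              have r4: "ready S3 l M4" by (rule ready_cong[THEN iffD2, OF _ S3(1)]) (use p4 in auto)
              have st: "stack M4 = {u, v}" "M4 26 0 = 2" using p4 by blast+
              have fx: "runs W (fix_loop (raise_cond N) (Var 28 \<oplus> Const 1)) M4 (fix_loop_post (\<lambda>l. \<forall>v<n. \<not> down_viol ?E l v) (up_viol ?E) (pot ?E) S3 l M4)"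
                by (rule runs_raise_loop[OF g' ab' r4 S3(3,2) nv']) (use st uv uv' in auto)
              show ?thesis
              proof (rule runs_conseq[OF fx], intro allI impI)
                fix t5 M5 m assume m: "m \<le> (60::nat)" and "fix_loop_post (\<lambda>l. \<forall>v<n. \<not> down_viol ?E l v) (up_viol ?E) (pot ?E) S3 l M4 t5 M5"
                then obtain S' l' where S': "ready S' l' M5" "consistent S' l'" "same_colors S3 S'"
                  "\<forall>v<n. \<not> down_viol ?E l' v" "\<forall>v<n. \<not> up_viol ?E l' v"
                  "N * t5 + C * (2 * pot ?E l') \<le> C * (2 * pot ?E l + N * 2) + N * 3"
                  unfolding st C_def by blast
                have mf: "map_option fst (S' e) = map_option fst (S3 e)" for e
                  using S'(3) by (simp add: same_colors_def)
                have "c < D + K" if "S' e = Some (c, j)" for e c j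
                  using mf[of e] that S3(4)[rule_format, of e] by (cases "S3 e") auto
                then have "invariant D ?E S' l' M5"
                  using S' S3(2) same_colors_dom[OF S'(3)] by (auto simp: invariant_def ready_def)
                moreover have "card R \<le> L + 1" using R(2) lL[OF xy(3)] by linarith
                moreover have "\<forall>e. e \<notin> R \<longrightarrow> map_option fst (S' e) = map_option fst (S e)" using mf R(3) by simp
                moreover have "N * (t1 + m + t3 + t4 + t5) + 2 * C * pot ?E l' \<le> 2 * C * pot E l + N * (C * (50 * N * L))"
                proof (rule amortized_bound[OF _ _ S'(6)])
                  have "(l x + 1) * (600 * (H + 2) + 3) \<le> L * C"
                    using lL[OF xy(3)] by (intro mult_mono) (auto simp: C_def)
                  moreover have "t1 \<le> 20 * (H + 2)" "t4 \<le> 20" using p1 p4 by blast+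
                  moreover have "t3 \<le> (l x + 1) * (600 * (H + 2) + 3) + 3" using p3 by blast
                  moreover have "C * (L + 1) = L * C + C" by (simp add: algebra_simps)
                  moreover have "20 * (H + 2) + 60 + 3 + 20 \<le> C" by (simp add: C_def)
                  ultimately show "t1 + m + t3 + t4 \<le> C * (L + 1)" using m by linarith
                  have "4 * L + 2 \<le> 10 * N * L + 2" using N_ge by (intro add_right_mono mult_right_mono) auto
                  then have "N * (4 * L + 2) \<le> N * (10 * N * L + 2)" by (rule mult_left_mono) simp
                  moreover have "pot ?E l \<le> pot E l + N * (4 * L + 2)"
                    unfolding pot_def by (rule potential_insert[OF g refl])
                  ultimately show "pot ?E l \<le> pot E l + N * (10 * N * L + 2)" by linarith
                qed
                ultimately have "Q (t1 + m + t3 + t4 + t5) M5" using R(1) unfolding Q_def by blast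
                then show "Q (t1 + m + (t3 + (t4 + t5))) M5" by (simp add: add.assoc)
              qed
            qed
            done
        qed
        done
      show ?thesis
      proof (cases "l v < l u")
        case True
        then have M2: "M1(15 := (M1 15)(0 := v), 16 := (M1 16)(0 := u), 22 := (M1 22)(0 := 1)) = M2"
          by (simp add: M2_def x_def y_def)
        show ?thesis using in1 lv uv(1,2) True unfolding insert_edge_def
          apply (simp add: runs_If runs_Seq[of _ "If b c d" for b c d] runs_Seq[of _ "Write a c d" for a c d] runs_Write M2)
          apply (rule runs_conseq[OF rest])
          apply (erule allE[of _ 22])
          apply (simp add: algebra_simps)
          done
      next
        case False
        then have M2: "M1(15 := (M1 15)(0 := u), 16 := (M1 16)(0 := v), 22 := (M1 22)(0 := 1)) = M2"
          by (simp add: M2_def x_def y_def)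
        show ?thesis using in1 lv uv(1,2) False unfolding insert_edge_def
          apply (simp add: runs_If runs_Seq[of _ "If b c d" for b c d] runs_Seq[of _ "Write a c d" for a c d] runs_Write M2)
          apply (rule runs_conseq[OF rest])
          apply (erule allE[of _ 22])
          apply (simp add: algebra_simps)
          done
      qed
    qed
    done
  then show ?thesis unfolding Q_def M0_def .
qed

lemma runs_delete:
  assumes inv: "invariant D E S l M" and g: "graph_on n E" and ab: "arboricity {..<n} E \<le> \<alpha>"
    and uv: "u < n" "v < n" "u \<noteq> v" "{u, v} \<in> E"
  shows "runs W (coloring_program N) (input_update (Delete u v) M) (update_post D E (E - {{u, v}}) S l)"
    (is "runs W _ _ ?Q")
proof -
  define Q where "Q = ?Q"
  let ?E = "E - {{u, v}}"
  define M0 where "M0 = input_update (Delete u v) M"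
  have r0: "represents S l M0" using inv by (simp only: M0_def represents_input invariant_def)
  have in0: "M0 0 2 = 0" "M0 0 3 = u" "M0 0 4 = v" by (auto simp: M0_def)
  have dom: "dom S = E" and cons: "consistent S l" and bnd: "\<And>e c j. S e = Some (c, j) \<Longrightarrow> c < D + K"
    and nv: "\<And>v. v < n \<Longrightarrow> \<not> up_viol E l v" "\<And>v. v < n \<Longrightarrow> \<not> down_viol E l v"
    using inv by (auto simp: invariant_def)
  have g': "graph_on n ?E" using g by (auto simp: graph_on_def)
  have E: "insert {u, v} ?E = E" using uv(4) by blast
  have lL: "l w \<le> L" if "w < n" for w using level_less_L[OF g ab nv(2) that] by simp
  have "{u, v} \<in> dom S" using dom uv(4) by simp
  then obtain z where "S {u, v} = Some z" using domD by metis
  then obtain c j where cj: "S {u, v} = Some (c, j)" by (cases z) simp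
  let ?S = "S({u, v} := None)"
  have nv': "\<not> up_viol ?E l w" if "w < n" for w
  proof -
    have "N * deg_above ?E l w (l w) \<le> N * deg_above E l w (l w)"
      using deg_above_insert_edge(1)[OF g', of l w "l w" "{u, v}"] unfolding E by (intro mult_left_mono) auto
    then show ?thesis using nv(1)[OF that] unfolding up_viol_def by linarith
  qed
  have uv': "w \<in> {u, v}" if "w < n" "down_viol ?E l w" for w
  proof (rule ccontr)
    assume "w \<notin> {u, v}"
    then have "N * deg_above E l w k \<le> N * deg_above ?E l w k" for k
      using deg_above_insert_edge(2)[OF g', of "{u, v}" l w k] unfolding E by (intro mult_left_mono) auto
    then show False using nv(2)[OF that(1)] that(2) unfolding down_viol_def by (meson le_less_trans)
  qed
  have cons1: "consistent ?S l" using cons unfolding consistent_def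
    by (metis fun_upd_apply option.distinct(1))
  have dom1: "dom ?S = ?E" using dom by simp
  have "runs W (coloring_program N) M0 Q"
    unfolding coloring_program_def
    apply (simp add: runs_basic)
    apply (rule runs_conseq[OF runs_init[OF r0]])
    subgoal premises p1 for t1 M1
    proof -
      have r1: "ready S l M1" and in1: "M1 0 2 = 0" "M1 0 3 = u" "M1 0 4 = v" using p1 in0 by auto
      define M2 where "M2 = M1(15 := (M1 15)(0 := u), 16 := (M1 16)(0 := v))"
      have r2: "ready S l M2" using r1 by (simp add: M2_def)
      have rem: "runs W remove_edge M2 (remove_edge_post ?S l c j M2)"
        by (rule runs_remove_edge[OF r2 cj]) (auto simp: M2_def)
      have rest: "runs W (remove_edge ;; push_endpoints ;; fix_loop (lower_cond N) (Var 28 \<ominus> Const 1)) M2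
        (\<lambda>t M'. \<forall>m \<le> 60. Q (t1 + m + t) M')"
        apply (simp add: runs_basic)
        apply (rule runs_conseq[OF rem])
        subgoal premises p3 for t3 M3
        proof -
          have in3: "M3 0 3 = u" "M3 0 4 = v" using p3 in1 by (auto simp: M2_def)
          have r3: "ready ?S l M3" using p3 by blast
          show ?thesis
            apply (subst runs_Seq)
            apply (rule runs_conseq[OF push_endpoints_spec[of M3 u v, OF in3 uv(1,2)]])
            subgoal premises p4 for t4 M4
            proof -
              have r4: "ready ?S l M4" by (rule ready_cong[THEN iffD2, OF _ r3]) (use p4 in auto)
              have st: "stack M4 = {u, v}" "M4 26 0 = 2" using p4 by blast+
              have fx: "runs W (fix_loop (lower_cond N) (Var 28 \<ominus> Const 1)) M4 (fix_loop_post (\<lambda>l. \<forall>v<n. \<not> up_viol ?E l v \<and> l v \<le> L) (down_viol ?E) (pot ?E) ?S l M4)"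
                by (rule runs_lower_loop[OF g' r4 cons1 dom1 nv' lL]) (use st uv uv' in auto)
              show ?thesis
              proof (rule runs_conseq[OF fx], intro allI impI)
                fix t5 M5 m assume m: "m \<le> (60::nat)" and "fix_loop_post (\<lambda>l. \<forall>v<n. \<not> up_viol ?E l v \<and> l v \<le> L) (down_viol ?E) (pot ?E) ?S l M4 t5 M5"
                then obtain S' l' where S': "ready S' l' M5" "consistent S' l'" "same_colors ?S S'"
                  "\<forall>v<n. \<not> up_viol ?E l' v \<and> l' v \<le> L" "\<forall>v<n. \<not> down_viol ?E l' v"
                  "N * t5 + C * (2 * pot ?E l') \<le> C * (2 * pot ?E l + N * 2) + N * 3"
                  unfolding st C_def by blast
                have mf: "map_option fst (S' e) = map_option fst (?S e)" for e
                  using S'(3) by (simp add: same_colors_def)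
                have "c < D + K" if "S' e = Some (c, j)" for e c j
                  using mf[of e] that bnd by (cases "S e") (auto split: if_splits)
                then have "invariant D ?E S' l' M5"
                  using S' dom1 same_colors_dom[OF S'(3)] by (auto simp: invariant_def ready_def)
                \<comment> \<open>Uncoloring the deleted edge is the only color change; the falls
                  that follow keep all colors.\<close>
                moreover have "\<forall>e. e \<notin> {{u, v}} \<longrightarrow> map_option fst (S' e) = map_option fst (S e)" using mf by simp
                moreover have "N * (t1 + m + t3 + t4 + t5) + 2 * C * pot ?E l' \<le> 2 * C * pot E l + N * (C * (50 * N * L))"
                proof (rule amortized_bound[OF _ _ S'(6)])
                  have "t1 \<le> 20 * (H + 2)" "t4 \<le> 20" "t3 \<le> 200 * (H + 2)" using p1 p3 p4 by blast+
                  then have "t1 + m + t3 + t4 \<le> C" using m by (simp add: C_def)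
                  also have "\<dots> \<le> C * (L + 1)" by simp
                  finally show "t1 + m + t3 + t4 \<le> C * (L + 1)" .
                  have "pot ?E l \<le> pot E l + 10 * (N ^ 2 * L)"
                    unfolding pot_def by (rule potential_delete[OF g refl lL])
                  also have "\<dots> \<le> pot E l + N * (10 * N * L + 2)"
                    by (simp add: power2_eq_square algebra_simps)
                  finally show "pot ?E l \<le> pot E l + N * (10 * N * L + 2)" .
                qed
                ultimately have "Q (t1 + m + t3 + t4 + t5) M5" unfolding Q_def
                  by (intro exI[of _ S'] exI[of _ l'] exI[of _ "{{u, v}}"]) simp
                then show "Q (t1 + m + (t3 + (t4 + t5))) M5" by (simp add: add.assoc)
              qed
            qed
            done
        qed
        done
      show ?thesis using in1 uv(1,2) unfolding delete_edge_def
        apply (simp add: runs_If runs_Seq[of _ "Write a c d" for a c d] runs_Write)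
        apply (fold M2_def)
        apply (rule runs_conseq[OF rest])
        apply (erule allE[of _ 11])
        apply (simp add: algebra_simps)
        done
    qed
    done
  then show ?thesis unfolding Q_def M0_def .
qed

end

section \<open>Update sequences\<close>

lemma graph_after_Suc:
  "i < length us \<Longrightarrow> graph_after us (Suc i) = apply_update (us ! i) (graph_after us i)"
  by (simp add: graph_after_def take_Suc_conv_app_nth)

lemma graph_on_graph_after:
  "valid_updates n \<alpha> us \<Longrightarrow> i \<le> length us \<Longrightarrow> graph_on n (graph_after us i)"
proof (induction i)
  case 0
  show ?case by (simp add: graph_after_def graph_on_def)
next
  case (Suc i)
  then have g: "graph_on n (graph_after us i)" and v: "valid_update n (graph_after us i) (us ! i)"
    by (auto simp: valid_updates_def)
  show ?case
  proof (cases "us ! i")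
    case (Insert u v)
    then show ?thesis using g v Suc.prems(2) by (auto simp: graph_after_Suc graph_on_def)
  next
    case (Delete u v)
    then show ?thesis using g Suc.prems(2) by (auto simp: graph_after_Suc graph_on_def)
  qed
qed

lemma card_adj_le_overall:
  assumes "valid_updates n \<alpha> us" "i \<le> length us" "x < n"
  shows "card (adj (graph_after us i) x) \<le> overall_max_degree n us"
proof -
  have "card (adj (graph_after us i) x) = degree (graph_after us i) x"
    using degree_eq_card_adj[OF graph_on_graph_after[OF assms(1,2)]] by simp
  also have "\<dots> \<le> max_degree n (graph_after us i)"
    unfolding max_degree_def using assms(3) by (intro Max_ge) auto
  also have "\<dots> \<le> overall_max_degree n us"
    unfolding overall_max_degree_def using assms(2) by (intro Max_ge) auto
  finally show ?thesis .
qed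

text \<open>The first update of a valid sequence has to be an insertion, and its single edge already
  forces all three bounds.\<close>

lemma valid_updates_nonempty:
  assumes v: "valid_updates n \<alpha> us" and ne: "us \<noteq> []"
  shows "2 \<le> n" "1 \<le> \<alpha>" "1 \<le> overall_max_degree n us"
proof -
  have len: "0 < length us" using ne by simp
  then have v0: "valid_update n {} (us ! 0)" using v by (force simp: valid_updates_def graph_after_def)
  then obtain x y where u: "us ! 0 = Insert x y" and xy: "x < n" "y < n" "x \<noteq> y"
    by (cases "us ! 0") auto
  then show "2 \<le> n" by linarith
  have g1: "graph_after us 1 = {{x, y}}"
    using graph_after_Suc[of 0 us] len u by (simp add: graph_after_def One_nat_def)
  have "induced_edges {{x, y}} {x, y} = {{x, y}}" by (auto simp: induced_edges_def)
  moreover have "card (induced_edges (graph_after us 1) {x, y}) \<le> \<alpha> * card {x, y}"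
  proof (rule arboricity_bound)
    have 1: "1 \<le> length us" using len by linarith
    show "graph_on n (graph_after us 1)" by (rule graph_on_graph_after[OF v 1])
    show "arboricity {..<n} (graph_after us 1) \<le> \<alpha>" using v 1 unfolding valid_updates_def by blast
  qed (use xy in auto)
  ultimately show "1 \<le> \<alpha>" using g1 by (cases \<alpha>) auto
  have "adj {{x, y}} x = {y}" using xy by (auto simp: adj_def doubleton_eq_iff)
  then have "card (adj (graph_after us 1) x) = 1" using g1 by simp
  then show "1 \<le> overall_max_degree n us" using card_adj_le_overall[OF v, of 1 x] len xy
    by (simp add: Suc_le_eq)
qed

context coloring_ram
begin

lemma stored_coloring_represented:
  assumes r: "represents S l M"
  shows "stored_coloring n (dom S) M = (\<lambda>e. map_option (\<lambda>(c, j). c + 1) (S e))"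
proof
  fix e
  show "stored_coloring n (dom S) M e = map_option (\<lambda>(c, j). c + 1) (S e)"
  proof (cases "S e")
    case None
    then have "e \<notin> dom S" by auto
    then show ?thesis using None by (simp add: stored_coloring_def)
  next
    case (Some x)
    obtain c j where cj: "S e = Some (c, j)" using Some by (cases x) simp
    have S: "valid_state S" using r by (simp add: represents_def)
    have "e \<in> dom S" using cj by blast
    then obtain u v where "e = {u, v}" "u \<noteq> v" using S unfolding valid_state_def graph_on_def by blast
    then have "e = {Min e, Max e}" by (auto simp: min_def max_def)
    then have "S {Min e, Max e} = Some (c, j)" using cj by simp
    then have "M 1 (Min e * n + Max e) = c + 1" using r unfolding represents_def by blast
    then show ?thesis using \<open>e \<in> dom S\<close> cj by (simp add: stored_coloring_def)
  qed
qed

lemma invariant_proper: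
  assumes inv: "invariant D E S l M" and X: "real (D + K) \<le> X"
  shows "proper_edge_coloring X E (stored_coloring n E M)"
proof -
  have r: "represents S l M" and E: "dom S = E" and bnd: "\<And>e c j. S e = Some (c, j) \<Longrightarrow> c < D + K"
    using inv by (auto simp: invariant_def)
  have S: "valid_state S" using r by (simp add: represents_def)
  have col: "stored_coloring n E M = (\<lambda>e. map_option (\<lambda>(c, j). c + 1) (S e))"
    using stored_coloring_represented[OF r] E by simp
  show ?thesis unfolding proper_edge_coloring_def col
  proof (intro conjI ballI impI)
    show "dom (\<lambda>e. map_option (\<lambda>(c, j). c + 1) (S e)) = E" using E by (auto simp: dom_def)
    show "ran (\<lambda>e. map_option (\<lambda>(c, j). c + 1) (S e)) \<subseteq> {1..nat \<lfloor>X\<rfloor>}"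
    proof
      fix k assume "k \<in> ran (\<lambda>e. map_option (\<lambda>(c, j). c + 1) (S e))"
      then obtain e c j where e: "S e = Some (c, j)" "k = c + 1" by (auto simp: ran_def)
      have "real k \<le> real (D + K)" using bnd[OF e(1)] e(2) by simp
      then have "k \<le> nat \<lfloor>X\<rfloor>" using X by (intro le_nat_floor) linarith
      then show "k \<in> {1..nat \<lfloor>X\<rfloor>}" using e(2) by simp
    qed
    fix e f assume e: "e \<in> E" and f: "f \<in> E" and ef: "e \<noteq> f \<and> e \<inter> f \<noteq> {}"
    then obtain v where v: "v \<in> e" "v \<in> f" by blast
    have pair: "\<exists>w. e = {v, w}" if "e \<in> E" "v \<in> e" for e
    proof -
      obtain a b where "e = {a, b}" using S E \<open>e \<in> E\<close> unfolding valid_state_def graph_on_def by blast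
      then show ?thesis using \<open>v \<in> e\<close> by (auto simp: insert_commute)
    qed
    obtain w w' where w: "e = {v, w}" "f = {v, w'}" using pair e f v by meson
    obtain c j c' j' where c: "S e = Some (c, j)" "S f = Some (c', j')" using e f E by (auto simp: dom_def)
    have "c \<noteq> c'" using S ef c unfolding w valid_state_def by blast
    then show "map_option (\<lambda>(c, j). c + 1) (S e) \<noteq> map_option (\<lambda>(c, j). c + 1) (S f)" using c by simp
  qed
qed

lemma invariant_recourse:
  assumes "invariant D E S l M" "invariant D E' S' l' M'" and R: "finite R"
    and eq: "\<And>e. e \<notin> R \<Longrightarrow> map_option fst (S' e) = map_option fst (S e)"
  shows "recourse (stored_coloring n E M) (stored_coloring n E' M') \<le> card R"
proof -
  have col: "stored_coloring n E M = (\<lambda>e. map_option (\<lambda>(c, j). c + 1) (S e))"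
    "stored_coloring n E' M' = (\<lambda>e. map_option (\<lambda>(c, j). c + 1) (S' e))"
    using stored_coloring_represented assms(1,2) by (auto simp: invariant_def)
  have "map_option (\<lambda>(c, j). c + 1) x = map_option (\<lambda>(c, j). c + 1) y"
    if "map_option fst x = map_option fst y" for x y :: "(nat \<times> nat) option"
    using that by (cases x; cases y) auto
  then have "{e. stored_coloring n E M e \<noteq> stored_coloring n E' M' e} \<subseteq> R"
    unfolding col using eq by (metis (mono_tags, lifting) mem_Collect_eq subsetI)
  then show ?thesis unfolding recourse_def by (rule card_mono[OF R])
qed

lemma invariant_initial: "invariant D {} (\<lambda>_. None) (\<lambda>_. 0) (initial_memory n \<alpha>)"
proof -
  have "colors (\<lambda>_. None) v j = {}" for v j by (simp add: colors_def)
  moreover have "0 < full" using full_plus B_bounds(6) by linarith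
  moreover have "deg_above {} l v i = 0" for l v i by (simp add: deg_above_def adj_def)
  ultimately show ?thesis
    by (simp add: invariant_def represents_def valid_state_def graph_on_def initial_memory_def
        tree_count_def consistent_def up_viol_def down_viol_def)
qed

text \<open>States and levels exist only from one update to the next, so the run is assembled by
  dependent choice. The levels are carried along so that the potential telescopes, and they are
  pinned to 0 at the start, where the potential vanishes.\<close>

lemma run_exists:
  assumes v: "valid_updates n \<alpha> us"
  defines "D \<equiv> overall_max_degree n us"
  shows "\<exists>M t. is_run W (coloring_program N) n \<alpha> us M t \<and>
    (\<forall>i \<le> length us. \<exists>S l. invariant D (graph_after us i) S l (M i)) \<and>
    (\<forall>i < length us. recourse (stored_coloring n (graph_after us i) (M i))
       (stored_coloring n (graph_after us (Suc i)) (M (Suc i))) \<le> L + 1) \<and>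
    (\<Sum>i<length us. t i) \<le> length us * (C * (50 * N * L))"
proof -
  let ?G = "graph_after us"
  let ?P = "\<lambda>i (M, S, l). (i = 0 \<longrightarrow> M = initial_memory n \<alpha> \<and> l = (\<lambda>_. 0)) \<and> (i \<le> length us \<longrightarrow> invariant D (?G i) S l M)"
  let ?step = "\<lambda>i (M, S, l) (M', S', l') t. exec W (coloring_program N) (input_update (us ! i) M) t M' \<and>
    recourse (stored_coloring n (?G i) M) (stored_coloring n (?G (Suc i)) M') \<le> L + 1 \<and>
    N * t + 2 * C * pot (?G (Suc i)) l' \<le> 2 * C * pot (?G i) l + N * (C * (50 * N * L))"
  have "\<exists>f. \<forall>i. ?P i (f i) \<and> (i < length us \<longrightarrow> (\<exists>t. ?step i (f i) (f (Suc i)) t))"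
  proof (rule dependent_nat_choice)
    have "?G 0 = {}" by (simp add: graph_after_def)
    then show "\<exists>x. ?P 0 x" using invariant_initial[of D]
      by (intro exI[of _ "(initial_memory n \<alpha>, \<lambda>_. None, \<lambda>_. 0)"]) simp
  next
    fix x i assume Pi: "?P i x"
    obtain M S l where x: "x = (M, S, l)" by (cases x)
    show "\<exists>y. ?P (Suc i) y \<and> (i < length us \<longrightarrow> (\<exists>t. ?step i x y t))"
    proof (cases "i < length us")
      case True
      have inv: "invariant D (?G i) S l M" using Pi True x by simp
      have g: "graph_on n (?G i)" using graph_on_graph_after[OF v] True by simp
      have ab: "arboricity {..<n} (?G i) \<le> \<alpha>" "arboricity {..<n} (?G (Suc i)) \<le> \<alpha>"
        using v True by (auto simp: valid_updates_def)
      have deg: "card (adj (?G (Suc i)) y) \<le> D" if "y < n" for y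
        using card_adj_le_overall[OF v _ that, of "Suc i"] True by (simp add: D_def)
      have vu: "valid_update n (?G i) (us ! i)" using v True by (simp add: valid_updates_def)
      have "runs W (coloring_program N) (input_update (us ! i) M) (update_post D (?G i) (?G (Suc i)) S l)"
      proof (cases "us ! i")
        case (Insert u w)
        then have G: "?G (Suc i) = insert {u, w} (?G i)" using True by (simp add: graph_after_Suc)
        show ?thesis unfolding G Insert
          by (rule runs_insert[OF inv g ab(1)]) (use vu Insert ab(2) deg G in auto)
      next
        case (Delete u w)
        then have G: "?G (Suc i) = ?G i - {{u, w}}" using True by (simp add: graph_after_Suc)
        show ?thesis unfolding G Delete
          by (rule runs_delete[OF inv g ab(1)]) (use vu Delete in auto)
      qed
      then obtain t M' S' l' R where ex: "exec W (coloring_program N) (input_update (us ! i) M) t M'"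
        and inv': "invariant D (?G (Suc i)) S' l' M'" and R: "finite R" "card R \<le> L + 1"
          "\<forall>e. e \<notin> R \<longrightarrow> map_option fst (S' e) = map_option fst (S e)"
        and am: "N * t + 2 * C * pot (?G (Suc i)) l' \<le> 2 * C * pot (?G i) l + N * (C * (50 * N * L))"
        unfolding runs_def by blast
      have "recourse (stored_coloring n (?G i) M) (stored_coloring n (?G (Suc i)) M') \<le> L + 1"
        using invariant_recourse[OF inv inv' R(1)] R(2,3) by (meson order_trans)
      then show ?thesis using ex inv' am x by (intro exI[of _ "(M', S', l')"]) auto
    qed (auto intro!: exI[of _ x] simp: x)
  qed
  then obtain f where f0: "\<forall>i. ?P i (f i) \<and> (i < length us \<longrightarrow> (\<exists>t. ?step i (f i) (f (Suc i)) t))" by (rule exE)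
  have f: "?P i (f i)" for i by (rule f0[rule_format, THEN conjunct1])
  define t where "t i = (SOME t. ?step i (f i) (f (Suc i)) t)" for i
  have t: "?step i (f i) (f (Suc i)) (t i)" if "i < length us" for i
    unfolding t_def by (rule someI_ex) (rule f0[rule_format, THEN conjunct2, rule_format, OF that])
  define M where "M i = fst (f i)" for i
  define l where "l i = snd (snd (f i))" for i
  have am: "N * t i + 2 * C * pot (?G (Suc i)) (l (Suc i)) \<le> 2 * C * pot (?G i) (l i) + N * (C * (50 * N * L))"
    if "i < length us" for i using t[OF that] by (simp add: l_def split: prod.splits)
  have "N * (\<Sum>i<k. t i) + 2 * C * pot (?G k) (l k) \<le> N * (k * (C * (50 * N * L)))" if "k \<le> length us" for k
    using that
  proof (induction k)
    case 0
    have "l 0 = (\<lambda>_. 0)" using f[of 0] by (simp add: l_def split: prod.splits)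
    then show ?case by (simp add: pot_def potential_def node_pot_def graph_after_def)
  next
    case (Suc k)
    then have "N * (\<Sum>i<k. t i) + 2 * C * pot (?G k) (l k) \<le> N * (k * (C * (50 * N * L)))" by simp
    moreover have "N * (\<Sum>i<Suc k. t i) = N * (\<Sum>i<k. t i) + N * t k" by (simp add: distrib_left)
    moreover have "N * (Suc k * (C * (50 * N * L))) = N * (k * (C * (50 * N * L))) + N * (C * (50 * N * L))"
      by (simp add: algebra_simps)
    ultimately show ?case using am[of k] Suc.prems by linarith
  qed
  from this[of "length us"] have "N * (\<Sum>i<length us. t i) \<le> N * (length us * (C * (50 * N * L)))" by linarith
  then have "(\<Sum>i<length us. t i) \<le> length us * (C * (50 * N * L))" using N_ge by simp
  moreover have "is_run W (coloring_program N) n \<alpha> us M t"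
  proof -
    have "M 0 = initial_memory n \<alpha>" using f[of 0] by (auto simp: M_def split: prod.splits)
    moreover have "exec W (coloring_program N) (input_update (us ! i) (M i)) (t i) (M (Suc i))"
      if "i < length us" for i using t[OF that] by (simp add: M_def split: prod.splits)
    ultimately show ?thesis by (simp add: is_run_def)
  qed
  moreover have "\<exists>S l. invariant D (?G i) S l (M i)" if "i \<le> length us" for i
    using f[of i] that by (auto simp: M_def split: prod.splits)
  moreover have "recourse (stored_coloring n (?G i) (M i)) (stored_coloring n (?G (Suc i)) (M (Suc i))) \<le> L + 1"
    if "i < length us" for i using t[OF that] by (simp add: M_def split: prod.splits)
  ultimately show ?thesis by blast
qed

end

text \<open>Each quantity is built from few factors bounded by small powers of \<open>A\<close>, the
  numerals being absorbed through \<open>5 \<le> A\<close>. The exponent 20 is generous.\<close>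

lemma word_bounds:
  fixes n \<alpha> q H A :: nat
  assumes A: "5 \<le> A" "n \<le> A" "\<alpha> \<le> A" "q \<le> A" and H: "2 ^ H < 4 * n"
  shows "(4 * (5 * q) * 2 ^ H) ^ 3 \<le> A ^ 20" (is ?idx)
    and "(4 * (5 * q) + 5) * \<alpha> < A ^ 20" (is ?thr)
    and "2 * (5 * q * (n * n * (4 * (2 * (5 * q) * H) + 2)) +
      5 * (n * (2 * (5 * q) * H * ((2 * (5 * q) + 1) ^ 2 * \<alpha>)))) + 4 * (5 * q) < A ^ 20" (is ?stk)
proof -
  have pw: "k \<le> A ^ j" if "k \<le> 5 ^ j" for k j :: nat
    using that power_mono[OF A(1), of j] by simp
  have mul: "x * y \<le> A ^ (i + j)" if "x \<le> A ^ i" "y \<le> A ^ j" for x y i j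
    unfolding power_add by (rule mult_mono[OF that]) auto
  have up: "x \<le> A ^ j" if "x \<le> A ^ i" "i \<le> j" for x i j
    using that(1) power_increasing[OF that(2), of A] A(1) by linarith
  have n1: "n \<le> A ^ 1" "\<alpha> \<le> A ^ 1" "q \<le> A ^ 1" using A by auto
  have N: "5 * q \<le> A ^ 2" using mul[OF pw[of 5 1] n1(3)] by simp
  have P: "2 ^ H \<le> A ^ 2"
  proof -
    have "4 * n \<le> A ^ 2" using mul[OF pw[of 4 1] n1(1)] by simp
    then show ?thesis using H by linarith
  qed
  have "H < 2 ^ H" by (rule less_exp)
  then have H2: "H \<le> A ^ 2" using P by linarith
  have "4 * (5 * q) \<le> A ^ 3" using mul[OF pw[of 4 1] N] by simp
  from mul[OF this P] have "4 * (5 * q) * 2 ^ H \<le> A ^ 5" by simp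
  then have "(4 * (5 * q) * 2 ^ H) ^ 3 \<le> (A ^ 5) ^ 3" by (rule power_mono) simp
  then have "(4 * (5 * q) * 2 ^ H) ^ 3 \<le> A ^ 15" by (simp add: power_mult[symmetric])
  then show ?idx by (rule up) simp
  have lt: "A ^ 18 < A ^ 20" using A by (intro power_strict_increasing) auto
  have add: "x + y \<le> A ^ Suc i" if "x \<le> A ^ i" "y \<le> A ^ i" for x y i
  proof -
    have "x + y \<le> 2 * A ^ i" using that by simp
    also have "\<dots> \<le> A * A ^ i" using A by (intro mult_right_mono) auto
    finally show ?thesis by simp
  qed
  have "4 * (5 * q) + 5 \<le> A ^ Suc 3" by (rule add[OF \<open>4 * (5 * q) \<le> A ^ 3\<close>]) (rule pw, simp)
  from mul[OF this n1(2)] have "(4 * (5 * q) + 5) * \<alpha> \<le> A ^ 5" by simp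
  then have "(4 * (5 * q) + 5) * \<alpha> \<le> A ^ 18" by (rule up) simp
  then show ?thr using lt by linarith
  have tN: "2 * (5 * q) \<le> A ^ 3" using mul[OF pw[of 2 1] N] by simp
  from mul[OF this H2] have L: "2 * (5 * q) * H \<le> A ^ 5" by simp
  have "4 * (2 * (5 * q) * H) \<le> A ^ 6" using mul[OF pw[of 4 1] L] by simp
  then have L2: "4 * (2 * (5 * q) * H) + 2 \<le> A ^ Suc 6" by (rule add) (rule pw, simp)
  have nn: "n * n \<le> A ^ 2" using mul[OF n1(1) n1(1)] by (simp add: numeral_2_eq_2)
  have "n * n * (4 * (2 * (5 * q) * H) + 2) \<le> A ^ 9" using mul[OF nn L2] by simp
  from mul[OF N this] have X: "5 * q * (n * n * (4 * (2 * (5 * q) * H) + 2)) \<le> A ^ 11" by simp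
  have "2 * (5 * q) + 1 \<le> A ^ Suc 3" by (rule add[OF tN]) (rule pw, simp)
  then have "(2 * (5 * q) + 1) ^ 2 \<le> (A ^ Suc 3) ^ 2" by (rule power_mono) simp
  then have "(2 * (5 * q) + 1) ^ 2 \<le> A ^ 8" by (simp add: power_mult[symmetric])
  from mul[OF this n1(2)] have "(2 * (5 * q) + 1) ^ 2 * \<alpha> \<le> A ^ 9" by simp
  from mul[OF L this] have "2 * (5 * q) * H * ((2 * (5 * q) + 1) ^ 2 * \<alpha>) \<le> A ^ 14" by simp
  from mul[OF n1(1) this] have "n * (2 * (5 * q) * H * ((2 * (5 * q) + 1) ^ 2 * \<alpha>)) \<le> A ^ 15" by simp
  from mul[OF pw[of 5 1] this]
  have Y: "5 * (n * (2 * (5 * q) * H * ((2 * (5 * q) + 1) ^ 2 * \<alpha>))) \<le> A ^ 16" by simp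
  let ?X = "5 * q * (n * n * (4 * (2 * (5 * q) * H) + 2))"
  let ?Y = "5 * (n * (2 * (5 * q) * H * ((2 * (5 * q) + 1) ^ 2 * \<alpha>)))"
  have "?X \<le> A ^ 16" using X by (rule up) simp
  moreover have "4 * (5 * q) \<le> A ^ 16" using \<open>4 * (5 * q) \<le> A ^ 3\<close> by (rule up) simp
  moreover have "2 * (x + y) + z \<le> 5 * a" if "x \<le> a" "y \<le> a" "z \<le> a" for x y z a :: nat
  proof -
    have "2 * (x + y) + z \<le> 2 * (a + a) + a" by (intro add_mono mult_left_mono that) simp
    then show ?thesis by simp
  qed
  ultimately have "2 * (?X + ?Y) + 4 * (5 * q) \<le> 5 * A ^ 16" using Y by blast
  also have "\<dots> \<le> A * A ^ 16" using A by (intro mult_right_mono) auto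
  also have "\<dots> = A ^ 17" by (simp flip: power_Suc)
  also have "\<dots> \<le> A ^ 18" using A by (intro power_increasing) auto
  finally show ?stk using lt by linarith
qed

text \<open>Minimality of \<open>H\<close> gives \<open>2 ^ H < 4 * n\<close>, hence H < 2 + log n;
  as log n \<ge> 1, additive constants turn into factors.\<close>

lemma height_exists:
  assumes "2 \<le> n"
  obtains H where "2 * n \<le> 2 ^ H" "2 ^ H < 4 * n" "real H + 2 \<le> 5 * log 2 (real n)" "real H \<le> 3 * log 2 (real n)"
proof -
  define H where "H = (LEAST h. 2 * n \<le> 2 ^ h)"
  have "2 * n \<le> 2 ^ (2 * n)" using less_exp[of "2 * n"] by simp
  then have ge: "2 * n \<le> 2 ^ H" unfolding H_def by (rule LeastI)
  have "H \<noteq> 0" using ge assms by (intro notI) simp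
  then obtain h where h: "H = Suc h" using not0_implies_Suc by blast
  have "\<not> 2 * n \<le> 2 ^ h" using not_less_Least[of h "\<lambda>h. 2 * n \<le> 2 ^ h"] h by (simp add: H_def)
  then have lt: "2 ^ H < 4 * n" using h by simp
  have "real (2 ^ H) < real (4 * n)" using lt by (simp only: of_nat_less_iff)
  then have "2 powr real H < 4 * real n" by (simp add: powr_realpow)
  then have "real H < log 2 (4 * real n)" using assms by (simp add: less_log_iff)
  also have "\<dots> = log 2 4 + log 2 (real n)" using assms by (simp add: log_mult)
  also have "log 2 4 = (2::real)" using log_pow_cancel[of 2 2] by simp
  finally have "real H < 2 + log 2 (real n)" .
  moreover have "1 \<le> log 2 (real n)" using assms by (simp add: le_log_iff)
  ultimately show thesis using that[OF ge lt] by linarith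
qed

theorem theorem3p1:
  "\<exists>(c_word::nat) (c_rec::real) (c_time::real). \<forall>\<epsilon>::real. 0 < \<epsilon> \<and> \<epsilon> < 1 \<longrightarrow>
     (\<exists>p::com. \<forall>(n::nat) (\<alpha>::nat) (us::update list). valid_updates n \<alpha> us \<longrightarrow>
       (\<exists>(M::nat \<Rightarrow> memory) (t::nat \<Rightarrow> nat).
          is_run ((n + \<alpha> + nat \<lceil>1 / \<epsilon>\<rceil>) ^ c_word) p n \<alpha> us M t \<and>
          (\<forall>i \<le> length us.
             proper_edge_coloring (real (overall_max_degree n us) + (4 + \<epsilon>) * real \<alpha>)
               (graph_after us i) (stored_coloring n (graph_after us i) (M i))) \<and>
          (\<forall>i < length us.
             real (recourse (stored_coloring n (graph_after us i) (M i))
                      (stored_coloring n (graph_after us (Suc i)) (M (Suc i))))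
               \<le> c_rec * (log 2 (real n) / \<epsilon>)) \<and>
          real (\<Sum>i<length us. t i)
            \<le> c_time * (real (length us) *
                 ((log 2 (real n))\<^sup>2 * log 2 (real (overall_max_degree n us) + 1) / \<epsilon>\<^sup>2))))"
\<comment> \<open>The exponent is that of \<open>word_bounds\<close>. Recourse is at most L + 1,
  with L at most 60 log n / \<epsilon>; the time constant rounds up 3120 * 50 * 10 * 60 =
  93600000.\<close>
proof (rule exI[of _ 20], rule exI[of _ 100], rule exI[of _ 100000000], intro allI impI, goal_cases)
  case (1 \<epsilon>)
  then have \<epsilon>: "0 < \<epsilon>" "\<epsilon> < 1" by auto
  define q where "q = nat \<lceil>1 / \<epsilon>\<rceil>"
  have e1: "1 < 1 / \<epsilon>" using \<epsilon> by simp
  then have "real q = real_of_int \<lceil>1 / \<epsilon>\<rceil>" unfolding q_def by simp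
  then have q: "1 / \<epsilon> \<le> real q" "real q < 1 / \<epsilon> + 1" by linarith+
  have q2: "2 \<le> q" using q(1) e1 by linarith
  \<comment> \<open>This gives 5/N \<le> \<epsilon>, so that \<open>K\<close> stays within (4 +
    \<epsilon>) \<alpha>.\<close>
  define N where "N = 5 * q"
  have N: "real N \<le> 10 / \<epsilon>" using q(2) e1 unfolding N_def by (simp add: field_simps)
  show ?case
  proof (rule exI[of _ "coloring_program N"], intro allI impI, goal_cases)
    case (1 n \<alpha> us)
    note v = 1
    show ?case
    \<comment> \<open>\<open>2 \<le> n\<close> and \<open>1 \<le> \<alpha>\<close> are available
      only for a nonempty sequence; for the empty one nothing is executed and the empty coloring
      suffices.\<close>
    proof (cases "us = []")
      case True
      then show ?thesis
        by (intro exI[of _ "\<lambda>_. initial_memory n \<alpha>"] exI[of _ "\<lambda>_. 0"])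
          (simp add: is_run_def graph_after_def proper_edge_coloring_def stored_coloring_def)
    next
      case False
      note ne = valid_updates_nonempty[OF v False]
      obtain H where H: "2 * n \<le> 2 ^ H" "2 ^ H < 4 * n"
        "real H + 2 \<le> 5 * log 2 (real n)" "real H \<le> 3 * log 2 (real n)"
        by (rule height_exists[OF ne(1)])
      let ?A = "n + \<alpha> + nat \<lceil>1 / \<epsilon>\<rceil>"
      interpret coloring_ram n \<alpha> N H "?A ^ 20"
      proof
        have A: "5 \<le> ?A" "n \<le> ?A" "\<alpha> \<le> ?A" "q \<le> ?A" using ne q2 by (auto simp: q_def)
        note w = word_bounds[OF A H(2), folded N_def]
        show "(4 * N * 2 ^ H) ^ 3 \<le> ?A ^ 20" by (rule w(1))
        show "(4 * N + 5) * \<alpha> < ?A ^ 20" by (rule w(2))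
        show "2 * (N * (n * n * (4 * (2 * N * H) + 2)) + 5 * (n * (2 * N * H * ((2 * N + 1) ^ 2 * \<alpha>)))) + 4 * N < ?A ^ 20"
          by (rule w(3))
      qed (use ne H q2 in \<open>auto simp: N_def\<close>)
      let ?lg = "log 2 (real n)" and ?D = "overall_max_degree n us"
      obtain M t where run: "is_run (?A ^ 20) (coloring_program N) n \<alpha> us M t"
        and inv: "\<And>i. i \<le> length us \<Longrightarrow> \<exists>S l. invariant ?D (graph_after us i) S l (M i)"
        and rec: "\<And>i. i < length us \<Longrightarrow> recourse (stored_coloring n (graph_after us i) (M i))
           (stored_coloring n (graph_after us (Suc i)) (M (Suc i))) \<le> L + 1"
        and time: "(\<Sum>i<length us. t i) \<le> length us * (C * (50 * N * L))"
        using run_exists[OF v] by blast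
      have lg: "1 \<le> ?lg" using ne(1) by (simp add: le_log_iff)
      have L: "real L \<le> 60 * (?lg / \<epsilon>)"
      proof -
        have "real L = 2 * (real N * real H)" by (simp add: L_def)
        also have "\<dots> \<le> 2 * ((10 / \<epsilon>) * (3 * ?lg))"
          by (intro mult_left_mono mult_mono N H(4)) (use \<epsilon> in auto)
        finally show ?thesis by simp
      qed
      have proper: "proper_edge_coloring (real ?D + (4 + \<epsilon>) * real \<alpha>)
          (graph_after us i) (stored_coloring n (graph_after us i) (M i))" if "i \<le> length us" for i
      proof -
        have "real K \<le> (4 + \<epsilon>) * real \<alpha>"
        proof -
          have "K * N \<le> (4 * N + 5) * \<alpha>" unfolding K_def by (rule div_times_less_eq_dividend)
          then have "real (K * N) \<le> real ((4 * N + 5) * \<alpha>)" by (simp only: of_nat_le_iff)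
          then have 1: "real K * real N \<le> (4 * real N + 5) * real \<alpha>" by simp
          have "5 \<le> \<epsilon> * real N" using q(1) \<epsilon> by (simp add: N_def field_simps)
          then have "(4 * real N + 5) * real \<alpha> \<le> (4 * real N + \<epsilon> * real N) * real \<alpha>"
            by (intro mult_right_mono) auto
          then have "real K * real N \<le> ((4 + \<epsilon>) * real \<alpha>) * real N" using 1 by (simp add: algebra_simps)
          then show ?thesis using N_ge by simp
        qed
        then have "real (?D + K) \<le> real ?D + (4 + \<epsilon>) * real \<alpha>" by simp
        then show ?thesis using inv[OF that] invariant_proper by blast
      qed
      have recourse: "real (recourse (stored_coloring n (graph_after us i) (M i))
           (stored_coloring n (graph_after us (Suc i)) (M (Suc i)))) \<le> 100 * (?lg / \<epsilon>)" if "i < length us" for i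
      proof -
        have "1 * 1 \<le> ?lg * (1 / \<epsilon>)" by (intro mult_mono) (use lg e1 in auto)
        moreover have "real (recourse (stored_coloring n (graph_after us i) (M i))
           (stored_coloring n (graph_after us (Suc i)) (M (Suc i)))) \<le> real L + 1" using rec[OF that] by linarith
        ultimately show ?thesis using L by simp
      qed
      \<comment> \<open>A factor of at least 1, by which the estimate of the time may be multiplied
        to reach the stated form.\<close>
      have D: "1 \<le> log 2 (real ?D + 1)" using ne(3) by (simp add: le_log_iff)
      have "real (\<Sum>i<length us. t i) \<le> real (length us * (C * (50 * N * L)))" using time by (simp only: of_nat_le_iff)
      also have "\<dots> = real (length us) * (real C * (50 * real N * real L))" by simp
      also have "\<dots> \<le> real (length us) * ((3120 * ?lg) * (50 * (10 / \<epsilon>) * (60 * (?lg / \<epsilon>))))"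
      proof (intro mult_left_mono mult_mono)
        have "real C = 600 * (real H + 2) + 120" by (simp add: C_def)
        also have "\<dots> \<le> 600 * (5 * ?lg) + 120 * ?lg" by (intro add_mono mult_left_mono H(3)) (use lg in auto)
        finally show "real C \<le> 3120 * ?lg" by simp
      qed (use N L lg \<epsilon> in auto)
      also have "\<dots> = 93600000 * (real (length us) * (?lg\<^sup>2 * 1 / \<epsilon>\<^sup>2))" by (simp add: power2_eq_square)
      also have "\<dots> \<le> 100000000 * (real (length us) * (?lg\<^sup>2 * log 2 (real ?D + 1) / \<epsilon>\<^sup>2))"
        by (intro mult_mono mult_left_mono divide_right_mono) (use D \<epsilon> in auto)
      finally show ?thesis using run proper recourse by blast
    qed
  qed
qed

end
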